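(* Let $J\in\{I,J_1,J_+\}$ and let $G$ be an abelian group. For any closure space $X$ the singular simplicial cochain complex $C_J^\bullet(X;G)$ and the singular cubical cochain complex $C_{(J,\times)}^\bullet(X;G)$ are cochain homotopy equivalent: $C_J^\bullet(X;G)\simeq C_{(J,\times)}^\bullet(X;G)$.
   Context: A closure space $(X,c)$ is a set $X$ with a map $c:\mathcal P(X)\to\mathcal P(X)$ such that $c(\emptyset)=\emptyset$, $A\subseteq c(A)$, and $c(A\cup B)=c(A)\cup c(B)$. The interior is $i(A)=X\setminus c(X\setminus A)$, and $V$ is a neighborhood of $x$ if $x\in i(V)$. A map $f:(X,c)\to(Y,d)$ is continuous if $f(c(A))\subseteq d(f(A))$ for all $A\subseteq X$. Topological spaces are closure spaces via the topological closure. The product $X\times Y$ is the set product with the closure for which the sets $U\times V$ ($U$ a neighborhood of $x$, $V$ of $y$) form a neighborhood base at $(x,y)$. Spaces: $I=[0,1]$ with the usual topology; $J_1=\{0,1\}$ with the indiscrete closure; $J_+=\{0,1\}$ with $c(\{0\})=\{0,1\}$, $c(\{1\})=\{1\}$. Singular simplices: $|\Delta^n|^{I}$ is the standard topological $n$-simplex; $|\Delta^n|^{J_1}$ is $\{0,\dots,n\}$ with the indiscrete closure; $|\Delta^n|^{J_+}$ is $\{0,\dots,n\}$ with $c(\{i\})=\{j: j\ge i\}$. $C^J_n(X)$ is the free abelian group on continuous maps $\sigma:|\Delta^n|^J\to X$, with $\partial\sigma=\sum_{i=0}^n(-1)^i\sigma\circ d^i$, $d^i$ the $i$-th face inclusion.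 Singular cubes: $J^{\times n}$ is the $n$-fold product (a point if $n=0$). Let $Q_n(X)$ be the free abelian group on continuous maps $\sigma:J^{\times n}\to X$ and $D_n(X)$ the subgroup generated by the degenerate $\sigma$, i.e. those that do not depend on their $i$-th coordinate for some $1\le i\le n$. Then $C^{(J,\times)}_n(X)=Q_n(X)/D_n(X)$, with $\partial\sigma=\sum_{i=1}^n(-1)^i(A_i\sigma-B_i\sigma)$, where $A_i\sigma$ (resp. $B_i\sigma$) is $\sigma$ with $0$ (resp. $1$) inserted in the $i$-th coordinate. $C_J^\bullet(X;G)=\operatorname{Hom}_{\mathbb Z}(C^J_\bullet(X),G)$ and $C_{(J,\times)}^\bullet(X;G)=\operatorname{Hom}_{\mathbb Z}(C^{(J,\times)}_\bullet(X),G)$ with the induced coboundaries. *)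

theory Defs
  imports "HOL-Homology.Homology" "HOL-Algebra.Generated_Groups"
begin

section \<open>Closure spaces\<close>

text \<open>A closure space is given by its set of points and its closure operator; the values of the
  operator on sets that are not contained in the set of points are irrelevant.\<close>

record 'a cspace =
  pts :: "'a set"
  clo :: "'a set \<Rightarrow> 'a set"

definition closure_space :: "'a cspace \<Rightarrow> bool" where
  "closure_space X \<longleftrightarrow>
     clo X {} = {} \<and>
     (\<forall>A. A \<subseteq> pts X \<longrightarrow> A \<subseteq> clo X A \<and> clo X A \<subseteq> pts X) \<and>
     (\<forall>A B. A \<subseteq> pts X \<and> B \<subseteq> pts X \<longrightarrow> clo X (A \<union> B) = clo X A \<union> clo X B)"

definition cinterior :: "'a cspace \<Rightarrow> 'a set \<Rightarrow> 'a set" where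
  "cinterior X A = pts X - clo X (pts X - A)"

definition cnbhd :: "'a cspace \<Rightarrow> 'a \<Rightarrow> 'a set \<Rightarrow> bool" where
  "cnbhd X x V \<longleftrightarrow> V \<subseteq> pts X \<and> x \<in> cinterior X V"

definition ccontinuous :: "'a cspace \<Rightarrow> 'b cspace \<Rightarrow> ('a \<Rightarrow> 'b) \<Rightarrow> bool" where
  "ccontinuous X Y f \<longleftrightarrow>
     f ` pts X \<subseteq> pts Y \<and> (\<forall>A. A \<subseteq> pts X \<longrightarrow> f ` clo X A \<subseteq> clo Y (f ` A))"

text \<open>Maps out of \<open>X\<close> are represented by functions that are \<open>undefined\<close> off \<open>X\<close>, so that
  equality of maps is equality of functions.\<close>

definition cmaps :: "'a cspace \<Rightarrow> 'b cspace \<Rightarrow> ('a \<Rightarrow> 'b) set" where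
  "cmaps X Y = {f \<in> extensional (pts X). ccontinuous X Y f}"

definition cspace_of :: "'a topology \<Rightarrow> 'a cspace" where
  "cspace_of T = \<lparr>pts = topspace T, clo = (\<lambda>A. T closure_of A)\<rparr>"

definition indiscrete_cspace :: "'a set \<Rightarrow> 'a cspace" where
  "indiscrete_cspace S = \<lparr>pts = S, clo = (\<lambda>A. if A = {} then {} else S)\<rparr>"

text \<open>Product of a finite family: a point is in the closure of \<open>A\<close> iff every box of neighbourhoods
  of its coordinates meets \<open>A\<close>. This is the closure for which these boxes form a neighbourhood
  base, as made explicit in the lemma that follows.\<close>

definition cprod :: "'i set \<Rightarrow> ('i \<Rightarrow> 'a cspace) \<Rightarrow> ('i \<Rightarrow> 'a) cspace" where
  "cprod K Y =
     \<lparr>pts = (\<Pi>\<^sub>E k\<in>K. pts (Y k)),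
      clo = (\<lambda>A. {x \<in> (\<Pi>\<^sub>E k\<in>K. pts (Y k)).
                 \<forall>U. (\<forall>k\<in>K. cnbhd (Y k) (x k) (U k)) \<longrightarrow> (\<Pi>\<^sub>E k\<in>K. U k) \<inter> A \<noteq> {}})\<rparr>"

lemma cnbhd_cprod_iff:
  assumes "x \<in> pts (cprod K Y)"
  shows "cnbhd (cprod K Y) x V \<longleftrightarrow>
    V \<subseteq> pts (cprod K Y) \<and> (\<exists>U. (\<forall>k\<in>K. cnbhd (Y k) (x k) (U k)) \<and> (\<Pi>\<^sub>E k\<in>K. U k) \<subseteq> V)"
proof -
  have "(\<Pi>\<^sub>E k\<in>K. U k) \<subseteq> (\<Pi>\<^sub>E k\<in>K. pts (Y k))" if "\<forall>k\<in>K. cnbhd (Y k) (x k) (U k)" for U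
    using that by (intro PiE_mono) (simp add: cnbhd_def)
  then have "(\<Pi>\<^sub>E k\<in>K. U k) \<inter> ((\<Pi>\<^sub>E k\<in>K. pts (Y k)) - V) = {} \<longleftrightarrow> (\<Pi>\<^sub>E k\<in>K. U k) \<subseteq> V"
    if "\<forall>k\<in>K. cnbhd (Y k) (x k) (U k)" for U
    using that by blast
  then show ?thesis
    using assms unfolding cnbhd_def[of "cprod K Y"] cinterior_def[of "cprod K Y"]
    by (auto simp add: cprod_def)
qed


section \<open>Intervals and simplices\<close>

definition interval_I :: "real cspace" where
  "interval_I = cspace_of (top_of_set {0..1})"

definition interval_J1 :: "nat cspace" where
  "interval_J1 = indiscrete_cspace {0, 1}"

definition interval_Jplus :: "nat cspace" where
  "interval_Jplus = \<lparr>pts = {0, 1}, clo = (\<lambda>A. if 0 \<in> A then {0, 1} else A)\<rparr>"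

definition simplex_I :: "nat \<Rightarrow> (nat \<Rightarrow> real) cspace" where
  "simplex_I n = cspace_of (subtopology (powertop_real UNIV) (standard_simplex n))"

definition simplex_J1 :: "nat \<Rightarrow> nat cspace" where
  "simplex_J1 n = indiscrete_cspace {0..n}"

definition simplex_Jplus :: "nat \<Rightarrow> nat cspace" where
  "simplex_Jplus n = \<lparr>pts = {0..n}, clo = (\<lambda>A. {j \<in> {0..n}. \<exists>i\<in>A. i \<le> j})\<rparr>"

text \<open>The face inclusion omitting vertex \<open>i\<close>, for the simplices whose points are the vertices \<open>0, ..., n\<close>.
  Its counterpart for the topological simplices is \<open>simplical_face\<close>.\<close>

definition vertex_face :: "nat \<Rightarrow> nat \<Rightarrow> nat" where
  "vertex_face i j = (if j < i then j else Suc j)"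


section \<open>Chain and cochain complexes\<close>

text \<open>Complexes are concentrated in degrees \<open>n \<ge> 0\<close>. The differential \<open>bd C n\<close> goes from degree
  \<open>n + 1\<close> to degree \<open>n\<close>, and \<open>cobd C n\<close> goes from degree \<open>n\<close> to degree \<open>n + 1\<close>.\<close>

record 'a chain_cx =
  ch :: "nat \<Rightarrow> 'a monoid"
  bd :: "nat \<Rightarrow> 'a \<Rightarrow> 'a"

record 'a cochain_cx =
  coch :: "nat \<Rightarrow> 'a monoid"
  cobd :: "nat \<Rightarrow> 'a \<Rightarrow> 'a"

definition cochain_complex :: "'a cochain_cx \<Rightarrow> bool" where
  "cochain_complex C \<longleftrightarrow>
     (\<forall>n. comm_group (coch C n)) \<and>
     (\<forall>n. cobd C n \<in> hom (coch C n) (coch C (Suc n))) \<and>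
     (\<forall>n. \<forall>x\<in>carrier (coch C n). cobd C (Suc n) (cobd C n x) = \<one>\<^bsub>coch C (Suc (Suc n))\<^esub>)"

definition cochain_map :: "'a cochain_cx \<Rightarrow> 'b cochain_cx \<Rightarrow> (nat \<Rightarrow> 'a \<Rightarrow> 'b) \<Rightarrow> bool" where
  "cochain_map C D f \<longleftrightarrow>
     (\<forall>n. f n \<in> hom (coch C n) (coch D n)) \<and>
     (\<forall>n. \<forall>x\<in>carrier (coch C n). cobd D n (f n x) = f (Suc n) (cobd C n x))"

text \<open>In additive notation the condition is \<open>f - g = d h + h d\<close>, where the first summand is
  absent in degree 0.\<close>

definition cochain_homotopic ::
  "'a cochain_cx \<Rightarrow> 'b cochain_cx \<Rightarrow> (nat \<Rightarrow> 'a \<Rightarrow> 'b) \<Rightarrow> (nat \<Rightarrow> 'a \<Rightarrow> 'b) \<Rightarrow> bool" where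
  "cochain_homotopic C D f g \<longleftrightarrow>
     (\<exists>h. (\<forall>n. h n \<in> hom (coch C (Suc n)) (coch D n)) \<and>
          (\<forall>n. \<forall>x\<in>carrier (coch C n).
             f n x \<otimes>\<^bsub>coch D n\<^esub> inv\<^bsub>coch D n\<^esub> (g n x) =
             (case n of 0 \<Rightarrow> \<one>\<^bsub>coch D n\<^esub> | Suc m \<Rightarrow> cobd D m (h m x))
               \<otimes>\<^bsub>coch D n\<^esub> h n (cobd C n x)))"

definition cochain_homotopy_equivalent :: "'a cochain_cx \<Rightarrow> 'b cochain_cx \<Rightarrow> bool" where
  "cochain_homotopy_equivalent C D \<longleftrightarrow>
     cochain_complex C \<and> cochain_complex D \<and>
     (\<exists>f g. cochain_map C D f \<and> cochain_map D C g \<and>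
            cochain_homotopic C C (\<lambda>n x. g n (f n x)) (\<lambda>n x. x) \<and>
            cochain_homotopic D D (\<lambda>n y. f n (g n y)) (\<lambda>n y. y))"

definition Hom_group ::
  "('a, 'k) monoid_scheme \<Rightarrow> ('g, 'm) monoid_scheme \<Rightarrow> ('a \<Rightarrow> 'g) monoid" where
  "Hom_group A G =
     \<lparr>carrier = hom A G \<inter> extensional (carrier A),
      monoid.mult = (\<lambda>\<phi> \<psi>. \<lambda>x\<in>carrier A. \<phi> x \<otimes>\<^bsub>G\<^esub> \<psi> x),
      one = (\<lambda>x\<in>carrier A. \<one>\<^bsub>G\<^esub>)\<rparr>"

definition Hom_complex :: "'a chain_cx \<Rightarrow> ('g, 'm) monoid_scheme \<Rightarrow> ('a \<Rightarrow> 'g) cochain_cx" where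
  "Hom_complex C G =
     \<lparr>coch = (\<lambda>n. Hom_group (ch C n) G),
      cobd = (\<lambda>n \<phi>. \<lambda>x\<in>carrier (ch C (Suc n)). \<phi> (bd C n x))\<rparr>"

text \<open>The quotient of \<open>Q\<close> by subgroups \<open>D n\<close> that are compatible with the differentials; the induced
  differential sends the coset of \<open>x\<close> to the coset of \<open>bd Q n x\<close>.\<close>

definition quotient_complex :: "'a chain_cx \<Rightarrow> (nat \<Rightarrow> 'a set) \<Rightarrow> 'a set chain_cx" where
  "quotient_complex Q D =
     \<lparr>ch = (\<lambda>n. ch Q n Mod D n),
      bd = (\<lambda>n S. the_elem ((\<lambda>x. D n #>\<^bsub>ch Q n\<^esub> bd Q n x) ` S))\<rparr>"


section \<open>Singular simplicial chains\<close>

text \<open>\<open>\<Delta>\<close> and \<open>d\<close> are the simplices \<open>\<Delta> n\<close> and the face inclusions \<open>d i\<close> from \<open>\<Delta> n\<close> to \<open>\<Delta> (n + 1)\<close>.\<close>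

definition simplicial_chains ::
  "(nat \<Rightarrow> 's cspace) \<Rightarrow> (nat \<Rightarrow> 's \<Rightarrow> 's) \<Rightarrow> 'a cspace \<Rightarrow> (('s \<Rightarrow> 'a) \<Rightarrow>\<^sub>0 int) chain_cx" where
  "simplicial_chains \<Delta> d X =
     \<lparr>ch = (\<lambda>n. free_Abelian_group (cmaps (\<Delta> n) X)),
      bd = (\<lambda>n. frag_extend
        (\<lambda>\<sigma>. \<Sum>i\<le>Suc n. frag_cmul ((-1) ^ i) (frag_of (restrict (\<sigma> \<circ> d i) (pts (\<Delta> n))))))\<rparr>"


section \<open>Singular cubical chains\<close>

text \<open>Points of the \<open>n\<close>-fold power are functions on the index set \<open>{1..n}\<close>, extended by \<open>undefined\<close>.\<close>

definition cpower :: "'j cspace \<Rightarrow> nat \<Rightarrow> (nat \<Rightarrow> 'j) cspace" where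
  "cpower J n = cprod {1..n} (\<lambda>_. J)"

definition insert_coord :: "nat \<Rightarrow> 'j \<Rightarrow> (nat \<Rightarrow> 'j) \<Rightarrow> nat \<Rightarrow> 'j" where
  "insert_coord i a x = (\<lambda>j. if j < i then x j else if j = i then a else x (j - 1))"

definition cube_face ::
  "'j cspace \<Rightarrow> nat \<Rightarrow> nat \<Rightarrow> 'j \<Rightarrow> ((nat \<Rightarrow> 'j) \<Rightarrow> 'a) \<Rightarrow> (nat \<Rightarrow> 'j) \<Rightarrow> 'a" where
  "cube_face J n i a \<sigma> = restrict (\<sigma> \<circ> insert_coord i a) (pts (cpower J n))"

definition degenerate_cube :: "'j cspace \<Rightarrow> nat \<Rightarrow> ((nat \<Rightarrow> 'j) \<Rightarrow> 'a) \<Rightarrow> bool" where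
  "degenerate_cube J n \<sigma> \<longleftrightarrow>
     (\<exists>i\<in>{1..n}. \<forall>x\<in>pts (cpower J n). \<forall>t\<in>pts J. \<sigma> (x(i := t)) = \<sigma> x)"

definition cube_chains ::
  "'j::{zero, one} cspace \<Rightarrow> 'a cspace \<Rightarrow> (((nat \<Rightarrow> 'j) \<Rightarrow> 'a) \<Rightarrow>\<^sub>0 int) chain_cx" where
  "cube_chains J X =
     \<lparr>ch = (\<lambda>n. free_Abelian_group (cmaps (cpower J n) X)),
      bd = (\<lambda>n. frag_extend
        (\<lambda>\<sigma>. \<Sum>i = 1..Suc n. frag_cmul ((-1) ^ i)
               (frag_of (cube_face J n i 0 \<sigma>) - frag_of (cube_face J n i 1 \<sigma>))))\<rparr>"

definition degenerate_chains ::
  "'j::{zero, one} cspace \<Rightarrow> 'a cspace \<Rightarrow> nat \<Rightarrow> (((nat \<Rightarrow> 'j) \<Rightarrow> 'a) \<Rightarrow>\<^sub>0 int) set" where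
  "degenerate_chains J X n =
     generate (ch (cube_chains J X) n) (frag_of ` {\<sigma> \<in> cmaps (cpower J n) X. degenerate_cube J n \<sigma>})"

definition cubical_chains ::
  "'j::{zero, one} cspace \<Rightarrow> 'a cspace \<Rightarrow> (((nat \<Rightarrow> 'j) \<Rightarrow> 'a) \<Rightarrow>\<^sub>0 int) set chain_cx" where
  "cubical_chains J X = quotient_complex (cube_chains J X) (degenerate_chains J X)"

end

theory Submission
  imports Defs
begin

text \<open>The proof is by acyclic models, carried out in the preadditive category whose morphisms are
  integer combinations of continuous maps. There both boundary operators are right multiplications,
  by alternating sums \<open>dD n\<close> of faces and \<open>dQ n\<close> of cube faces, so natural transformations of chain
  functors are right multiplications as well, and each is determined by its value on the identity of
  the model. Chains on models are contractible: simplicial chains by a cone, cubical chains modulo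
  degenerate ones by a contraction parametrized by \<open>J\<close>. This yields, by induction on the degree,
  \<open>\<Phi> n\<close> from the cube to the simplex, \<open>\<Psi> n\<close> from the simplex to the cube, and the two homotopies.
  For right multiplication by \<open>\<Psi> n\<close> to be defined on the quotient by degenerate cubes, it must kill
  them; this holds if \<open>\<Psi> n\<close> is annihilated by the maps \<open>p n j\<close> setting the \<open>j\<close>-th coordinate to \<open>0\<close>,
  which is arranged by multiplying with the product of the \<open>1 - p n j\<close>.\<close>

section \<open>Chains and closure spaces\<close>

text \<open>The quotient by degenerate cubes is forced: a point has one cube in each dimension and
  every boundary vanishes, so unnormalized cubical chains of a point have homology in all degrees.
  But classes in a quotient are not combinations of maps. All constructions therefore take place
  among unnormalized chains, and cubical identities hold modulo degenerate ones. This makes the two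
  directions unequal. Right multiplication by \<open>\<Phi>\<close> arrives at cubical chains and
  may err by degenerate chains; right multiplication by \<open>\<Psi>\<close> or by the cubical
  homotopy leaves them and must kill degenerate cubes. Then \<open>\<Psi>\<close> also kills the
  error of \<open>\<Phi>\<close>, and the identities between simplicial chains become exact. The
  identity of the cube does not kill degenerate cubes, so the cubical homotopy ends at the projector
  \<open>nrm\<close>, which agrees with the identity up to degenerate chains. All topology sits in
  the contractions of simplices and cubes. They start at the vertex or corner 0; for
  \<open>interval_Jplus\<close>, whose closure is not symmetric, this direction matters.\<close>

definition chains :: "'a set \<Rightarrow> ('a \<Rightarrow>\<^sub>0 int) set" where
  "chains S = carrier (free_Abelian_group S)"

lemma chains_iff: "c \<in> chains S \<longleftrightarrow> Poly_Mapping.keys c \<subseteq> S"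
  by (simp add: chains_def)

lemma chains_0 [simp]: "0 \<in> chains S"
  by (simp add: chains_iff)

lemma chains_of [simp]: "frag_of x \<in> chains S \<longleftrightarrow> x \<in> S"
  by (simp add: chains_iff)

lemma chains_diff [intro]: "a \<in> chains S \<Longrightarrow> b \<in> chains S \<Longrightarrow> a - b \<in> chains S"
  using keys_diff[of a b] by (auto simp: chains_iff)

lemma chains_minus [intro]: "a \<in> chains S \<Longrightarrow> - a \<in> chains S"
  by (simp add: chains_iff)

lemma chains_add [intro]: "a \<in> chains S \<Longrightarrow> b \<in> chains S \<Longrightarrow> a + b \<in> chains S"
  using keys_add[of a b] by (auto simp: chains_iff)

lemma chains_cmul [intro]: "a \<in> chains S \<Longrightarrow> frag_cmul k a \<in> chains S"
  using keys_cmul[of k a] by (auto simp: chains_iff)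

lemma chains_sum [intro]: "(\<And>i. i \<in> I \<Longrightarrow> f i \<in> chains S) \<Longrightarrow> sum f I \<in> chains S"
  by (induction I rule: infinite_finite_induct) auto

lemma chains_mono: "S \<subseteq> T \<Longrightarrow> c \<in> chains S \<Longrightarrow> c \<in> chains T"
  by (auto simp: chains_iff)

lemma chains_induct [consumes 1, case_names zero one diff]:
  assumes "c \<in> chains S" "P 0" "\<And>x. x \<in> S \<Longrightarrow> P (frag_of x)"
    "\<And>a b. P a \<Longrightarrow> P b \<Longrightarrow> P (a - b)"
  shows "P c"
  using assms(1) unfolding chains_iff
  by (rule frag_induction) (use assms in auto)

lemma chains_frag_extend:
  assumes "c \<in> chains S" "\<And>x. x \<in> S \<Longrightarrow> f x \<in> chains T"
  shows "frag_extend f c \<in> chains T"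
  using assms(1) by (induction rule: chains_induct) (auto simp: assms(2) frag_extend_diff)

text \<open>Turns the generated subgroup in \<open>degenerate_chains\<close> into a condition on
  supports, so that degenerate chains admit the same induction as all chains.\<close>

lemma generate_free_Abelian_group:
  assumes "T \<subseteq> S"
  shows "generate (free_Abelian_group S) (frag_of ` T) = chains T"
proof -
  interpret group "free_Abelian_group S" by simp
  have T: "frag_of ` T \<subseteq> carrier (free_Abelian_group S)"
    using assms by auto
  show ?thesis
  proof
    have "subgroup (chains T) (free_Abelian_group S)"
      using assms by unfold_locales (auto simp: chains_iff dest: subsetD[OF keys_add])
    then show "generate (free_Abelian_group S) (frag_of ` T) \<subseteq> chains T"
      by (intro generate_subgroup_incl) auto
    show "chains T \<subseteq> generate (free_Abelian_group S) (frag_of ` T)"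
    proof
      fix c assume "c \<in> chains T"
      then have "c \<in> generate (free_Abelian_group S) (frag_of ` T) \<and> c \<in> carrier (free_Abelian_group S)"
      proof (induction rule: chains_induct)
        case zero
        then show ?case
          using generate.one[of "free_Abelian_group S"] by simp
      next
        case (one x)
        then show ?case
          using assms by (auto intro: generate.incl)
      next
        case (diff a b)
        then have b: "- b \<in> generate (free_Abelian_group S) (frag_of ` T)"
          using generate_m_inv_closed[OF T, of b] by simp
        have "a + - b \<in> generate (free_Abelian_group S) (frag_of ` T)"
          using generate.eng[of a "free_Abelian_group S" "frag_of ` T" "- b"] diff b by simp
        then show ?case
          using diff keys_diff[of a b] by auto
      qed
      then show "c \<in> generate (free_Abelian_group S) (frag_of ` T)" ..
    qed
  qed
qed

lemma frag_cmul_diff: "frag_cmul k (a - b) = frag_cmul k a - frag_cmul k b"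
  using frag_cmul_distrib2[of k a "- b"] frag_cmul_cmul[of k "- 1" b] frag_cmul_cmul[of "- 1" k b]
  by simp

text \<open>The sum of the coefficients, read off after sending every generator to one point. Its
  vanishing is the cycle condition in degree 0.\<close>

definition aug :: "('a \<Rightarrow>\<^sub>0 int) \<Rightarrow> int" where
  "aug c = Poly_Mapping.lookup (frag_extend (\<lambda>_. frag_of ()) c) ()"

lemma aug_simps [simp]:
  "aug 0 = 0" "aug (frag_of x) = 1" "aug (a + b) = aug a + aug b" "aug (a - b) = aug a - aug b"
  "aug (- a) = - aug a" "aug (frag_cmul k a) = k * aug a"
  by (simp_all add: aug_def frag_extend_add frag_extend_diff frag_extend_minus frag_extend_cmul
      lookup_add lookup_minus)

text \<open>Bilinear composition of formal integer combinations of maps, the composites being restricted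
  to the points of \<open>X\<close>. In this preadditive category both boundary operators are right
  multiplication by a fixed morphism, and naturality is associativity.\<close>

definition ccomp :: "'x cspace \<Rightarrow> (('y \<Rightarrow> 'z) \<Rightarrow>\<^sub>0 int) \<Rightarrow> (('x \<Rightarrow> 'y) \<Rightarrow>\<^sub>0 int) \<Rightarrow> (('x \<Rightarrow> 'z) \<Rightarrow>\<^sub>0 int)"
  where "ccomp X a b = frag_extend (\<lambda>f. frag_extend (\<lambda>g. frag_of (compose (pts X) f g)) b) a"

abbreviation Chom :: "'x cspace \<Rightarrow> 'y cspace \<Rightarrow> (('x \<Rightarrow> 'y) \<Rightarrow>\<^sub>0 int) set" where
  "Chom X Y \<equiv> chains (cmaps X Y)"

definition cid :: "'x cspace \<Rightarrow> (('x \<Rightarrow> 'x) \<Rightarrow>\<^sub>0 int)" where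
  "cid X = frag_of (restrict id (pts X))"

lemma ccomp_of_of [simp]: "ccomp X (frag_of f) (frag_of g) = frag_of (compose (pts X) f g)"
  by (simp add: ccomp_def)

lemma ccomp_left:
  "ccomp X 0 b = 0" "ccomp X (a + a') b = ccomp X a b + ccomp X a' b"
  "ccomp X (a - a') b = ccomp X a b - ccomp X a' b" "ccomp X (- a) b = - ccomp X a b"
  "ccomp X (frag_cmul k a) b = frag_cmul k (ccomp X a b)"
  by (simp_all add: ccomp_def frag_extend_add frag_extend_diff frag_extend_minus frag_extend_cmul)

text \<open>Linearity in the second argument is not immediate, because \<open>ccomp\<close> extends
  over the first argument outermost; induction on \<open>a\<close> reduces it to a single map on the
  left.\<close>

lemma ccomp_right:
  "ccomp X a 0 = 0" "ccomp X a (b + b') = ccomp X a b + ccomp X a b'"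
  "ccomp X a (b - b') = ccomp X a b - ccomp X a b'" "ccomp X a (- b) = - ccomp X a b"
  "ccomp X a (frag_cmul k b) = frag_cmul k (ccomp X a b)"
proof -
  have "a \<in> chains UNIV" by (simp add: chains_iff)
  then have "ccomp X a 0 = 0 \<and> ccomp X a (b - b') = ccomp X a b - ccomp X a b' \<and>
    ccomp X a (b + b') = ccomp X a b + ccomp X a b' \<and>
    ccomp X a (- b) = - ccomp X a b \<and> ccomp X a (frag_cmul k b) = frag_cmul k (ccomp X a b)"
    by (induction rule: chains_induct)
      (auto simp: ccomp_left, auto simp: ccomp_def frag_extend_add frag_extend_diff
        frag_extend_minus frag_extend_cmul frag_cmul_distrib2 frag_cmul_diff
        simp del: minus_frag_cmul)
  then show "ccomp X a 0 = 0" "ccomp X a (b + b') = ccomp X a b + ccomp X a b'"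
    "ccomp X a (b - b') = ccomp X a b - ccomp X a b'" "ccomp X a (- b) = - ccomp X a b"
    "ccomp X a (frag_cmul k b) = frag_cmul k (ccomp X a b)"
    by auto
qed

lemma ccomp_sum_left: "ccomp X (sum f I) b = (\<Sum>i\<in>I. ccomp X (f i) b)"
  by (induction I rule: infinite_finite_induct) (auto simp: ccomp_left)

lemma ccomp_sum_right: "ccomp X a (sum f I) = (\<Sum>i\<in>I. ccomp X a (f i))"
  by (induction I rule: infinite_finite_induct) (auto simp: ccomp_right)

text \<open>A composite of two single maps is a single map, so both sides are bilinear and agree on
  generators. This evaluates the degree 0 condition on products.\<close>

lemma aug_ccomp [simp]:
  fixes a :: "('y \<Rightarrow> 'z) \<Rightarrow>\<^sub>0 int"
  shows "aug (ccomp X a b) = aug a * aug b"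
proof -
  have b: "b \<in> chains UNIV" and a: "a \<in> chains UNIV" by (auto simp: chains_iff)
  have 1: "aug (ccomp X (frag_of f) b) = aug b" for f :: "'y \<Rightarrow> 'z"
    using b by (induction rule: chains_induct) (auto simp: ccomp_right)
  show ?thesis
    using a by (induction rule: chains_induct) (auto simp: ccomp_left left_diff_distrib 1)
qed

lemma ccomp_in_chains:
  assumes "a \<in> chains A" "b \<in> chains B" "\<And>f g. f \<in> A \<Longrightarrow> g \<in> B \<Longrightarrow> compose (pts X) f g \<in> S"
  shows "ccomp X a b \<in> chains S"
  unfolding ccomp_def
  by (intro chains_frag_extend[OF assms(1)] chains_frag_extend[OF assms(2)]) (simp add: assms(3))

text \<open>The composite of \<open>a\<close> and \<open>b\<close> is cut down to
  \<open>pts X\<close>; the cut goes unnoticed exactly on values of \<open>c\<close> that lie in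
  \<open>pts X\<close>.\<close>

lemma ccomp_assoc:
  fixes a :: "('y \<Rightarrow> 'z) \<Rightarrow>\<^sub>0 int"
  assumes "c \<in> chains {h. h ` pts W \<subseteq> pts X}"
  shows "ccomp W (ccomp X a b) c = ccomp W a (ccomp W b c)"
proof -
  have a: "a \<in> chains UNIV" and b: "b \<in> chains UNIV" by (auto simp: chains_iff)
  have 1: "ccomp W (ccomp X (frag_of f) (frag_of g)) c = ccomp W (frag_of f) (ccomp W (frag_of g) c)"
    for f :: "'y \<Rightarrow> 'z" and g
    using assms
  proof (induction rule: chains_induct)
    case (one h)
    then have "compose (pts W) (compose (pts X) f g) h = compose (pts W) f (compose (pts W) g h)"
      by (auto simp: compose_def fun_eq_iff)
    then show ?case by simp
  qed (auto simp: ccomp_right)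
  have 2: "ccomp W (ccomp X (frag_of f) b) c = ccomp W (frag_of f) (ccomp W b c)" for f :: "'y \<Rightarrow> 'z"
    using b by (induction rule: chains_induct) (auto simp: ccomp_right ccomp_left 1[simplified])
  show ?thesis
    using a by (induction rule: chains_induct) (auto simp: ccomp_right ccomp_left 2)
qed

section \<open>Closure spaces and continuous maps\<close>

lemma closure_spaceD:
  assumes "closure_space X"
  shows "clo X {} = {}" "A \<subseteq> pts X \<Longrightarrow> A \<subseteq> clo X A" "A \<subseteq> pts X \<Longrightarrow> clo X A \<subseteq> pts X"
    "A \<subseteq> pts X \<Longrightarrow> B \<subseteq> pts X \<Longrightarrow> clo X (A \<union> B) = clo X A \<union> clo X B"
  using assms unfolding closure_space_def by meson+

lemma cmaps_compose:
  assumes "f \<in> cmaps Y Z" "g \<in> cmaps X Y" "closure_space X"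
  shows "compose (pts X) f g \<in> cmaps X Z"
proof -
  have fg: "f ` pts Y \<subseteq> pts Z" "g ` pts X \<subseteq> pts Y"
    and cf: "\<And>A. A \<subseteq> pts Y \<Longrightarrow> f ` clo Y A \<subseteq> clo Z (f ` A)"
    and cg: "\<And>A. A \<subseteq> pts X \<Longrightarrow> g ` clo X A \<subseteq> clo Y (g ` A)"
    using assms by (auto simp: cmaps_def ccontinuous_def)
  have "compose (pts X) f g ` clo X A \<subseteq> clo Z (compose (pts X) f g ` A)" if A: "A \<subseteq> pts X" for A
  proof -
    have eq: "compose (pts X) f g ` B = f ` g ` B" if "B \<subseteq> pts X" for B
      using that by (auto simp: compose_def image_image intro!: image_cong)
    have "f ` g ` clo X A \<subseteq> f ` clo Y (g ` A)"
      using cg[OF A] by (rule image_mono)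
    also have "\<dots> \<subseteq> clo Z (f ` g ` A)"
      using fg A by (intro cf) blast
    finally show ?thesis
      using eq A closure_spaceD(3)[OF assms(3) A] by simp
  qed
  moreover have "compose (pts X) f g ` pts X \<subseteq> pts Z"
    using fg by (auto simp: compose_def)
  ultimately show ?thesis
    by (simp add: cmaps_def ccontinuous_def compose_extensional)
qed

lemma ccomp_Chom [intro]:
  "closure_space X \<Longrightarrow> a \<in> Chom Y Z \<Longrightarrow> b \<in> Chom X Y \<Longrightarrow> ccomp X a b \<in> Chom X Z"
  by (rule ccomp_in_chains) (auto intro: cmaps_compose)

lemma Chom_assoc:
  "c \<in> Chom W X \<Longrightarrow> ccomp W (ccomp X a b) c = ccomp W a (ccomp W b c)"
  by (rule ccomp_assoc, erule chains_mono[rotated]) (auto simp: cmaps_def ccontinuous_def)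

lemma ccomp_cid_right:
  assumes "a \<in> Chom X Y" shows "ccomp X a (cid X) = a"
  using assms
proof (induction rule: chains_induct)
  case (one f)
  then have "compose (pts X) f (restrict id (pts X)) = f"
    by (auto simp: cmaps_def compose_def fun_eq_iff extensional_def)
  then show ?case by (simp add: cid_def)
qed (auto simp: ccomp_left)

lemma ccomp_cid_left:
  assumes "b \<in> Chom X Y" shows "ccomp X (cid Y) b = b"
  using assms
proof (induction rule: chains_induct)
  case (one f)
  then have "compose (pts X) (restrict id (pts Y)) f = f"
    by (auto simp: cmaps_def ccontinuous_def compose_def fun_eq_iff extensional_def)
  then show ?case by (simp add: cid_def)
qed (auto simp: ccomp_right)

lemma ccontinuous_const:
  assumes "closure_space X" "closure_space Y" "v \<in> pts Y"
  shows "ccontinuous X Y (\<lambda>_. v)"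
  unfolding ccontinuous_def
proof (intro conjI allI impI)
  fix A assume A: "A \<subseteq> pts X"
  show "(\<lambda>_. v) ` clo X A \<subseteq> clo Y ((\<lambda>_. v) ` A)"
  proof (cases "A = {}")
    case True
    then show ?thesis
      by (simp add: closure_spaceD(1) assms)
  next
    case False
    then have "(\<lambda>_. v) ` A = {v}" by auto
    then show ?thesis
      using closure_spaceD(2)[OF assms(2), of "{v}"] assms(3) by auto
  qed
qed (use assms in auto)

lemma ccontinuous_cong:
  assumes "closure_space X" "\<And>x. x \<in> pts X \<Longrightarrow> f x = g x"
  shows "ccontinuous X Y f \<longleftrightarrow> ccontinuous X Y g"
proof -
  have "f ` A = g ` A" if "A \<subseteq> pts X" for A
    using that assms(2) by (intro image_cong) auto
  moreover have "clo X A \<subseteq> pts X" if "A \<subseteq> pts X" for A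
    using that assms(1) by (simp add: closure_spaceD)
  ultimately show ?thesis
    by (simp add: ccontinuous_def)
qed

lemma restrict_cmaps:
  "closure_space X \<Longrightarrow> restrict f (pts X) \<in> cmaps X Y \<longleftrightarrow> ccontinuous X Y f"
  unfolding cmaps_def using ccontinuous_cong[of X f "restrict f (pts X)" Y] by auto

lemma cid_Chom [simp]: "closure_space X \<Longrightarrow> cid X \<in> Chom X X"
  unfolding cid_def chains_of by (simp add: restrict_cmaps ccontinuous_def)

text \<open>The common cancellation behind \<open>\<partial>\<partial> = 0\<close> for simplices (\<open>m = 0\<close>) and cubes (\<open>m = 1\<close>).\<close>

lemma alternating_double_sum:
  fixes a :: "nat \<Rightarrow> nat \<Rightarrow> 'a \<Rightarrow>\<^sub>0 int"
  assumes "\<And>i j. m \<le> i \<Longrightarrow> i < j \<Longrightarrow> j \<le> Suc n \<Longrightarrow> a i j = a (j - 1) i"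
  shows "(\<Sum>j=m..Suc n. \<Sum>i=m..n. frag_cmul ((-1) ^ (i + j)) (a i j)) = 0"
proof -
  let ?P = "{m..Suc n} \<times> {m..n}"
  let ?s = "\<lambda>(j, i). frag_cmul ((-1) ^ (i + j)) (a i j)"
  have P: "?P = {(j, i) \<in> ?P. i < j} \<union> {(j, i) \<in> ?P. j \<le> i}" by auto
  have "(\<Sum>j=m..Suc n. \<Sum>i=m..n. frag_cmul ((-1) ^ (i + j)) (a i j)) = sum ?s ?P"
    by (simp add: sum.cartesian_product)
  also have "\<dots> = sum ?s {(j, i) \<in> ?P. i < j} + sum ?s {(j, i) \<in> ?P. j \<le> i}"
    by (subst P, rule sum.union_disjoint) (auto intro: finite_subset[of _ ?P])
  \<comment> \<open>The bijection from \<open>(j, i)\<close> to \<open>(i, j - 1)\<close> carries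
    the pairs below the diagonal to the others. By the hypothesis it preserves the values of
    \<open>a\<close>, and it lowers the exponent of the sign by one.\<close>
  also have "sum ?s {(j, i) \<in> ?P. i < j} = sum (\<lambda>x. - ?s x) {(j, i) \<in> ?P. j \<le> i}"
  proof (rule sum.reindex_bij_witness[where i = "\<lambda>(j, i). (Suc i, j)" and j = "\<lambda>(j, i). (i, j - 1)"])
    fix p assume "p \<in> {(j, i) \<in> ?P. i < j}"
    then obtain j i where p: "p = (j, i)" "m \<le> i" "i < j" "j \<le> Suc n" by auto
    then obtain k where k: "j = Suc k" by (cases j) auto
    then have "a i j = a k i" using assms[of i j] p by simp
    then show "- ?s (case p of (j, i) \<Rightarrow> (i, j - 1)) = ?s p"
      using p k by (simp add: add.commute)
  qed auto
  finally show ?thesis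
    by (simp add: sum_negf)
qed

text \<open>The inductive construction underlying acyclic models: \<open>b\<close> is the boundary, \<open>\<gamma>\<close> and \<open>\<delta>\<close> are the
  actions of the coface maps between models on the chains of two consecutive degrees, and everything
  is read modulo \<open>N\<close> and \<open>N'\<close>.\<close>

lemma lifting_sequence:
  fixes b \<gamma> \<delta> :: "nat \<Rightarrow> 'z::ab_group_add \<Rightarrow> 'z"
  assumes start: "\<exists>x\<in>B 0. b 0 x - W 0 \<in> N 0"
    and lift: "\<And>n z. z \<in> A (Suc n) \<Longrightarrow> b n z \<in> N' n \<Longrightarrow> \<exists>x\<in>B (Suc n). b (Suc n) x - z \<in> N (Suc n)"
    and A: "\<And>n x. x \<in> B n \<Longrightarrow> W (Suc n) - \<gamma> n x \<in> A (Suc n)"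
    and W: "\<And>n. b n (W (Suc n)) - \<delta> n (W n) \<in> N' n"
    and comm: "\<And>n x. x \<in> B n \<Longrightarrow> b n (\<gamma> n x) = \<delta> n (b n x)"
    and dd: "\<And>n x. x \<in> B n \<Longrightarrow> \<delta> (Suc n) (\<gamma> n x) = 0"
    and N: "\<And>n y. y \<in> N n \<Longrightarrow> \<delta> n y \<in> N' n"
    and N': "\<And>n x y. x \<in> N' n \<Longrightarrow> y \<in> N' n \<Longrightarrow> x - y \<in> N' n"
    and b: "\<And>n x y. b n (x - y) = b n x - b n y"
    and \<delta>: "\<And>n x y. \<delta> n (x - y) = \<delta> n x - \<delta> n y"
  obtains X where "\<And>n. X n \<in> B n" "b 0 (X 0) - W 0 \<in> N 0"
    "\<And>n. b (Suc n) (X (Suc n)) - (W (Suc n) - \<gamma> n (X n)) \<in> N (Suc n)"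
proof -
  \<comment> \<open>The invariant may mention \<open>X n\<close> alone, so it keeps only
    \<open>\<delta>\<close> of the error \<open>b n (X n) - W n\<close>. Up to \<open>N\<close>,
    that error is minus the \<open>\<gamma>\<close> of the previous term, which \<open>dd\<close>
    makes invisible to \<open>\<delta>\<close>.\<close>
  have "\<exists>X. \<forall>n. (X n \<in> B n \<and> \<delta> n (b n (X n) - W n) \<in> N' n \<and> (n = 0 \<longrightarrow> b n (X n) - W n \<in> N n)) \<and>
      b (Suc n) (X (Suc n)) - (W (Suc n) - \<gamma> n (X n)) \<in> N (Suc n)"
  proof (rule dependent_nat_choice)
    show "\<exists>x. x \<in> B 0 \<and> \<delta> 0 (b 0 x - W 0) \<in> N' 0 \<and> (0 = 0 \<longrightarrow> b 0 x - W 0 \<in> N 0)"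
      using start N by blast
  next
    fix x n assume x: "x \<in> B n \<and> \<delta> n (b n x - W n) \<in> N' n \<and> (n = 0 \<longrightarrow> b n x - W n \<in> N n)"
    let ?z = "W (Suc n) - \<gamma> n x"
    \<comment> \<open>Moving \<open>b\<close> past \<open>\<gamma>\<close> splits the boundary of
      the next target into the compatibility of \<open>W\<close> and the invariant, both in
      \<open>N' n\<close>.\<close>
    have "b n ?z = (b n (W (Suc n)) - \<delta> n (W n)) - \<delta> n (b n x - W n)"
      using x by (simp add: b \<delta> comm)
    then have "b n ?z \<in> N' n"
      using x W N' by simp
    then obtain y where y: "y \<in> B (Suc n)" "b (Suc n) y - ?z \<in> N (Suc n)"
      using lift A x by blast
    have "b (Suc n) y - W (Suc n) = (b (Suc n) y - ?z) - \<gamma> n x" by simp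
    then have "\<delta> (Suc n) (b (Suc n) y - W (Suc n)) = \<delta> (Suc n) (b (Suc n) y - ?z)"
      using x dd by (simp only: \<delta>[of "Suc n" "b (Suc n) y - ?z"]) simp
    then show "\<exists>y. (y \<in> B (Suc n) \<and> \<delta> (Suc n) (b (Suc n) y - W (Suc n)) \<in> N' (Suc n) \<and>
        (Suc n = 0 \<longrightarrow> b (Suc n) y - W (Suc n) \<in> N (Suc n))) \<and> b (Suc n) y - ?z \<in> N (Suc n)"
      using y N by (intro exI[of _ y]) simp
  qed
  then show ?thesis using that by metis
qed

section \<open>Neighbourhoods and finite products\<close>

lemma cnbhdD:
  "cnbhd X x U \<Longrightarrow> U \<subseteq> pts X" "cnbhd X x U \<Longrightarrow> x \<in> pts X" "cnbhd X x U \<Longrightarrow> x \<notin> clo X (pts X - U)"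
  by (auto simp: cnbhd_def cinterior_def)

lemma cnbhdI:
  "U \<subseteq> pts X \<Longrightarrow> x \<in> pts X \<Longrightarrow> x \<notin> clo X (pts X - U) \<Longrightarrow> cnbhd X x U"
  by (auto simp: cnbhd_def cinterior_def)

lemma clo_mono:
  assumes "closure_space X" "A \<subseteq> B" "B \<subseteq> pts X"
  shows "clo X A \<subseteq> clo X B"
proof -
  have "clo X B = clo X A \<union> clo X B"
    using closure_spaceD(4)[OF assms(1), of A B] assms(2,3) by (simp add: Un_absorb1)
  then show ?thesis by blast
qed

lemma cnbhd_mem:
  assumes "closure_space X" "cnbhd X x U" shows "x \<in> U"
  using cnbhdD[OF assms(2)] closure_spaceD(2)[OF assms(1), of "pts X - U"] by auto

lemma cnbhd_pts: "closure_space X \<Longrightarrow> x \<in> pts X \<Longrightarrow> cnbhd X x (pts X)"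
  by (rule cnbhdI) (simp_all add: closure_spaceD(1))

lemma cnbhd_Int:
  assumes "closure_space X" "cnbhd X x U" "cnbhd X x V"
  shows "cnbhd X x (U \<inter> V)"
  using cnbhdD[OF assms(2)] cnbhdD[OF assms(3)]
    closure_spaceD(4)[OF assms(1), of "pts X - U" "pts X - V"]
  by (intro cnbhdI) (auto simp: Diff_Int)

text \<open>The factor \<open>pts X\<close> gives the empty family its proper meaning; that family
  occurs for the cube of dimension 0.\<close>

lemma cnbhd_INT:
  assumes "closure_space X" "finite K" "\<And>k. k \<in> K \<Longrightarrow> cnbhd X x (U k)" "x \<in> pts X"
  shows "cnbhd X x (pts X \<inter> (\<Inter>k\<in>K. U k))"
  using assms(2,3)
proof (induction K rule: finite_induct)
  case empty
  then show ?case using cnbhd_pts assms by simp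
next
  case (insert k K)
  then show ?case
    using cnbhd_Int[OF assms(1), of x "U k" "pts X \<inter> (\<Inter>k\<in>K. U k)"] by (simp add: Int_left_commute)
qed

lemma clo_meets_cnbhd:
  assumes "closure_space X" "A \<subseteq> pts X" "x \<in> clo X A" "cnbhd X x V"
  shows "V \<inter> A \<noteq> {}"
proof
  assume "V \<inter> A = {}"
  then have "A \<subseteq> pts X - V" using assms(2) by auto
  then have "clo X A \<subseteq> clo X (pts X - V)" by (intro clo_mono assms(1)) auto
  then show False using assms(3) cnbhdD(3)[OF assms(4)] by auto
qed

lemma cnbhd_vimage:
  assumes "closure_space X" "closure_space Y" "ccontinuous X Y f" "x \<in> pts X" "cnbhd Y (f x) U"
  shows "cnbhd X x {z \<in> pts X. f z \<in> U}"
proof (rule cnbhdI)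
  let ?A = "pts X - {z \<in> pts X. f z \<in> U}"
  have "f ` clo X ?A \<subseteq> clo Y (f ` ?A)" and f: "f ` pts X \<subseteq> pts Y"
    using assms(3) unfolding ccontinuous_def by auto
  moreover have "clo Y (f ` ?A) \<subseteq> clo Y (pts Y - U)"
    using f by (intro clo_mono assms(2)) auto
  ultimately show "x \<notin> clo X ?A"
    using cnbhdD(3)[OF assms(5)] by blast
qed (use assms in auto)

lemma pts_cprod [simp]: "pts (cprod K Y) = (\<Pi>\<^sub>E k\<in>K. pts (Y k))"
  by (simp add: cprod_def)

lemma clo_cprod: "x \<in> clo (cprod K Y) A \<longleftrightarrow> x \<in> pts (cprod K Y) \<and>
    (\<forall>U. (\<forall>k\<in>K. cnbhd (Y k) (x k) (U k)) \<longrightarrow> (\<Pi>\<^sub>E k\<in>K. U k) \<inter> A \<noteq> {})"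
  by (simp add: cprod_def)

lemma clo_cprodD:
  "x \<in> clo (cprod K Y) A \<Longrightarrow> (\<And>k. k \<in> K \<Longrightarrow> cnbhd (Y k) (x k) (U k)) \<Longrightarrow> (\<Pi>\<^sub>E k\<in>K. U k) \<inter> A \<noteq> {}"
  by (simp add: cprod_def)

lemma closure_space_cprod:
  assumes "\<And>k. k \<in> K \<Longrightarrow> closure_space (Y k)"
  shows "closure_space (cprod K Y)"
proof -
  have "clo (cprod K Y) {} = {}"
    using cnbhd_pts[OF assms] by (fastforce simp: clo_cprod)
  moreover have "A \<subseteq> clo (cprod K Y) A" if "A \<subseteq> pts (cprod K Y)" for A
  proof
    fix x assume x: "x \<in> A"
    have "x \<in> (\<Pi>\<^sub>E k\<in>K. U k)" if "\<forall>k\<in>K. cnbhd (Y k) (x k) (U k)" for U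
      using that x \<open>A \<subseteq> _\<close> cnbhd_mem[OF assms] by (auto simp: PiE_iff)
    then show "x \<in> clo (cprod K Y) A"
      using x that unfolding clo_cprod by blast
  qed
  moreover have "x \<in> clo (cprod K Y) A \<union> clo (cprod K Y) B" if x: "x \<in> clo (cprod K Y) (A \<union> B)" for x A B
  proof (rule ccontr)
    assume n: "\<not> ?thesis"
    have xp: "x \<in> pts (cprod K Y)"
      using x unfolding clo_cprod by (rule conjunct1)
    obtain U where "\<forall>k\<in>K. cnbhd (Y k) (x k) (U k)" "(\<Pi>\<^sub>E k\<in>K. U k) \<inter> A = {}"
      using n xp unfolding Un_iff clo_cprod[of x K Y A] by blast
    moreover obtain V where "\<forall>k\<in>K. cnbhd (Y k) (x k) (V k)" "(\<Pi>\<^sub>E k\<in>K. V k) \<inter> B = {}"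
      using n xp unfolding Un_iff clo_cprod[of x K Y B] by blast
    moreover from calculation have "cnbhd (Y k) (x k) (U k \<inter> V k)" if "k \<in> K" for k
      using cnbhd_Int[OF assms] that by simp
    then have "(\<Pi>\<^sub>E k\<in>K. U k \<inter> V k) \<inter> (A \<union> B) \<noteq> {}"
      using clo_cprodD[OF x, of "\<lambda>k. U k \<inter> V k"] by blast
    ultimately show False
      by (auto simp: PiE_Int[symmetric])
  qed
  moreover have mono: "clo (cprod K Y) A \<subseteq> clo (cprod K Y) B" if "A \<subseteq> B" for A B
  proof
    fix x assume x: "x \<in> clo (cprod K Y) A"
    then have "(\<Pi>\<^sub>E k\<in>K. U k) \<inter> B \<noteq> {}" if "\<forall>k\<in>K. cnbhd (Y k) (x k) (U k)" for U
      using clo_cprodD[OF x, of U] that \<open>A \<subseteq> B\<close> by blast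
    then show "x \<in> clo (cprod K Y) B"
      using x unfolding clo_cprod by blast
  qed
  have "clo (cprod K Y) A \<union> clo (cprod K Y) B \<subseteq> clo (cprod K Y) (A \<union> B)" for A B
    using mono[of A "A \<union> B"] mono[of B "A \<union> B"] by simp
  moreover have "clo (cprod K Y) A \<subseteq> pts (cprod K Y)" for A
    unfolding clo_cprod subset_iff by blast
  ultimately show ?thesis
    unfolding closure_space_def by (meson subset_antisym subsetI)
qed

text \<open>A box pulls back to an intersection of preimages of neighbourhoods. As \<open>K\<close>
  is finite this is again a neighbourhood, so it meets \<open>A\<close>, and the box meets the image
  of \<open>A\<close>.\<close>

lemma ccontinuous_cprod:
  assumes "finite K" "closure_space X" "\<And>k. k \<in> K \<Longrightarrow> closure_space (Y k)"
    and f: "\<And>k. k \<in> K \<Longrightarrow> ccontinuous X (Y k) (\<lambda>x. f x k)" "\<And>x. x \<in> pts X \<Longrightarrow> f x \<in> extensional K"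
  shows "ccontinuous X (cprod K Y) f"
  unfolding ccontinuous_def
proof (intro conjI allI impI)
  have "f x k \<in> pts (Y k)" if "x \<in> pts X" "k \<in> K" for x k
    using that f(1) by (auto simp: ccontinuous_def)
  then show sub: "f ` pts X \<subseteq> pts (cprod K Y)"
    using f(2) by (auto simp: image_subset_iff PiE_iff)
  fix A assume A: "A \<subseteq> pts X"
  show "f ` clo X A \<subseteq> clo (cprod K Y) (f ` A)"
  proof
    fix y assume "y \<in> f ` clo X A"
    then obtain x where x: "x \<in> clo X A" "y = f x" by auto
    have xX: "x \<in> pts X" using x A closure_spaceD(3)[OF assms(2)] by auto
    have "(\<Pi>\<^sub>E k\<in>K. U k) \<inter> f ` A \<noteq> {}" if U: "\<forall>k\<in>K. cnbhd (Y k) (y k) (U k)" for U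
    proof -
      have "cnbhd X x (pts X \<inter> (\<Inter>k\<in>K. {z \<in> pts X. f z k \<in> U k}))"
        using U x(2) by (intro cnbhd_INT cnbhd_vimage[OF assms(2,3) f(1)] assms xX) auto
      from clo_meets_cnbhd[OF assms(2) A x(1) this]
      obtain z where "z \<in> A" "\<forall>k\<in>K. f z k \<in> U k"
        by blast
      then have "f z \<in> (\<Pi>\<^sub>E k\<in>K. U k) \<inter> f ` A"
        using f(2) A by (auto simp: PiE_iff)
      then show ?thesis by blast
    qed
    then show "y \<in> clo (cprod K Y) (f ` A)"
      using sub xX x by (auto simp: clo_cprod)
  qed
qed

lemma ccontinuous_proj:
  assumes "\<And>k. k \<in> K \<Longrightarrow> closure_space (Y k)" "k \<in> K"
  shows "ccontinuous (cprod K Y) (Y k) (\<lambda>x. x k)"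
  unfolding ccontinuous_def
proof (intro conjI allI impI)
  show "(\<lambda>x. x k) ` pts (cprod K Y) \<subseteq> pts (Y k)"
    using assms by auto
  fix A assume A: "A \<subseteq> pts (cprod K Y)"
  show "(\<lambda>x. x k) ` clo (cprod K Y) A \<subseteq> clo (Y k) ((\<lambda>x. x k) ` A)"
  proof (rule ccontr)
    assume "\<not> ?thesis"
    then obtain x where x: "x \<in> clo (cprod K Y) A" "x k \<notin> clo (Y k) ((\<lambda>x. x k) ` A)" by auto
    have xp: "x j \<in> pts (Y j)" if "j \<in> K" for j using x(1) that by (auto simp: clo_cprod)
    \<comment> \<open>If \<open>x k\<close> were not in the closure of the projected set, the
      complement of that set would be a neighbourhood of \<open>x k\<close>. The box constrained in
      this one coordinate then misses \<open>A\<close>.\<close>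
    let ?U = "\<lambda>j. if j = k then pts (Y k) - (\<lambda>x. x k) ` A else pts (Y j)"
    have "(\<lambda>x. x k) ` A \<subseteq> pts (Y k)" using A assms(2) by (auto simp: PiE_iff)
    then have "cnbhd (Y k) (x k) (pts (Y k) - (\<lambda>x. x k) ` A)"
      using x(2) xp[OF assms(2)] by (intro cnbhdI) (auto simp: double_diff)
    then have "\<forall>j\<in>K. cnbhd (Y j) (x j) (?U j)"
      using cnbhd_pts[OF assms(1)] xp by auto
    then have "(\<Pi>\<^sub>E j\<in>K. ?U j) \<inter> A \<noteq> {}"
      using clo_cprodD[OF x(1), of ?U] by blast
    then obtain y where "y \<in> (\<Pi>\<^sub>E j\<in>K. ?U j)" "y \<in> A"
      by blast
    then have "y k \<in> ?U k" using assms(2) by (blast dest: PiE_mem)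
    then show False using \<open>y \<in> A\<close> by auto
  qed
qed

section \<open>Dualizing chain homotopy equivalences\<close>

definition chain_complex :: "'a chain_cx \<Rightarrow> bool" where
  "chain_complex C \<longleftrightarrow>
     (\<forall>n. comm_group (ch C n)) \<and>
     (\<forall>n. bd C n \<in> hom (ch C (Suc n)) (ch C n)) \<and>
     (\<forall>n. \<forall>x\<in>carrier (ch C (Suc (Suc n))). bd C n (bd C (Suc n) x) = \<one>\<^bsub>ch C n\<^esub>)"

definition chain_map :: "'a chain_cx \<Rightarrow> 'b chain_cx \<Rightarrow> (nat \<Rightarrow> 'a \<Rightarrow> 'b) \<Rightarrow> bool" where
  "chain_map C D f \<longleftrightarrow>
     (\<forall>n. f n \<in> hom (ch C n) (ch D n)) \<and>
     (\<forall>n. \<forall>x\<in>carrier (ch C (Suc n)). bd D n (f (Suc n) x) = f n (bd C n x))"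

text \<open>The term \<open>x\<close> stands on the side of the homotopy, so that no inverses occur
  among chains; the inverse in \<open>cochain_homotopic\<close> appears only after
  dualizing.\<close>

definition chain_homotopic_id :: "'a chain_cx \<Rightarrow> (nat \<Rightarrow> 'a \<Rightarrow> 'a) \<Rightarrow> bool" where
  "chain_homotopic_id C k \<longleftrightarrow>
     (\<exists>s. (\<forall>n. s n \<in> hom (ch C n) (ch C (Suc n))) \<and>
          (\<forall>n. \<forall>x\<in>carrier (ch C n).
             k n x = (case n of 0 \<Rightarrow> \<one>\<^bsub>ch C n\<^esub> | Suc m \<Rightarrow> s m (bd C m x))
               \<otimes>\<^bsub>ch C n\<^esub> bd C n (s n x) \<otimes>\<^bsub>ch C n\<^esub> x))"

lemma comm_group_Hom_group:
  assumes "group A" "comm_group G"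
  shows "comm_group (Hom_group A G)"
proof -
  interpret A: group A by fact
  interpret G: comm_group G by fact
  show ?thesis
  proof (rule comm_groupI)
    fix x y assume xy: "x \<in> carrier (Hom_group A G)" "y \<in> carrier (Hom_group A G)"
    then show "x \<otimes>\<^bsub>Hom_group A G\<^esub> y \<in> carrier (Hom_group A G)"
      by (auto simp: Hom_group_def hom_def Pi_def G.m_ac)
    show "x \<otimes>\<^bsub>Hom_group A G\<^esub> y = y \<otimes>\<^bsub>Hom_group A G\<^esub> x"
      using xy by (auto simp: Hom_group_def hom_def Pi_def intro: G.m_comm restrict_ext)
    fix z assume "z \<in> carrier (Hom_group A G)"
    then show "x \<otimes>\<^bsub>Hom_group A G\<^esub> y \<otimes>\<^bsub>Hom_group A G\<^esub> z = x \<otimes>\<^bsub>Hom_group A G\<^esub> (y \<otimes>\<^bsub>Hom_group A G\<^esub> z)"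
      using xy by (auto simp: Hom_group_def hom_def Pi_def intro!: restrict_ext G.m_assoc)
  next
    show "\<one>\<^bsub>Hom_group A G\<^esub> \<in> carrier (Hom_group A G)"
      by (auto simp: Hom_group_def hom_def)
  next
    fix x assume x: "x \<in> carrier (Hom_group A G)"
    then show "\<one>\<^bsub>Hom_group A G\<^esub> \<otimes>\<^bsub>Hom_group A G\<^esub> x = x"
      by (auto simp: Hom_group_def hom_def Pi_def fun_eq_iff extensional_def)
    have "(\<lambda>a\<in>carrier A. inv\<^bsub>G\<^esub> x a) \<in> carrier (Hom_group A G)"
      using x by (auto simp: Hom_group_def hom_def Pi_def G.inv_mult)
    moreover have "(\<lambda>a\<in>carrier A. inv\<^bsub>G\<^esub> x a) \<otimes>\<^bsub>Hom_group A G\<^esub> x = \<one>\<^bsub>Hom_group A G\<^esub>"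
      using x by (auto simp: Hom_group_def hom_def Pi_def intro: restrict_ext)
    ultimately show "\<exists>y\<in>carrier (Hom_group A G). y \<otimes>\<^bsub>Hom_group A G\<^esub> x = \<one>\<^bsub>Hom_group A G\<^esub>"
      by blast
  qed
qed

text \<open>Serves three times: for coboundaries, for duals of chain maps and for duals of
  homotopies.\<close>

lemma Hom_group_pullback:
  assumes "f \<in> hom A B" "group A" "group B" "comm_group G"
  shows "(\<lambda>\<phi>. \<lambda>x\<in>carrier A. \<phi> (f x)) \<in> hom (Hom_group B G) (Hom_group A G)"
proof -
  interpret A: group A by fact
  interpret B: group B by fact
  interpret G: comm_group G by fact
  show ?thesis
  proof (rule homI)
    fix \<phi> assume "\<phi> \<in> carrier (Hom_group B G)"
    then show "(\<lambda>x\<in>carrier A. \<phi> (f x)) \<in> carrier (Hom_group A G)"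
      using assms(1) by (auto simp: Hom_group_def hom_def Pi_def)
  next
    fix \<phi> \<psi> assume "\<phi> \<in> carrier (Hom_group B G)" "\<psi> \<in> carrier (Hom_group B G)"
    then show "(\<lambda>x\<in>carrier A. (\<phi> \<otimes>\<^bsub>Hom_group B G\<^esub> \<psi>) (f x)) =
        (\<lambda>x\<in>carrier A. \<phi> (f x)) \<otimes>\<^bsub>Hom_group A G\<^esub> (\<lambda>x\<in>carrier A. \<psi> (f x))"
      using assms(1) by (auto simp: Hom_group_def hom_def Pi_def)
  qed
qed

context
  fixes G :: "('g, 'm) monoid_scheme"
  assumes G: "comm_group G"
begin

lemma Hom_complex_sel [simp]:
  "coch (Hom_complex C G) n = Hom_group (ch C n) G"
  "cobd (Hom_complex C G) n \<phi> = (\<lambda>x\<in>carrier (ch C (Suc n)). \<phi> (bd C n x))"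
  by (simp_all add: Hom_complex_def)

lemma Hom_group_one_of: "group A \<Longrightarrow> \<phi> \<in> carrier (Hom_group A G) \<Longrightarrow> \<phi> \<one>\<^bsub>A\<^esub> = \<one>\<^bsub>G\<^esub>"
  by (rule hom_one[of _ A]) (auto simp: Hom_group_def intro: comm_group.axioms(2)[OF G])

lemma cochain_complex_Hom:
  assumes "chain_complex C"
  shows "cochain_complex (Hom_complex C G)"
proof -
  have gr: "group (ch C n)" for n
    using assms comm_group.axioms(2) unfolding chain_complex_def by blast
  have hb: "bd C n \<in> hom (ch C (Suc n)) (ch C n)" for n
    using assms by (simp add: chain_complex_def)
  have "cobd (Hom_complex C G) n \<in> hom (Hom_group (ch C n) G) (Hom_group (ch C (Suc n)) G)" for n
    using Hom_group_pullback[OF hb gr gr G, of n] by (simp add: Hom_complex_def)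
  moreover have "cobd (Hom_complex C G) (Suc n) (cobd (Hom_complex C G) n \<phi>)
      = \<one>\<^bsub>Hom_group (ch C (Suc (Suc n))) G\<^esub>" if "\<phi> \<in> carrier (Hom_group (ch C n) G)" for n \<phi>
  proof -
    have "bd C (Suc n) x \<in> carrier (ch C (Suc n))" if "x \<in> carrier (ch C (Suc (Suc n)))" for x
      using hb that by (auto simp: hom_def)
    then show ?thesis
      using assms Hom_group_one_of[OF gr that]
      by (auto simp: chain_complex_def Hom_group_def intro!: restrict_ext)
  qed
  ultimately show ?thesis
    unfolding cochain_complex_def using comm_group_Hom_group[OF gr G] by simp
qed

lemma cochain_map_Hom:
  assumes "chain_complex C" "chain_complex D" "chain_map C D f"
  shows "cochain_map (Hom_complex D G) (Hom_complex C G) (\<lambda>n \<phi>. \<lambda>x\<in>carrier (ch C n). \<phi> (f n x))"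
proof -
  have gr: "group (ch C n)" "group (ch D n)" for n
    using assms comm_group.axioms(2) unfolding chain_complex_def by blast+
  have hb: "bd C n x \<in> carrier (ch C n)" if "x \<in> carrier (ch C (Suc n))" for n x
    using assms(1) that by (auto simp: chain_complex_def hom_def)
  have hf: "f n \<in> hom (ch C n) (ch D n)" for n
    using assms by (simp add: chain_map_def)
  then have hf': "f n x \<in> carrier (ch D n)" if "x \<in> carrier (ch C n)" for n x
    using that by (auto simp: hom_def)
  show ?thesis
    unfolding cochain_map_def
    using Hom_group_pullback[OF hf gr G] assms(3) hb hf'
    by (auto simp: chain_map_def intro!: restrict_ext)
qed

text \<open>Dualizing exchanges the two terms of a homotopy: pulling back along the boundary
  followed by \<open>s\<close> is \<open>h\<close> followed by the coboundary, and conversely.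
  \<open>F\<close> is prescribed only on cochains, since in use it is a composite of two restricted
  pullbacks.\<close>

lemma cochain_homotopic_Hom:
  fixes C :: "'a chain_cx"
  assumes C: "chain_complex C" and k: "chain_homotopic_id C k"
    and F: "\<And>n \<phi>. \<phi> \<in> carrier (Hom_group (ch C n) G) \<Longrightarrow> F n \<phi> = (\<lambda>x\<in>carrier (ch C n). \<phi> (k n x))"
  shows "cochain_homotopic (Hom_complex C G) (Hom_complex C G) F (\<lambda>n \<phi>. \<phi>)"
proof -
  obtain s where s: "\<And>n. s n \<in> hom (ch C n) (ch C (Suc n))"
    and eq: "\<And>n x. x \<in> carrier (ch C n) \<Longrightarrow>
             k n x = (case n of 0 \<Rightarrow> \<one>\<^bsub>ch C n\<^esub> | Suc m \<Rightarrow> s m (bd C m x))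
               \<otimes>\<^bsub>ch C n\<^esub> bd C n (s n x) \<otimes>\<^bsub>ch C n\<^esub> x"
    using k by (auto simp: chain_homotopic_id_def)
  have gr: "group (ch C n)" for n
    using assms comm_group.axioms(2) unfolding chain_complex_def by blast
  have hb: "bd C n x \<in> carrier (ch C n)" if "x \<in> carrier (ch C (Suc n))" for n x
    using C that by (auto simp: chain_complex_def hom_def)
  have hs: "s n x \<in> carrier (ch C (Suc n))" if "x \<in> carrier (ch C n)" for n x
    using s that by (auto simp: hom_def)
  define h where "h n \<phi> = (\<lambda>x\<in>carrier (ch C n). \<phi> (s n x))" for n and \<phi> :: "'a \<Rightarrow> 'g"
  have hh: "h n \<in> hom (Hom_group (ch C (Suc n)) G) (Hom_group (ch C n) G)" for n
    unfolding h_def by (rule Hom_group_pullback[OF s gr gr G])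
  have "F n \<phi> \<otimes>\<^bsub>Hom_group (ch C n) G\<^esub> inv\<^bsub>Hom_group (ch C n) G\<^esub> \<phi> =
             (case n of 0 \<Rightarrow> \<one>\<^bsub>Hom_group (ch C n) G\<^esub> | Suc m \<Rightarrow> cobd (Hom_complex C G) m (h m \<phi>))
               \<otimes>\<^bsub>Hom_group (ch C n) G\<^esub> h n (cobd (Hom_complex C G) n \<phi>)" (is "_ = ?c \<otimes>\<^bsub>_\<^esub> ?d")
    if \<phi>: "\<phi> \<in> carrier (Hom_group (ch C n) G)" for n \<phi>
  proof -
    interpret H: comm_group "Hom_group (ch C n) G" by (rule comm_group_Hom_group[OF gr G])
    interpret Cn: group "ch C n" by (rule gr)
    have cc: "cochain_complex (Hom_complex C G)" by (rule cochain_complex_Hom[OF C])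
    have d: "?d \<in> carrier (Hom_group (ch C n) G)"
      using cc hh[of n] \<phi> by (auto simp: cochain_complex_def hom_def Pi_def)
    have c: "?c \<in> carrier (Hom_group (ch C n) G)"
    proof (cases n)
      case (Suc m)
      then show ?thesis
        using cc hh[of m] \<phi> unfolding cochain_complex_def hom_def Pi_def by simp
    qed (use H.one_closed in simp)
    have hom\<phi>: "\<phi> (x \<otimes>\<^bsub>ch C n\<^esub> y) = \<phi> x \<otimes>\<^bsub>G\<^esub> \<phi> y" if "x \<in> carrier (ch C n)" "y \<in> carrier (ch C n)" for x y
      using \<phi> that by (auto simp: Hom_group_def hom_def)
    have ext: "\<phi> \<in> extensional (carrier (ch C n))" using \<phi> by (simp add: Hom_group_def)
    have "F n \<phi> = ?c \<otimes>\<^bsub>Hom_group (ch C n) G\<^esub> ?d \<otimes>\<^bsub>Hom_group (ch C n) G\<^esub> \<phi>"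
    proof
      fix x
      show "F n \<phi> x = (?c \<otimes>\<^bsub>Hom_group (ch C n) G\<^esub> ?d \<otimes>\<^bsub>Hom_group (ch C n) G\<^esub> \<phi>) x"
      proof (cases "x \<in> carrier (ch C n)")
        case x: True
        let ?y = "case n of 0 \<Rightarrow> \<one>\<^bsub>ch C n\<^esub> | Suc m \<Rightarrow> s m (bd C m x)"
        have y: "?y \<in> carrier (ch C n)"
          using x hs hb group.is_monoid[OF gr, THEN monoid.one_closed] by (auto split: nat.split)
        have "?c x = \<phi> ?y"
          using x Hom_group_one_of[OF gr \<phi>] hb by (auto split: nat.split simp: h_def Hom_group_def)
        moreover have "?d x = \<phi> (bd C n (s n x))"
          using x hs by (auto simp: h_def)
        moreover have "F n \<phi> x = \<phi> ?y \<otimes>\<^bsub>G\<^esub> \<phi> (bd C n (s n x)) \<otimes>\<^bsub>G\<^esub> \<phi> x"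
          using x y hb hs by (simp add: F[OF \<phi>] eq hom\<phi>)
        ultimately show ?thesis
          using x by (simp add: Hom_group_def)
      next
        case False
        then show ?thesis using F[OF \<phi>] by (simp add: Hom_group_def)
      qed
    qed
    moreover have "F n \<phi> \<in> carrier (Hom_group (ch C n) G)"
      using calculation c d \<phi> by simp
    ultimately show ?thesis
      using H.inv_solve_right[of "?c \<otimes>\<^bsub>Hom_group (ch C n) G\<^esub> ?d" "F n \<phi>" \<phi>] c d \<phi> by simp
  qed
  then show ?thesis
    unfolding cochain_homotopic_def Hom_complex_sel(1) using hh by (intro exI[of _ h]) blast
qed

lemma cochain_homotopy_equivalent_Hom:
  assumes C: "chain_complex C" and D: "chain_complex D"
    and f: "chain_map C D f" and g: "chain_map D C g"
    and gf: "chain_homotopic_id C (\<lambda>n x. g n (f n x))"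
    and fg: "chain_homotopic_id D (\<lambda>n y. f n (g n y))"
  shows "cochain_homotopy_equivalent (Hom_complex C G) (Hom_complex D G)"
proof -
  have f': "f n x \<in> carrier (ch D n)" if "x \<in> carrier (ch C n)" for n x
    using f that by (auto simp: chain_map_def hom_def)
  have g': "g n x \<in> carrier (ch C n)" if "x \<in> carrier (ch D n)" for n x
    using g that by (auto simp: chain_map_def hom_def)
  show ?thesis
    unfolding cochain_homotopy_equivalent_def
  proof (intro conjI exI)
    \<comment> \<open>By contravariance, \<open>g\<close> induces the map out of the cochains of
      \<open>C\<close> and \<open>f\<close> the map back.\<close>
    show "cochain_map (Hom_complex C G) (Hom_complex D G) (\<lambda>n \<phi>. \<lambda>x\<in>carrier (ch D n). \<phi> (g n x))"
      by (rule cochain_map_Hom[OF D C g])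
    show "cochain_map (Hom_complex D G) (Hom_complex C G) (\<lambda>n \<phi>. \<lambda>x\<in>carrier (ch C n). \<phi> (f n x))"
      by (rule cochain_map_Hom[OF C D f])
  qed (auto intro!: cochain_complex_Hom[OF C] cochain_complex_Hom[OF D] restrict_ext
      cochain_homotopic_Hom[OF C gf] cochain_homotopic_Hom[OF D fg] simp: f' g')
qed

end

text \<open>\<open>the_elem\<close> of an image has a meaning only if the map is constant on the
  coset, which holds as \<open>F\<close> kills \<open>N\<close>. The differential of
  \<open>quotient_complex\<close> is of this form.\<close>

lemma FactGroup_induced_hom:
  assumes "N \<lhd> A" "group B" "F \<in> hom A B" "\<And>d. d \<in> N \<Longrightarrow> F d = \<one>\<^bsub>B\<^esub>"
  shows FactGroup_induced_eq: "\<And>x. x \<in> carrier A \<Longrightarrow> the_elem (F ` (N #>\<^bsub>A\<^esub> x)) = F x"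
    and "(\<lambda>S. the_elem (F ` S)) \<in> hom (A Mod N) B"
proof -
  interpret N: normal N A by fact
  interpret B: group B by fact
  show eq: "the_elem (F ` (N #>\<^bsub>A\<^esub> x)) = F x" if x: "x \<in> carrier A" for x
  proof (rule the_elem_image_unique)
    show "N #>\<^bsub>A\<^esub> x \<noteq> {}"
      using N.rcos_self[OF x] N.subgroup_axioms by auto
    show "F y = F x" if y: "y \<in> N #>\<^bsub>A\<^esub> x" for y
    proof -
      obtain h where "h \<in> N" "y = h \<otimes>\<^bsub>A\<^esub> x"
        using y by (auto simp: r_coset_def)
      then show ?thesis
        using x assms(3,4) N.mem_carrier by (simp add: hom_def Pi_def)
    qed
  qed
  show "(\<lambda>S. the_elem (F ` S)) \<in> hom (A Mod N) B"
  proof (rule homI)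
    fix S assume "S \<in> carrier (A Mod N)"
    then show "the_elem (F ` S) \<in> carrier B"
      using assms(3) by (auto simp: FactGroup_def RCOSETS_def eq hom_def)
  next
    fix S T assume "S \<in> carrier (A Mod N)" "T \<in> carrier (A Mod N)"
    then obtain x y where "x \<in> carrier A" "y \<in> carrier A" "S = N #>\<^bsub>A\<^esub> x" "T = N #>\<^bsub>A\<^esub> y"
      by (auto simp: FactGroup_def RCOSETS_def)
    then show "the_elem (F ` (S \<otimes>\<^bsub>A Mod N\<^esub> T)) = the_elem (F ` S) \<otimes>\<^bsub>B\<^esub> the_elem (F ` T)"
      using assms(3) by (simp add: FactGroup_def N.rcos_sum eq hom_def)
  qed
qed

text \<open>The hypotheses only involve representatives of cosets: \<open>\<phi>\<close> is a chain map and \<open>t\<close> a homotopy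
  modulo \<open>D\<close>.\<close>

lemma cochain_homotopy_equivalent_Hom_quotient:
  fixes C :: "'a chain_cx" and Q :: "'b chain_cx" and G :: "('g, 'm) monoid_scheme"
  assumes G: "comm_group G" and C: "chain_complex C"
    and Q: "\<And>n. comm_group (ch Q n)" "\<And>n. bd Q n \<in> hom (ch Q (Suc n)) (ch Q n)"
    and QQ: "\<And>n x. x \<in> carrier (ch Q (Suc (Suc n))) \<Longrightarrow> bd Q n (bd Q (Suc n) x) \<in> D n"
    and D: "\<And>n. subgroup (D n) (ch Q n)" "\<And>n d. d \<in> D (Suc n) \<Longrightarrow> bd Q n d \<in> D n"
    and \<phi>: "\<And>n. \<phi> n \<in> hom (ch C n) (ch Q n)"
      "\<And>n x. x \<in> carrier (ch C (Suc n)) \<Longrightarrow>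
        D n #>\<^bsub>ch Q n\<^esub> bd Q n (\<phi> (Suc n) x) = D n #>\<^bsub>ch Q n\<^esub> \<phi> n (bd C n x)"
    and \<psi>: "\<And>n. \<psi> n \<in> hom (ch Q n) (ch C n)" "\<And>n d. d \<in> D n \<Longrightarrow> \<psi> n d = \<one>\<^bsub>ch C n\<^esub>"
      "\<And>n x. x \<in> carrier (ch Q (Suc n)) \<Longrightarrow> bd C n (\<psi> (Suc n) x) = \<psi> n (bd Q n x)"
    and s: "chain_homotopic_id C (\<lambda>n x. \<psi> n (\<phi> n x))"
    and t: "\<And>n. t n \<in> hom (ch Q n) (ch Q (Suc n))" "\<And>n d. d \<in> D n \<Longrightarrow> t n d \<in> D (Suc n)"
      "\<And>n x. x \<in> carrier (ch Q n) \<Longrightarrow>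
        D n #>\<^bsub>ch Q n\<^esub> \<phi> n (\<psi> n x) = D n #>\<^bsub>ch Q n\<^esub>
          ((case n of 0 \<Rightarrow> \<one>\<^bsub>ch Q n\<^esub> | Suc m \<Rightarrow> t m (bd Q m x)) \<otimes>\<^bsub>ch Q n\<^esub> bd Q n (t n x) \<otimes>\<^bsub>ch Q n\<^esub> x)"
  shows "cochain_homotopy_equivalent (Hom_complex C G) (Hom_complex (quotient_complex Q D) G)"
proof -
  let ?R = "quotient_complex Q D"
  have ch: "ch ?R n = ch Q n Mod D n" for n by (simp add: quotient_complex_def)
  have grQ: "group (ch Q n)" for n
    using Q(1) comm_group.axioms(2) by blast
  have cgC: "comm_group (ch C n)" for n using C by (simp add: chain_complex_def)
  have grC: "group (ch C n)" for n
    using cgC comm_group.axioms(2) by blast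
  have nor: "D n \<lhd> ch Q n" for n
    by (rule comm_group.normal_iff_subgroup[THEN iffD2, OF Q(1) D(1)])
  have cgR: "comm_group (ch ?R n)" for n
    unfolding ch by (rule comm_group.abelian_FactGroup[OF Q(1) D(1)])
  have grR: "group (ch Q n Mod D n)" for n
    by (rule normal.factorgroup_is_group[OF nor])
  define cl where "cl n x = D n #>\<^bsub>ch Q n\<^esub> x" for n x
  have cl: "cl n \<in> hom (ch Q n) (ch Q n Mod D n)" for n
    unfolding cl_def[abs_def] by (rule normal.r_coset_hom_Mod[OF nor])
  have clc: "cl n x \<in> carrier (ch Q n Mod D n)" if "x \<in> carrier (ch Q n)" for n x
    using cl that by (auto simp: hom_def)
  have clm: "cl n (x \<otimes>\<^bsub>ch Q n\<^esub> y) = cl n x \<otimes>\<^bsub>ch Q n Mod D n\<^esub> cl n y"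
    if "x \<in> carrier (ch Q n)" "y \<in> carrier (ch Q n)" for n x y
    using cl that by (auto simp: hom_def)
  have cl1: "cl n \<one>\<^bsub>ch Q n\<^esub> = \<one>\<^bsub>ch Q n Mod D n\<^esub>" for n
    by (rule hom_one[OF cl grQ grR])
  have clD: "cl n d = \<one>\<^bsub>ch Q n Mod D n\<^esub>" if "d \<in> D n" for n d
    using group.coset_join2[OF grQ _ D(1) that] subgroup.subset[OF D(1)] that
    by (auto simp: cl_def FactGroup_def)
  have rep: "\<exists>x\<in>carrier (ch Q n). S = cl n x" if "S \<in> carrier (ch Q n Mod D n)" for n S
    using that by (auto simp: FactGroup_def RCOSETS_def cl_def)
  have \<phi>c: "\<phi> n x \<in> carrier (ch Q n)" if "x \<in> carrier (ch C n)" for n x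
    using \<phi>(1) that by (auto simp: hom_def)
  have \<psi>c: "\<psi> n x \<in> carrier (ch C n)" if "x \<in> carrier (ch Q n)" for n x
    using \<psi>(1) that by (auto simp: hom_def)
  have tc: "t n x \<in> carrier (ch Q (Suc n))" if "x \<in> carrier (ch Q n)" for n x
    using t(1) that by (auto simp: hom_def)
  have bc: "bd Q n x \<in> carrier (ch Q n)" if "x \<in> carrier (ch Q (Suc n))" for n x
    using Q(2) that by (auto simp: hom_def)
  have bdR: "bd ?R n S = the_elem ((\<lambda>x. cl n (bd Q n x)) ` S)" for n S
    by (simp add: quotient_complex_def cl_def)
  have bdhom: "(\<lambda>x. cl n (bd Q n x)) \<in> hom (ch Q (Suc n)) (ch Q n Mod D n)" for n
    using hom_compose[OF Q(2) cl] by (simp add: comp_def)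
  have bdR_cl: "bd ?R n (cl (Suc n) x) = cl n (bd Q n x)" if "x \<in> carrier (ch Q (Suc n))" for n x
    unfolding bdR cl_def[of "Suc n"]
    by (rule FactGroup_induced_eq[OF nor grR bdhom _ that]) (rule clD, rule D(2))
  have bdR_hom: "bd ?R n \<in> hom (ch Q (Suc n) Mod D (Suc n)) (ch Q n Mod D n)" for n
    unfolding bdR[abs_def] by (rule FactGroup_induced_hom[OF nor grR bdhom]) (rule clD, rule D(2))
  \<comment> \<open>Only \<open>g\<close> and \<open>u\<close> start at the quotient and have to be
    well defined on cosets: \<open>\<psi>\<close> kills \<open>D n\<close>, and \<open>t\<close>
    maps \<open>D n\<close> into \<open>D (Suc n)\<close>. For \<open>f\<close> it is enough to take
    classes of values.\<close>
  define f where "f n x = cl n (\<phi> n x)" for n x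
  define g where "g n S = the_elem (\<psi> n ` S)" for n S
  define u where "u n S = the_elem ((\<lambda>x. cl (Suc n) (t n x)) ` S)" for n S
  have g_cl: "g n (cl n x) = \<psi> n x" if "x \<in> carrier (ch Q n)" for n x
    unfolding g_def cl_def by (rule FactGroup_induced_eq[OF nor grC \<psi>(1,2) that])
  have g_hom: "g n \<in> hom (ch Q n Mod D n) (ch C n)" for n
    unfolding g_def[abs_def] by (rule FactGroup_induced_hom[OF nor grC \<psi>(1,2)])
  have thom: "(\<lambda>x. cl (Suc n) (t n x)) \<in> hom (ch Q n) (ch Q (Suc n) Mod D (Suc n))" for n
    using hom_compose[OF t(1) cl] by (simp add: comp_def)
  have u_cl: "u n (cl n x) = cl (Suc n) (t n x)" if "x \<in> carrier (ch Q n)" for n x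
    unfolding u_def cl_def[of n] by (rule FactGroup_induced_eq[OF nor grR thom _ that]) (rule clD, rule t(2))
  have u_hom: "u n \<in> hom (ch Q n Mod D n) (ch Q (Suc n) Mod D (Suc n))" for n
    unfolding u_def[abs_def] by (rule FactGroup_induced_hom[OF nor grR thom]) (rule clD, rule t(2))
  have f_hom: "f n \<in> hom (ch C n) (ch Q n Mod D n)" for n
    using hom_compose[OF \<phi>(1) cl] by (simp add: comp_def f_def[abs_def])
  have bCc: "bd C n x \<in> carrier (ch C n)" if "x \<in> carrier (ch C (Suc n))" for n x
    using C that by (auto simp: chain_complex_def hom_def)
  show ?thesis
  proof (rule cochain_homotopy_equivalent_Hom[OF G C])
    show "chain_complex ?R"
      unfolding chain_complex_def
    proof (intro conjI allI ballI)
      fix n S assume "S \<in> carrier (ch ?R (Suc (Suc n)))"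
      then obtain x where "x \<in> carrier (ch Q (Suc (Suc n)))" "S = cl (Suc (Suc n)) x"
        using rep ch by metis
      then show "bd ?R n (bd ?R (Suc n) S) = \<one>\<^bsub>ch ?R n\<^esub>"
        using QQ clD by (simp add: bdR_cl bc ch)
    qed (use cgR bdR_hom ch in auto)
    show "chain_map C ?R f"
      using f_hom \<phi>(2) by (auto simp: chain_map_def ch f_def bdR_cl \<phi>c cl_def[symmetric])
    show "chain_map ?R C g"
      unfolding chain_map_def ch
    proof (intro conjI allI ballI)
      fix n S assume "S \<in> carrier (ch Q (Suc n) Mod D (Suc n))"
      then obtain x where "x \<in> carrier (ch Q (Suc n))" "S = cl (Suc n) x"
        using rep by metis
      then show "bd C n (g (Suc n) S) = g n (bd ?R n S)"
        by (simp add: g_cl bdR_cl bc \<psi>)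
    qed (rule g_hom)
    have "g n (f n x) = \<psi> n (\<phi> n x)" if "x \<in> carrier (ch C n)" for n x
      using that by (simp add: f_def g_cl \<phi>c)
    then show "chain_homotopic_id C (\<lambda>n x. g n (f n x))"
      using s by (simp add: chain_homotopic_id_def cong: ball_cong)
    show "chain_homotopic_id ?R (\<lambda>n y. f n (g n y))"
      unfolding chain_homotopic_id_def ch
    proof (intro exI[of _ u] conjI allI ballI u_hom)
      fix n S assume "S \<in> carrier (ch Q n Mod D n)"
      then obtain x where x: "x \<in> carrier (ch Q n)" "S = cl n x"
        using rep by metis
      let ?y = "case n of 0 \<Rightarrow> \<one>\<^bsub>ch Q n\<^esub> | Suc m \<Rightarrow> t m (bd Q m x)"
      have y: "?y \<in> carrier (ch Q n)"
        using x tc bc group.is_monoid[OF grQ] by (auto split: nat.split intro: monoid.one_closed)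
      have y': "(case n of 0 \<Rightarrow> \<one>\<^bsub>ch Q n Mod D n\<^esub> | Suc m \<Rightarrow> u m (bd ?R m S)) = cl n ?y"
        using x by (auto split: nat.split simp: cl1 bdR_cl u_cl bc)
      have "f n (g n S) = cl n (?y \<otimes>\<^bsub>ch Q n\<^esub> bd Q n (t n x) \<otimes>\<^bsub>ch Q n\<^esub> x)"
        using x t(3)[of x n] by (simp add: f_def g_cl cl_def[symmetric])
      also have "\<dots> = cl n ?y \<otimes>\<^bsub>ch Q n Mod D n\<^esub> bd ?R n (u n S) \<otimes>\<^bsub>ch Q n Mod D n\<^esub> S"
        using x y group.is_monoid[OF grQ]
        by (simp add: clm bc tc monoid.m_closed u_cl bdR_cl)
      finally show "f n (g n S) = (case n of 0 \<Rightarrow> \<one>\<^bsub>ch Q n Mod D n\<^esub> | Suc m \<Rightarrow> u m (bd ?R m S))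
          \<otimes>\<^bsub>ch Q n Mod D n\<^esub> bd ?R n (u n S) \<otimes>\<^bsub>ch Q n Mod D n\<^esub> S"
        by (simp only: y')
    qed
  qed
qed

section \<open>Singular cubes\<close>

text \<open>An extra degeneracy on the singular simplices of \<open>K\<close>: coning from the apex
  \<open>v\<close> adds a new vertex 0. It is a condition on single simplices, so that the three
  intervals can supply it by different means.\<close>

definition simp_contractible ::
  "(nat \<Rightarrow> 's cspace) \<Rightarrow> (nat \<Rightarrow> 's \<Rightarrow> 's) \<Rightarrow> 'k cspace \<Rightarrow> bool" where
  "simp_contractible \<Delta> d K \<longleftrightarrow> (\<exists>v\<in>pts K. \<exists>c. \<forall>n. \<forall>\<sigma>\<in>cmaps (\<Delta> n) K.
     c n \<sigma> \<in> cmaps (\<Delta> (Suc n)) K \<and> compose (pts (\<Delta> n)) (c n \<sigma>) (d 0) = \<sigma> \<and>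
     (\<forall>i\<le>n. compose (pts (\<Delta> n)) (c n \<sigma>) (d (Suc i)) =
       (case n of 0 \<Rightarrow> (\<lambda>_\<in>pts (\<Delta> 0). v) | Suc m \<Rightarrow> c m (compose (pts (\<Delta> m)) \<sigma> (d i)))))"

text \<open>The parameter of the contraction becomes the first coordinate, so the faces and
  degeneracies of the old cube reappear with index raised by one.\<close>

definition cube_cone :: "('j::{zero,one} \<Rightarrow> 'k \<Rightarrow> 'k) \<Rightarrow> 'j cspace \<Rightarrow> nat \<Rightarrow> ((nat \<Rightarrow> 'j) \<Rightarrow> 'k) \<Rightarrow> (nat \<Rightarrow> 'j) \<Rightarrow> 'k" where
  "cube_cone H J n \<sigma> = (\<lambda>x\<in>pts (cpower J (Suc n)). H (x 1) (\<sigma> (\<lambda>k\<in>{1..n}. x (Suc k))))"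

text \<open>Continuity is required of each coned cube and not of \<open>H\<close> on a product of
  \<open>J\<close> and \<open>K\<close>: \<open>cprod\<close> forms products of spaces of one type,
  and only coned cubes occur in the chain contraction.\<close>

definition cube_contractible :: "'j::{zero,one} cspace \<Rightarrow> 'k cspace \<Rightarrow> bool" where
  "cube_contractible J K \<longleftrightarrow> (\<exists>v\<in>pts K. \<exists>H. (\<forall>y\<in>pts K. H 0 y = v \<and> H 1 y = y) \<and>
     (\<forall>n. \<forall>\<sigma>\<in>cmaps (cpower J n) K. cube_cone H J n \<sigma> \<in> cmaps (cpower J (Suc n)) K))"

lemma pts_cpower: "pts (cpower J n) = (\<Pi>\<^sub>E k\<in>{1..n}. pts J)"
  by (simp add: cpower_def)

lemma compose_restrict_right: "compose A f (restrict g A) = compose A f g"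
  by (auto simp: compose_def)

lemma compose_compose: "g ` A \<subseteq> B \<Longrightarrow> compose A (compose B f h) g = compose A f (compose A h g)"
  by (auto simp: compose_def fun_eq_iff)

text \<open>The source of the cubical face identities, and with \<open>a = b = 0\<close> also of
  those for topological simplices, whose faces insert a zero coordinate.\<close>

lemma insert_coord_insert_coord:
  assumes "i < j"
  shows "insert_coord j a (insert_coord i b x) = insert_coord i b (insert_coord (j - 1) a x)"
proof
  fix k
  obtain j' where j: "j = Suc j'" "i \<le> j'" using assms by (cases j) auto
  show "insert_coord j a (insert_coord i b x) k = insert_coord i b (insert_coord (j - 1) a x) k"
  proof (cases "k \<le> Suc j'")
    case True
    then consider "k < i" | "k = i" | "i < k" "k \<le> j'" | "k = Suc j'" by linarith
    then show ?thesis
      by cases (use j in \<open>simp_all add: insert_coord_def\<close>)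
  next
    case False
    then obtain k' where "k = Suc k'" "j' < k'" by (cases k) auto
    then show ?thesis using j by (simp add: insert_coord_def)
  qed
qed

lemma insert_coord_upd:
  assumes "1 \<le> i" "1 \<le> j"
  shows "(insert_coord i a x)(j := b) =
    (if j = i then insert_coord i b x else insert_coord i a (x((if j < i then j else j - 1) := b)))"
proof
  fix k
  consider "k < i" | "k = i" | k' where "k = Suc k'" "i \<le> k'"
    by (cases k) (auto, linarith)
  then show "((insert_coord i a x)(j := b)) k =
    (if j = i then insert_coord i b x else insert_coord i a (x((if j < i then j else j - 1) := b))) k"
    by cases (use assms in \<open>auto simp: insert_coord_def\<close>)
qed

section \<open>Cubical boundary, degenerate chains and normalization\<close>

locale cube_model =
  fixes J :: "'j::{zero,one} cspace"
  assumes closure_J: "closure_space J" and J01: "0 \<in> pts J" "1 \<in> pts J"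
begin

abbreviation "sq n \<equiv> cpower J n"

definition "A n i a = restrict (insert_coord i a) (pts (sq n))"
definition "p n i = restrict (\<lambda>x. x(i := 0)) (pts (sq n))"

definition dQ :: "nat \<Rightarrow> ((nat \<Rightarrow> 'j) \<Rightarrow> nat \<Rightarrow> 'j) \<Rightarrow>\<^sub>0 int" where
  "dQ n = (\<Sum>i = 1..Suc n. frag_cmul ((-1) ^ i) (frag_of (A n i 0) - frag_of (A n i 1)))"

definition degen :: "nat \<Rightarrow> 'k cspace \<Rightarrow> (((nat \<Rightarrow> 'j) \<Rightarrow> 'k) \<Rightarrow>\<^sub>0 int) set" where
  "degen n X = chains {\<sigma> \<in> cmaps (sq n) X. degenerate_cube J n \<sigma>}"

definition killed :: "nat \<Rightarrow> 'y cspace \<Rightarrow> (('y \<Rightarrow> nat \<Rightarrow> 'j) \<Rightarrow>\<^sub>0 int) set" where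
  "killed n Y = {x \<in> Chom Y (sq n). \<forall>j\<in>{1..n}. ccomp Y (frag_of (p n j)) x = 0}"

lemma closure_sq [simp]: "closure_space (sq n)"
  unfolding cpower_def by (rule closure_space_cprod) (rule closure_J)

lemma ccontinuous_sq:
  assumes "closure_space X" "\<And>k. k \<in> {1..n} \<Longrightarrow> ccontinuous X J (\<lambda>x. f x k)"
    "\<And>x. x \<in> pts X \<Longrightarrow> f x \<in> extensional {1..n}"
  shows "ccontinuous X (sq n) f"
  unfolding cpower_def by (rule ccontinuous_cprod) (use assms closure_J in auto)

lemma ccontinuous_sq_proj: "k \<in> {1..n} \<Longrightarrow> ccontinuous (sq n) J (\<lambda>x. x k)"
  unfolding cpower_def using ccontinuous_proj[of "{1..n}" "\<lambda>_. J"] closure_J by blast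

lemma insert_coord_in:
  assumes "x \<in> pts (sq n)" "a \<in> pts J" "i \<in> {1..Suc n}"
  shows "insert_coord i a x \<in> pts (sq (Suc n))"
  unfolding pts_cpower
proof (rule PiE_I)
  have x: "x k \<in> pts J" if "k \<in> {1..n}" for k
    using assms(1) that by (auto simp: pts_cpower)
  show "insert_coord i a x k \<in> pts J" if "k \<in> {1..Suc n}" for k
  proof -
    have "i < k \<Longrightarrow> k - 1 \<in> {1..n}" "k < i \<Longrightarrow> k \<in> {1..n}"
      using that assms(3) by auto
    then show ?thesis
      using x[of k] x[of "k - 1"] assms(2) by (simp add: insert_coord_def)
  qed
  have x': "x k = undefined" if "k \<notin> {1..n}" for k
    using assms(1) that unfolding pts_cpower by (rule PiE_arb)
  show "insert_coord i a x k = undefined" if "k \<notin> {1..Suc n}" for k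
  proof -
    have "k - 1 \<notin> {1..n}" "\<not> k < i \<Longrightarrow> k \<noteq> i" "k < i \<Longrightarrow> k \<notin> {1..n}"
      using that assms(3) by auto
    then show ?thesis
      using x'[of k] x'[of "k - 1"] by (simp add: insert_coord_def)
  qed
qed

lemma upd_in: "x \<in> pts (sq n) \<Longrightarrow> a \<in> pts J \<Longrightarrow> i \<in> {1..n} \<Longrightarrow> x(i := a) \<in> pts (sq n)"
  by (auto simp: pts_cpower PiE_iff extensional_def)

lemma A_cmaps: 
  assumes "i \<in> {1..Suc n}" "a \<in> pts J" shows "A n i a \<in> cmaps (sq n) (sq (Suc n))"
  unfolding A_def restrict_cmaps[OF closure_sq]
proof (rule ccontinuous_sq)
  fix k assume k: "k \<in> {1..Suc n}"
  consider "k < i" | "k = i" | "k > i" by linarith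
  then show "ccontinuous (sq n) J (\<lambda>x. insert_coord i a x k)"
  proof cases
    case 1
    then show ?thesis using ccontinuous_sq_proj[of k n] k assms by (simp add: insert_coord_def)
  next
    case 2
    then show ?thesis using ccontinuous_const[OF closure_sq closure_J assms(2)] by (simp add: insert_coord_def)
  next
    case 3
    then have "k - 1 \<in> {1..n}" using k assms by auto
    then show ?thesis using ccontinuous_sq_proj[of "k - 1" n] 3 by (simp add: insert_coord_def)
  qed
next
  fix x assume "x \<in> pts (sq n)"
  then show "insert_coord i a x \<in> extensional {1..Suc n}"
    using insert_coord_in[OF _ assms(2,1)] by (simp add: pts_cpower PiE_iff)
qed simp

lemma p_cmaps: 
  assumes "i \<in> {1..n}" shows "p n i \<in> cmaps (sq n) (sq n)"
  unfolding p_def restrict_cmaps[OF closure_sq]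
proof (rule ccontinuous_sq)
  fix k assume k: "k \<in> {1..n}"
  show "ccontinuous (sq n) J (\<lambda>x. (x(i := 0)) k)"
    using ccontinuous_sq_proj[OF k] ccontinuous_const[OF closure_sq closure_J J01(1)]
    by (cases "k = i") simp_all
next
  fix x assume "x \<in> pts (sq n)"
  then show "x(i := 0) \<in> extensional {1..n}"
    using upd_in[OF _ J01(1) assms] by (simp add: pts_cpower PiE_iff)
qed simp

lemma A_Chom: "i \<in> {1..Suc n} \<Longrightarrow> a = 0 \<or> a = 1 \<Longrightarrow> frag_of (A n i a) \<in> Chom (sq n) (sq (Suc n))"
  using A_cmaps J01 by auto

lemma p_Chom: "i \<in> {1..n} \<Longrightarrow> frag_of (p n i) \<in> Chom (sq n) (sq n)"
  using p_cmaps by auto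

lemma dQ_Chom [simp]: "dQ n \<in> Chom (sq n) (sq (Suc n))"
  unfolding dQ_def by (intro chains_sum chains_cmul chains_diff A_Chom) auto

lemma A_A:
  assumes "1 \<le> i" "i < j" "j \<le> Suc (Suc n)" "a \<in> pts J" "b \<in> pts J"
  shows "compose (pts (sq n)) (A (Suc n) j a) (A n i b) = compose (pts (sq n)) (A (Suc n) i b) (A n (j - 1) a)"
proof
  fix x
  have "insert_coord j a (insert_coord i b x) = insert_coord i b (insert_coord (j - 1) a x)"
    using assms by (intro insert_coord_insert_coord)
  moreover have "j - 1 \<in> {1..Suc n}"
    using assms by auto
  ultimately show "compose (pts (sq n)) (A (Suc n) j a) (A n i b) x = compose (pts (sq n)) (A (Suc n) i b) (A n (j - 1) a) x"
    using insert_coord_in[of x n b i] insert_coord_in[of x n a "j - 1"] assms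
    by (auto simp: compose_def A_def)
qed

text \<open>Resetting the inserted coordinate erases \<open>a\<close>, so \<open>p\<close>
  annihilates the difference of the two opposite faces in its own direction; in the other directions
  it moves past the face. Both \<open>deg_bd\<close> and \<open>killed_dQ\<close> rest on this
  dichotomy.\<close>

lemma p_A:
  assumes "i \<in> {1..Suc n}" "j \<in> {1..Suc n}" "a \<in> pts J"
  shows "compose (pts (sq n)) (p (Suc n) j) (A n i a) =
    (if j = i then A n i 0 else compose (pts (sq n)) (A n i a) (p n (if j < i then j else j - 1)))"
proof
  fix x
  have "(insert_coord i a x)(j := 0) =
      (if j = i then insert_coord i 0 x else insert_coord i a (x((if j < i then j else j - 1) := 0)))"
    using assms by (intro insert_coord_upd) auto
  moreover have "j \<noteq> i \<Longrightarrow> (if j < i then j else j - 1) \<in> {1..n}"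
    using assms by auto
  ultimately show "compose (pts (sq n)) (p (Suc n) j) (A n i a) x =
    (if j = i then A n i 0 else compose (pts (sq n)) (A n i a) (p n (if j < i then j else j - 1))) x"
    using insert_coord_in[of x n a i] upd_in[OF _ J01(1), of x n "if j < i then j else j - 1"] assms
    by (auto simp: compose_def A_def p_def)
qed

text \<open>Commuting idempotents: this makes the product of the \<open>1 - p\<close> a projector
  annihilated by every \<open>p\<close>.\<close>

lemma p_p:
  assumes "i \<in> {1..n}" "j \<in> {1..n}"
  shows "compose (pts (sq n)) (p n i) (p n j) = compose (pts (sq n)) (p n j) (p n i)"
    "compose (pts (sq n)) (p n i) (p n i) = p n i"
  using upd_in[OF _ J01(1) assms(1)] upd_in[OF _ J01(1) assms(2)]
  by (auto simp: compose_def p_def fun_eq_iff)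

lemma dQ_dQ: "ccomp (sq n) (dQ (Suc n)) (dQ n) = 0"
proof -
  define a where "a i j = ccomp (sq n) (frag_of (A (Suc n) j 0) - frag_of (A (Suc n) j 1))
    (frag_of (A n i 0) - frag_of (A n i 1))" for i j
  have "ccomp (sq n) (dQ (Suc n)) (dQ n) = (\<Sum>j=1..Suc (Suc n). \<Sum>i=1..Suc n. frag_cmul ((-1) ^ (i + j)) (a i j))"
    unfolding dQ_def ccomp_sum_left ccomp_sum_right a_def
    by (subst sum.swap) (simp only: ccomp_left(5) ccomp_right(5) frag_cmul_cmul power_add mult.commute)
  also have "\<dots> = 0"
  proof (rule alternating_double_sum)
    fix i j :: nat assume "1 \<le> i" "i < j" "j \<le> Suc (Suc n)"
    then show "a i j = a (j - 1) i"
      using A_A[of i j n] J01 unfolding a_def by (simp add: ccomp_left ccomp_right)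
  qed
  finally show ?thesis .
qed

text \<open>All points that differ only in coordinate \<open>i\<close> have the same reset, so
  invariance under this one map gives independence of every value. Degeneracy becomes an equation
  between composites.\<close>

lemma degenerate_iff:
  assumes "\<sigma> \<in> cmaps (sq n) X"
  shows "degenerate_cube J n \<sigma> \<longleftrightarrow> (\<exists>i\<in>{1..n}. compose (pts (sq n)) \<sigma> (p n i) = \<sigma>)"
proof -
  have "(\<forall>x\<in>pts (sq n). \<forall>t\<in>pts J. \<sigma> (x(i := t)) = \<sigma> x) \<longleftrightarrow> compose (pts (sq n)) \<sigma> (p n i) = \<sigma>" (is "?L \<longleftrightarrow> ?R")
    if i: "i \<in> {1..n}" for i
  proof
    assume ?L
    then show ?R
      using J01 assms by (auto simp: compose_def p_def fun_eq_iff cmaps_def extensional_def)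
  next
    assume R: ?R
    have 0: "\<sigma> (x(i := 0)) = \<sigma> x" if "x \<in> pts (sq n)" for x
      using fun_cong[OF R, of x] that by (simp add: compose_def p_def)
    show ?L
      using 0 upd_in[OF _ _ i] by (metis fun_upd_upd)
  qed
  then show ?thesis
    unfolding degenerate_cube_def by blast
qed

lemma deg_iff: "degen n X = chains {\<sigma> \<in> cmaps (sq n) X. \<exists>i\<in>{1..n}. compose (pts (sq n)) \<sigma> (p n i) = \<sigma>}"
  unfolding degen_def using degenerate_iff by (intro arg_cong[of _ _ chains]) blast

lemma deg_Chom: "z \<in> degen n X \<Longrightarrow> z \<in> Chom (sq n) X"
  unfolding degen_def by (erule chains_mono[rotated]) auto

lemma deg_simps [intro]:
  "0 \<in> degen n X" "a \<in> degen n X \<Longrightarrow> b \<in> degen n X \<Longrightarrow> a - b \<in> degen n X"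
  "a \<in> degen n X \<Longrightarrow> b \<in> degen n X \<Longrightarrow> a + b \<in> degen n X" "a \<in> degen n X \<Longrightarrow> - a \<in> degen n X"
  unfolding degen_def by auto

lemma deg_left:
  assumes "a \<in> Chom Y X" "b \<in> degen n Y"
  shows "ccomp (sq n) a b \<in> degen n X"
  unfolding deg_iff
proof (rule ccomp_in_chains[OF assms(1) assms(2)[unfolded deg_iff]])
  fix f g assume f: "f \<in> cmaps Y X" and "g \<in> {\<sigma> \<in> cmaps (sq n) Y. \<exists>i\<in>{1..n}. compose (pts (sq n)) \<sigma> (p n i) = \<sigma>}"
  then obtain i where g: "g \<in> cmaps (sq n) Y" "i \<in> {1..n}" "compose (pts (sq n)) g (p n i) = g" by auto
  then have "compose (pts (sq n)) (compose (pts (sq n)) f g) (p n i) = compose (pts (sq n)) f g"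
    using p_cmaps[OF g(2)] by (subst compose_compose) (auto simp: cmaps_def ccontinuous_def)
  then show "compose (pts (sq n)) f g \<in> {\<sigma> \<in> cmaps (sq n) X. \<exists>i\<in>{1..n}. compose (pts (sq n)) \<sigma> (p n i) = \<sigma>}"
    using f g cmaps_compose[OF f g(1)] by auto
qed

lemma deg_kill:
  assumes "z \<in> degen n X" "x \<in> killed n Y"
  shows "ccomp Y z x = 0"
  using assms(1) unfolding deg_iff
proof (induction rule: chains_induct)
  case (one \<sigma>)
  then obtain i where i: "i \<in> {1..n}" "compose (pts (sq n)) \<sigma> (p n i) = \<sigma>" by auto
  have "ccomp Y (frag_of \<sigma>) x = ccomp Y (ccomp (sq n) (frag_of \<sigma>) (frag_of (p n i))) x"
    by (simp add: i)
  also have "\<dots> = 0"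
    using assms(2) i by (subst Chom_assoc) (auto simp: killed_def ccomp_right)
  finally show ?case .
qed (auto simp: ccomp_left)

lemma p_deg: "i \<in> {1..n} \<Longrightarrow> frag_of (p n i) \<in> degen n (sq n)"
  unfolding deg_iff using p_cmaps p_p(2) by (auto intro!: bexI[of _ i])

text \<open>In the degenerate direction the opposite faces coincide and cancel; in every other
  direction each face is again degenerate.\<close>

lemma deg_bd:
  assumes "z \<in> degen (Suc n) X"
  shows "ccomp (sq n) z (dQ n) \<in> degen n X"
  using assms unfolding deg_iff[of "Suc n"]
proof (induction rule: chains_induct)
  case (one \<sigma>)
  then obtain j where \<sigma>: "\<sigma> \<in> cmaps (sq (Suc n)) X" and j: "j \<in> {1..Suc n}"
    and eq: "compose (pts (sq (Suc n))) \<sigma> (p (Suc n) j) = \<sigma>" by auto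
  have "ccomp (sq n) (frag_of \<sigma>) (frag_of (A n i 0) - frag_of (A n i 1)) \<in> degen n X" if i: "i \<in> {1..Suc n}" for i
  proof -
    have sA: "compose (pts (sq n)) \<sigma> (A n i a) = compose (pts (sq n)) \<sigma> (compose (pts (sq n)) (p (Suc n) j) (A n i a))"
      if "a \<in> pts J" for a
      using A_cmaps[OF i that] eq compose_compose[of "A n i a" "pts (sq n)" "pts (sq (Suc n))" \<sigma> "p (Suc n) j"]
      by (auto simp: cmaps_def ccontinuous_def)
    show ?thesis
    proof (cases "j = i")
      case True
      then have "compose (pts (sq n)) (p (Suc n) j) (A n i a) = A n i 0" if "a \<in> pts J" for a
        using p_A[OF i j that] by simp
      then have "compose (pts (sq n)) \<sigma> (A n i 0) = compose (pts (sq n)) \<sigma> (A n i 1)"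
        using sA[OF J01(2)] J01 by metis
      then show ?thesis by (auto simp: ccomp_right)
    next
      case False
      define j' where "j' = (if j < i then j else j - 1)"
      have j': "j' \<in> {1..n}" using False i j by (auto simp: j'_def)
      have "frag_of (compose (pts (sq n)) \<sigma> (A n i a)) \<in> degen n X" if a: "a \<in> pts J" for a
      proof -
        have "compose (pts (sq n)) \<sigma> (A n i a) = compose (pts (sq n)) (compose (pts (sq n)) \<sigma> (A n i a)) (p n j')"
          using sA[OF a] p_A[OF i j a] False p_cmaps[OF j']
          by (subst compose_compose) (auto simp: j'_def cmaps_def ccontinuous_def)
        then show ?thesis
          using j' cmaps_compose[OF \<sigma> A_cmaps[OF i a]] unfolding deg_iff
          by (auto intro!: bexI[of _ j'])
      qed
      then show ?thesis
        using J01 by (auto simp: ccomp_right)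
    qed
  qed
  then have "(\<Sum>i=1..Suc n. frag_cmul ((-1) ^ i) (ccomp (sq n) (frag_of \<sigma>) (frag_of (A n i 0) - frag_of (A n i 1)))) \<in> degen n X"
    unfolding degen_def by (intro chains_sum chains_cmul) auto
  then show ?case
    by (simp only: dQ_def ccomp_sum_right ccomp_right(5))
qed (auto simp: ccomp_left)

lemma killed_simps [intro]:
  "0 \<in> killed n Y" "x \<in> killed n Y \<Longrightarrow> y \<in> killed n Y \<Longrightarrow> x - y \<in> killed n Y"
  "x \<in> killed n Y \<Longrightarrow> - x \<in> killed n Y"
  by (auto simp: killed_def ccomp_right)

text \<open>Mirror image of \<open>deg_bd\<close>: a \<open>p\<close> on the left annihilates the
  face difference in its own direction and otherwise moves past it to meet \<open>x\<close>.\<close>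

lemma killed_dQ:
  assumes "closure_space Y" "x \<in> killed n Y"
  shows "ccomp Y (dQ n) x \<in> killed (Suc n) Y"
  unfolding killed_def
proof (intro CollectI conjI ballI)
  have x: "x \<in> Chom Y (sq n)" using assms by (simp add: killed_def)
  then show "ccomp Y (dQ n) x \<in> Chom Y (sq (Suc n))" by (rule ccomp_Chom[OF assms(1) dQ_Chom])
  fix j assume j: "j \<in> {1..Suc n}"
  have "ccomp Y (ccomp (sq n) (frag_of (p (Suc n) j)) (frag_of (A n i 0) - frag_of (A n i 1))) x = 0"
    if i: "i \<in> {1..Suc n}" for i
  proof (cases "j = i")
    case True
    then show ?thesis using p_A[OF i j] J01 by (simp add: ccomp_right ccomp_left)
  next
    case False
    define j' where "j' = (if j < i then j else j - 1)"
    have j': "j' \<in> {1..n}" using False i j by (auto simp: j'_def)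
    have "ccomp (sq n) (frag_of (p (Suc n) j)) (frag_of (A n i 0) - frag_of (A n i 1)) =
      ccomp (sq n) (frag_of (A n i 0) - frag_of (A n i 1)) (frag_of (p n j'))"
      using p_A[OF i j] False J01 by (simp add: ccomp_right ccomp_left j'_def)
    then show ?thesis
      using assms j' by (simp add: Chom_assoc[OF x] killed_def ccomp_right)
  qed
  then have "ccomp Y (ccomp (sq n) (frag_of (p (Suc n) j)) (dQ n)) x = 0"
    unfolding dQ_def ccomp_sum_right ccomp_sum_left ccomp_right(5) ccomp_left(5)
    by (intro sum.neutral ballI) simp
  then show "ccomp Y (frag_of (p (Suc n) j)) (ccomp Y (dQ n) x) = 0"
    by (simp add: Chom_assoc[OF x])
qed

lemma killed_right:
  assumes "closure_space Y" "x \<in> killed n Z" "y \<in> Chom Y Z"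
  shows "ccomp Y x y \<in> killed n Y"
  using assms by (auto simp: killed_def ccomp_left simp flip: Chom_assoc[OF assms(3)])

text \<open>The projector \<open>(1 - p 1) \<cdots> (1 - p k)\<close> with respect to which chains are normalized.\<close>

primrec nrm :: "nat \<Rightarrow> nat \<Rightarrow> ((nat \<Rightarrow> 'j) \<Rightarrow> nat \<Rightarrow> 'j) \<Rightarrow>\<^sub>0 int" where
  "nrm n 0 = cid (sq n)"
| "nrm n (Suc k) = nrm n k - ccomp (sq n) (frag_of (p n (Suc k))) (nrm n k)"

text \<open>A new factor is annihilated by its own \<open>p\<close> through idempotence, and earlier
  \<open>p\<close> commute past it. It changes a chain by a term that starts with a
  \<open>p\<close>, hence by a degenerate one, and by zero on killed chains.\<close>

lemma nrm_partial:
  assumes "k \<le> n"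
  shows "nrm n k \<in> Chom (sq n) (sq n)" "nrm n k - cid (sq n) \<in> degen n (sq n)"
    "j \<in> {1..k} \<Longrightarrow> ccomp (sq n) (frag_of (p n j)) (nrm n k) = 0"
    "x \<in> killed n Y \<Longrightarrow> ccomp Y (nrm n k) x = x"
proof -
  have "nrm n k \<in> Chom (sq n) (sq n) \<and> nrm n k - cid (sq n) \<in> degen n (sq n) \<and>
    (\<forall>j\<in>{1..k}. ccomp (sq n) (frag_of (p n j)) (nrm n k) = 0) \<and>
    (\<forall>x\<in>killed n Y. ccomp Y (nrm n k) x = x)"
    using assms
  proof (induction k)
    case 0
    then show ?case by (auto simp: killed_def ccomp_cid_left)
  next
    case (Suc k)
    then have 1: "nrm n k \<in> Chom (sq n) (sq n)" and 2: "nrm n k - cid (sq n) \<in> degen n (sq n)"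
      and 3: "\<And>j. j \<in> {1..k} \<Longrightarrow> ccomp (sq n) (frag_of (p n j)) (nrm n k) = 0"
      and 4: "\<And>x. x \<in> killed n Y \<Longrightarrow> ccomp Y (nrm n k) x = x"
      by auto
    have k: "Suc k \<in> {1..n}" using Suc by auto
    let ?p = "frag_of (p n (Suc k))"
    \<comment> \<open>Written so that every term is visibly degenerate; the last \<open>?p\<close>
      compensates for multiplying \<open>?p\<close> by the identity in the middle term.\<close>
    have "nrm n (Suc k) - cid (sq n) = (nrm n k - cid (sq n)) - ccomp (sq n) ?p (nrm n k - cid (sq n)) - ?p"
      by (simp add: ccomp_right ccomp_cid_right[OF p_Chom[OF k]])
    then have 22: "nrm n (Suc k) - cid (sq n) \<in> degen n (sq n)"
      by (simp only:) (intro deg_simps(2) 2 deg_left[OF p_Chom[OF k] 2] p_deg[OF k])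
    have 33: "ccomp (sq n) (frag_of (p n j)) (nrm n (Suc k)) = 0" if "j \<in> {1..Suc k}" for j
    proof -
      have j: "j \<in> {1..n}" using that k by auto
      have "ccomp (sq n) (frag_of (p n j)) (nrm n (Suc k)) = ccomp (sq n) (frag_of (p n j)) (nrm n k)
          - ccomp (sq n) (ccomp (sq n) (frag_of (p n j)) ?p) (nrm n k)"
        by (simp add: ccomp_right Chom_assoc[OF 1, symmetric] del: ccomp_of_of)
      also have "\<dots> = 0"
      proof (cases "j = Suc k")
        case True
        then show ?thesis using p_p(2)[OF k k] by simp
      next
        case False
        then have "ccomp (sq n) (frag_of (p n j)) (nrm n k) = 0" using 3 that by auto
        moreover have "ccomp (sq n) (frag_of (p n j)) ?p = ccomp (sq n) ?p (frag_of (p n j))"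
          using p_p(1)[OF j k] by simp
        ultimately show ?thesis
          by (simp add: Chom_assoc[OF 1] ccomp_right del: ccomp_of_of)
      qed
      finally show ?thesis .
    qed
    have "ccomp Y (nrm n (Suc k)) x = x" if x: "x \<in> killed n Y" for x
    proof -
      have xc: "x \<in> Chom Y (sq n)" "ccomp Y ?p x = 0" using x k by (auto simp: killed_def)
      then show ?thesis by (simp add: ccomp_left Chom_assoc[OF xc(1)] 4[OF x])
    qed
    then show ?case
      using 1 22 33 p_Chom[OF k] by (auto intro!: chains_diff)
  qed
  then show "nrm n k \<in> Chom (sq n) (sq n)" "nrm n k - cid (sq n) \<in> degen n (sq n)"
    "j \<in> {1..k} \<Longrightarrow> ccomp (sq n) (frag_of (p n j)) (nrm n k) = 0"
    "x \<in> killed n Y \<Longrightarrow> ccomp Y (nrm n k) x = x"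
    by auto
qed

lemma nrm_Chom [simp]: "nrm n n \<in> Chom (sq n) (sq n)"
  and nrm_cid: "nrm n n - cid (sq n) \<in> degen n (sq n)"
  and nrm_killed [simp]: "nrm n n \<in> killed n (sq n)"
  and nrm_fixes: "x \<in> killed n Y \<Longrightarrow> ccomp Y (nrm n n) x = x"
  using nrm_partial[of n n] by (auto simp: killed_def)

end

section \<open>Contraction of cubical chains\<close>

context cube_model begin

lemma tail_in: "x \<in> pts (sq (Suc n)) \<Longrightarrow> (\<lambda>k\<in>{1..n}. x (Suc k)) \<in> pts (sq n)"
  by (auto simp: pts_cpower)

lemma cube_cone_faces:
  assumes \<sigma>: "\<sigma> \<in> cmaps (sq n) K" and H: "\<And>y. y \<in> pts K \<Longrightarrow> H 0 y = v \<and> H 1 y = y"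
  shows "compose (pts (sq n)) (cube_cone H J n \<sigma>) (A n 1 0) = (\<lambda>_\<in>pts (sq n). v)"
    and "compose (pts (sq n)) (cube_cone H J n \<sigma>) (A n 1 1) = \<sigma>"
proof -
  have tl: "(\<lambda>k\<in>{1..n}. insert_coord 1 a x (Suc k)) = x" if "x \<in> pts (sq n)" for x and a :: 'j
    using that by (auto simp: pts_cpower insert_coord_def fun_eq_iff PiE_iff extensional_def)
  have K: "\<sigma> x \<in> pts K" if "x \<in> pts (sq n)" for x
    using \<sigma> that by (auto simp: cmaps_def ccontinuous_def)
  have eq: "compose (pts (sq n)) (cube_cone H J n \<sigma>) (A n 1 a) = (\<lambda>x\<in>pts (sq n). H a (\<sigma> x))"
    if "a \<in> pts J" for a
  proof
    fix x
    show "compose (pts (sq n)) (cube_cone H J n \<sigma>) (A n 1 a) x = (\<lambda>x\<in>pts (sq n). H a (\<sigma> x)) x"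
      using insert_coord_in[of x n a 1] that tl[of x a]
      by (simp add: compose_def A_def cube_cone_def) (simp add: insert_coord_def)
  qed
  show "compose (pts (sq n)) (cube_cone H J n \<sigma>) (A n 1 0) = (\<lambda>_\<in>pts (sq n). v)"
    unfolding eq[OF J01(1)] using H K by (intro restrict_ext) auto
  have "(\<lambda>x\<in>pts (sq n). H 1 (\<sigma> x)) = restrict \<sigma> (pts (sq n))"
    using H K by (intro restrict_ext) auto
  then show "compose (pts (sq n)) (cube_cone H J n \<sigma>) (A n 1 1) = \<sigma>"
    unfolding eq[OF J01(2)] using \<sigma> by (simp add: cmaps_def extensional_restrict)
qed

lemma cube_cone_face_Suc:
  assumes "i \<in> {1..Suc m}" "a \<in> pts J"
  shows "compose (pts (sq (Suc m))) (cube_cone H J (Suc m) \<sigma>) (A (Suc m) (Suc i) a) =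
    cube_cone H J m (compose (pts (sq m)) \<sigma> (A m i a))"
proof
  fix x
  have "(\<lambda>k\<in>{1..Suc m}. insert_coord (Suc i) a x (Suc k)) = insert_coord i a (\<lambda>k\<in>{1..m}. x (Suc k))"
    if "x \<in> pts (sq (Suc m))"
  proof
    fix k
    have "x k = undefined" if "k \<notin> {1..Suc m}"
      using \<open>x \<in> _\<close> that unfolding pts_cpower by (rule PiE_arb)
    then show "(\<lambda>k\<in>{1..Suc m}. insert_coord (Suc i) a x (Suc k)) k = insert_coord i a (\<lambda>k\<in>{1..m}. x (Suc k)) k"
      using assms by (cases k) (auto simp: insert_coord_def)
  qed
  moreover have "insert_coord (Suc i) a x 1 = x 1"
    using assms by (simp add: insert_coord_def)
  ultimately show "compose (pts (sq (Suc m))) (cube_cone H J (Suc m) \<sigma>) (A (Suc m) (Suc i) a) x =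
    cube_cone H J m (compose (pts (sq m)) \<sigma> (A m i a)) x"
    using insert_coord_in[of x "Suc m" a "Suc i"] assms tail_in[of x m]
    by (simp add: compose_def A_def cube_cone_def)
qed

text \<open>Lets the contraction act on chains modulo degenerate ones.\<close>

lemma cube_cone_degenerate:
  assumes i: "i \<in> {1..n}" and eq: "compose (pts (sq n)) \<sigma> (p n i) = \<sigma>"
  shows "compose (pts (sq (Suc n))) (cube_cone H J n \<sigma>) (p (Suc n) (Suc i)) = cube_cone H J n \<sigma>"
proof
  fix x :: "nat \<Rightarrow> 'j"
  let ?y = "\<lambda>k\<in>{1..n}. x (Suc k)"
  have "(\<lambda>k\<in>{1..n}. (x(Suc i := 0)) (Suc k)) = ?y(i := 0)"
    using i by (auto simp: fun_eq_iff)
  moreover have "\<sigma> (?y(i := 0)) = \<sigma> ?y" if "x \<in> pts (sq (Suc n))"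
    using fun_cong[OF eq, of ?y] tail_in[OF that] by (simp add: compose_def p_def)
  moreover have "(x(Suc i := 0)) 1 = x 1" using i by simp
  ultimately show "compose (pts (sq (Suc n))) (cube_cone H J n \<sigma>) (p (Suc n) (Suc i)) x = cube_cone H J n \<sigma> x"
    using upd_in[OF _ J01(1), of x "Suc n" "Suc i"] i
    by (simp add: compose_def p_def cube_cone_def del: fun_upd_apply)
qed

text \<open>The faces of a coned cube in its new direction are the cube itself and a constant cube;
  the others are cones on faces. The constant cube is degenerate in positive degree, while in degree
  0 its coefficient \<open>aug z\<close> vanishes. The cone on the boundary of \<open>z\<close> is
  degenerate because that boundary is.\<close>

lemma cube_acyclic:
  fixes K :: "'a cspace"
  assumes "cube_contractible J K" "closure_space K" "z \<in> Chom (sq n) K" "n = 0 \<Longrightarrow> aug z = 0"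
    "\<And>m. n = Suc m \<Longrightarrow> ccomp (sq m) z (dQ m) \<in> degen m K"
  shows "\<exists>w\<in>Chom (sq (Suc n)) K. ccomp (sq n) w (dQ n) - z \<in> degen n K"
proof -
  obtain v H where v: "v \<in> pts K" and H: "\<And>y. y \<in> pts K \<Longrightarrow> H 0 y = v \<and> H 1 y = y"
    and cone: "\<And>n \<sigma>. \<sigma> \<in> cmaps (sq n) K \<Longrightarrow> cube_cone H J n \<sigma> \<in> cmaps (sq (Suc n)) K"
    using assms(1) unfolding cube_contractible_def by blast
  define C where "C n = frag_extend (\<lambda>\<sigma>. frag_of (cube_cone H J n \<sigma>))" for n
  have C_of [simp]: "C n (frag_of \<sigma>) = frag_of (cube_cone H J n \<sigma>)" for n \<sigma> by (simp add: C_def)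
  have C_simps: "C n 0 = 0" "C n (a - b) = C n a - C n b" for n a b
    by (simp_all add: C_def frag_extend_diff)
  let ?k = "frag_of (\<lambda>_\<in>pts (sq n). v)"
  have key: "ccomp (sq n) (C n z) (dQ n) = z - frag_cmul (aug z) ?k -
      (case n of 0 \<Rightarrow> 0 | Suc m \<Rightarrow> C m (ccomp (sq m) z (dQ m)))"
    using assms(3)
  proof (induction rule: chains_induct)
    case (one \<sigma>)
    let ?f = "\<lambda>i. frag_of (compose (pts (sq n)) (cube_cone H J n \<sigma>) (A n i 0))
      - frag_of (compose (pts (sq n)) (cube_cone H J n \<sigma>) (A n i 1))"
    have "ccomp (sq n) (C n (frag_of \<sigma>)) (dQ n) = (\<Sum>i=1..Suc n. frag_cmul ((-1) ^ i) (?f i))"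
      unfolding dQ_def ccomp_sum_right ccomp_right(5) by (simp add: ccomp_right(3))
    \<comment> \<open>Faces are numbered from 1, so the first term has sign -1 and the end at
      parameter 1 counts positively. Shifting the remaining indices costs one more sign.\<close>
    also have "\<dots> = frag_of \<sigma> - ?k - (\<Sum>i=1..n. frag_cmul ((-1) ^ i) (?f (Suc i)))"
    proof -
      have "(\<Sum>i=1..Suc n. g i) = g 1 + (\<Sum>i=1..n. g (Suc i))" for g :: "nat \<Rightarrow> ((nat \<Rightarrow> 'j) \<Rightarrow> 'a) \<Rightarrow>\<^sub>0 int"
        using sum.shift_bounds_cl_Suc_ivl[of g 1 n] by (subst sum.atLeast_Suc_atMost) simp_all
      then show ?thesis
        using cube_cone_faces[OF one H] by (simp only:) (simp add: sum_negf flip: minus_frag_cmul)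
    qed
    also have "(\<Sum>i=1..n. frag_cmul ((-1) ^ i) (?f (Suc i))) =
      (case n of 0 \<Rightarrow> 0 | Suc m \<Rightarrow> C m (ccomp (sq m) (frag_of \<sigma>) (dQ m)))"
    proof (cases n)
      case (Suc m)
      have "frag_cmul ((-1) ^ i) (?f (Suc i)) =
          C m (frag_cmul ((-1) ^ i) (ccomp (sq m) (frag_of \<sigma>) (frag_of (A m i 0) - frag_of (A m i 1))))"
        if "i \<in> {1..n}" for i
        using that J01 unfolding Suc
        by (simp add: ccomp_right(3) cube_cone_face_Suc C_def frag_extend_cmul frag_extend_diff)
      then have "(\<Sum>i=1..n. frag_cmul ((-1) ^ i) (?f (Suc i))) =
          (\<Sum>i=1..n. C m (frag_cmul ((-1) ^ i) (ccomp (sq m) (frag_of \<sigma>) (frag_of (A m i 0) - frag_of (A m i 1)))))"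
        by (intro sum.cong) auto
      also have "\<dots> = C m (ccomp (sq m) (frag_of \<sigma>) (dQ m))"
        unfolding dQ_def ccomp_sum_right ccomp_right(5) C_def Suc
        by (subst frag_extend_sum) (simp_all add: comp_def)
      finally show ?thesis using Suc by simp
    qed simp
    finally show ?case by simp
  next
    case (diff a b)
    then show ?case
      by (simp add: C_simps ccomp_left frag_cmul_diff_distrib split: nat.split)
  qed (simp add: C_simps ccomp_left split: nat.split)
  have Cdeg: "C m a \<in> degen (Suc m) K" if "a \<in> degen m K" for m a
    using that unfolding deg_iff[of m]
  proof (induction rule: chains_induct)
    case (one \<sigma>)
    then obtain i where "\<sigma> \<in> cmaps (sq m) K" "i \<in> {1..m}" "compose (pts (sq m)) \<sigma> (p m i) = \<sigma>" by auto
    then show ?case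
      unfolding deg_iff C_of chains_of using cone cube_cone_degenerate[of i m \<sigma> H]
      by (intro CollectI conjI bexI[of _ "Suc i"]) auto
  qed (auto simp: C_simps)
  have "C n z \<in> Chom (sq (Suc n)) K"
    unfolding C_def by (rule chains_frag_extend[OF assms(3)]) (simp add: cone)
  moreover have "ccomp (sq n) (C n z) (dQ n) - z \<in> degen n K"
  proof (cases n)
    case 0
    then show ?thesis using key assms(4) by auto
  next
    case (Suc m)
    have "(\<lambda>_\<in>pts (sq n). v) \<in> cmaps (sq n) K"
      unfolding restrict_cmaps[OF closure_sq] by (rule ccontinuous_const[OF closure_sq assms(2) v])
    moreover have "compose (pts (sq n)) (\<lambda>_\<in>pts (sq n). v) (p n n) = (\<lambda>_\<in>pts (sq n). v)"
      using p_cmaps[of n n] Suc by (auto simp: compose_def fun_eq_iff cmaps_def ccontinuous_def)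
    ultimately have "?k \<in> degen n K"
      unfolding deg_iff chains_of using Suc by (intro CollectI conjI bexI[of _ n]) auto
    then have "frag_cmul (aug z) ?k \<in> degen n K"
      unfolding degen_def by (rule chains_cmul)
    moreover have "C m (ccomp (sq m) z (dQ m)) \<in> degen n K"
      using Cdeg assms(5) Suc by auto
    moreover have "ccomp (sq n) (C n z) (dQ n) - z = - frag_cmul (aug z) ?k - C m (ccomp (sq m) z (dQ m))"
      using key Suc by simp
    ultimately show ?thesis
      by (simp only:) (intro deg_simps)
  qed
  ultimately show ?thesis by blast
qed

end

text \<open>The four contractibility assumptions match the four constructions:
  \<open>cube_simp\<close> gives \<open>\<Phi>\<close>, \<open>simp_cube\<close> gives
  \<open>\<Psi>\<close>, and \<open>simp_simp\<close> and \<open>cube_cube\<close> give the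
  homotopies.\<close>

locale singular_model = cube_model J for J :: "'j::{zero,one} cspace" +
  fixes \<Delta> :: "nat \<Rightarrow> 's cspace" and d :: "nat \<Rightarrow> 's \<Rightarrow> 's"
  assumes closure_\<Delta> [simp]: "closure_space (\<Delta> n)"
    and d_continuous: "i \<le> Suc n \<Longrightarrow> ccontinuous (\<Delta> n) (\<Delta> (Suc n)) (d i)"
    and d_d: "i < j \<Longrightarrow> j \<le> Suc (Suc n) \<Longrightarrow> x \<in> pts (\<Delta> n) \<Longrightarrow> d j (d i x) = d i (d (j - 1) x)"
    and simp_simp: "simp_contractible \<Delta> d (\<Delta> m)"
    and simp_cube: "simp_contractible \<Delta> d (cpower J m)"
    and cube_simp: "cube_contractible J (\<Delta> m)"
    and cube_cube: "cube_contractible J (cpower J m)"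
begin

definition "face n i = restrict (d i) (pts (\<Delta> n))"

definition dD :: "nat \<Rightarrow> ('s \<Rightarrow> 's) \<Rightarrow>\<^sub>0 int" where
  "dD n = (\<Sum>i\<le>Suc n. frag_cmul ((-1) ^ i) (frag_of (face n i)))"

lemma d_in: "i \<le> Suc n \<Longrightarrow> x \<in> pts (\<Delta> n) \<Longrightarrow> d i x \<in> pts (\<Delta> (Suc n))"
  using d_continuous[of i n] by (auto simp: ccontinuous_def)

lemma face_cmaps: "i \<le> Suc n \<Longrightarrow> face n i \<in> cmaps (\<Delta> n) (\<Delta> (Suc n))"
  unfolding face_def by (simp add: restrict_cmaps d_continuous)

lemma dD_Chom [simp]: "dD n \<in> Chom (\<Delta> n) (\<Delta> (Suc n))"
  unfolding dD_def by (intro chains_sum chains_cmul) (simp add: face_cmaps)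

lemma compose_face: "compose (pts (\<Delta> n)) f (face n i) = compose (pts (\<Delta> n)) f (d i)"
  by (simp add: face_def compose_restrict_right)

lemma dD_dD: "ccomp (\<Delta> n) (dD (Suc n)) (dD n) = 0"
proof -
  define a where "a i j = frag_of (compose (pts (\<Delta> n)) (face (Suc n) j) (face n i))" for i j
  have "ccomp (\<Delta> n) (dD (Suc n)) (dD n) = (\<Sum>j=0..Suc (Suc n). \<Sum>i=0..Suc n. frag_cmul ((-1) ^ (i + j)) (a i j))"
    unfolding dD_def ccomp_sum_left ccomp_sum_right a_def atMost_atLeast0
    by (subst sum.swap) (simp only: ccomp_left(5) ccomp_right(5) frag_cmul_cmul power_add mult.commute ccomp_of_of)
  also have "\<dots> = 0"
  proof (rule alternating_double_sum)
    fix i j :: nat assume ij: "i < j" "j \<le> Suc (Suc n)"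
    have "compose (pts (\<Delta> n)) (face (Suc n) j) (face n i) =
        compose (pts (\<Delta> n)) (face (Suc n) i) (face n (j - 1))"
    proof
      fix x
      have i: "i \<le> Suc n" "j - 1 \<le> Suc n" using ij by auto
      show "compose (pts (\<Delta> n)) (face (Suc n) j) (face n i) x =
          compose (pts (\<Delta> n)) (face (Suc n) i) (face n (j - 1)) x"
        by (cases "x \<in> pts (\<Delta> n)")
          (simp_all only: compose_def face_def restrict_apply' restrict_apply d_d[OF ij] d_in i if_True if_False)
    qed
    then show "a i j = a (j - 1) i"
      unfolding a_def by (rule arg_cong)
  qed
  finally show ?thesis .
qed

lemma aug_dD_0: "aug (dD 0) = 0" by (simp add: dD_def)
lemma aug_dQ: "aug (dQ 0) = 0" by (simp add: dQ_def)

text \<open>Face 0 of the cone returns \<open>z\<close>; the other faces form the cone on its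
  boundary, or \<open>aug z\<close> times the apex in degree 0. In contrast to cubes no constant
  term survives in positive degree, so the filling is exact.\<close>

lemma simp_acyclic:
  assumes "simp_contractible \<Delta> d K" "z \<in> Chom (\<Delta> n) K" "n = 0 \<Longrightarrow> aug z = 0"
    "\<And>m. n = Suc m \<Longrightarrow> ccomp (\<Delta> m) z (dD m) = 0"
  shows "\<exists>w\<in>Chom (\<Delta> (Suc n)) K. ccomp (\<Delta> n) w (dD n) = z"
proof -
  obtain v c where *: "\<forall>n. \<forall>\<sigma>\<in>cmaps (\<Delta> n) K.
     c n \<sigma> \<in> cmaps (\<Delta> (Suc n)) K \<and> compose (pts (\<Delta> n)) (c n \<sigma>) (d 0) = \<sigma> \<and>
     (\<forall>i\<le>n. compose (pts (\<Delta> n)) (c n \<sigma>) (d (Suc i)) =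
       (case n of 0 \<Rightarrow> (\<lambda>_\<in>pts (\<Delta> 0). v) | Suc m \<Rightarrow> c m (compose (pts (\<Delta> m)) \<sigma> (d i))))"
    using assms(1) unfolding simp_contractible_def by (elim bexE exE)
  then have c: "\<And>n \<sigma>. \<sigma> \<in> cmaps (\<Delta> n) K \<Longrightarrow> c n \<sigma> \<in> cmaps (\<Delta> (Suc n)) K"
    and c0: "\<And>n \<sigma>. \<sigma> \<in> cmaps (\<Delta> n) K \<Longrightarrow> compose (pts (\<Delta> n)) (c n \<sigma>) (d 0) = \<sigma>"
    and cS: "\<And>n \<sigma> i. \<sigma> \<in> cmaps (\<Delta> n) K \<Longrightarrow> i \<le> n \<Longrightarrow> compose (pts (\<Delta> n)) (c n \<sigma>) (d (Suc i)) =
       (case n of 0 \<Rightarrow> (\<lambda>_\<in>pts (\<Delta> 0). v) | Suc m \<Rightarrow> c m (compose (pts (\<Delta> m)) \<sigma> (d i)))"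
    by auto
  define C where "C n = frag_extend (\<lambda>\<sigma>. frag_of (c n \<sigma>))" for n
  have C_of [simp]: "C n (frag_of \<sigma>) = frag_of (c n \<sigma>)" for n \<sigma> by (simp add: C_def)
  have C_simps: "C n 0 = 0" "C n (a - b) = C n a - C n b" for n a b
    by (simp_all add: C_def frag_extend_diff)
  have key: "ccomp (\<Delta> n) (C n z) (dD n) = z -
      (case n of 0 \<Rightarrow> frag_cmul (aug z) (frag_of (\<lambda>_\<in>pts (\<Delta> 0). v)) | Suc m \<Rightarrow> C m (ccomp (\<Delta> m) z (dD m)))"
    using assms(2)
  proof (induction rule: chains_induct)
    case (one \<sigma>)
    let ?f = "\<lambda>i. frag_of (compose (pts (\<Delta> n)) (c n \<sigma>) (d i))"
    have "ccomp (\<Delta> n) (C n (frag_of \<sigma>)) (dD n) = (\<Sum>i\<le>Suc n. frag_cmul ((-1) ^ i) (?f i))"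
      unfolding dD_def ccomp_sum_right ccomp_right(5) by (simp add: compose_face)
    also have "\<dots> = frag_of \<sigma> - (\<Sum>i\<le>n. frag_cmul ((-1) ^ i) (?f (Suc i)))"
      using c0[OF one] by (subst sum.atMost_Suc_shift) (simp add: sum_negf flip: minus_frag_cmul)
    also have "(\<Sum>i\<le>n. frag_cmul ((-1) ^ i) (?f (Suc i))) =
      (case n of 0 \<Rightarrow> frag_of (\<lambda>_\<in>pts (\<Delta> 0). v) | Suc m \<Rightarrow> C m (ccomp (\<Delta> m) (frag_of \<sigma>) (dD m)))"
    proof (cases n)
      case 0
      then show ?thesis using cS[OF one, of 0] by simp
    next
      case (Suc m)
      have "(\<Sum>i\<le>n. frag_cmul ((-1) ^ i) (?f (Suc i))) =
          (\<Sum>i\<le>n. C m (frag_cmul ((-1) ^ i) (ccomp (\<Delta> m) (frag_of \<sigma>) (frag_of (face m i)))))"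
        using cS[OF one] unfolding Suc
        by (intro sum.cong) (simp_all add: C_def frag_extend_cmul compose_face)
      also have "\<dots> = C m (ccomp (\<Delta> m) (frag_of \<sigma>) (dD m))"
        unfolding dD_def ccomp_sum_right ccomp_right(5) C_def Suc
        by (subst frag_extend_sum) (simp_all add: comp_def)
      finally show ?thesis using Suc by simp
    qed
    finally show ?case by (simp split: nat.split)
  next
    case (diff a b)
    then show ?case
      by (simp add: C_simps ccomp_left frag_cmul_diff_distrib split: nat.split)
  qed (simp add: C_simps ccomp_left split: nat.split)
  have "C n z \<in> Chom (\<Delta> (Suc n)) K"
    unfolding C_def by (rule chains_frag_extend[OF assms(2)]) (simp add: c)
  moreover have "ccomp (\<Delta> n) (C n z) (dD n) = z"
    using key assms(3,4) by (auto simp: C_simps split: nat.splits)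
  ultimately show ?thesis by blast
qed

end

section \<open>Comparison of simplicial and cubical chains\<close>

lemma ccomp_hom:
  assumes "closure_space Y" "b \<in> Chom Y Z"
  shows "(\<lambda>z. ccomp Y z b) \<in> hom (free_Abelian_group (cmaps Z X)) (free_Abelian_group (cmaps Y X))"
  using ccomp_Chom[OF assms(1) _ assms(2)] unfolding chains_def by (intro homI) (simp_all add: ccomp_left)

context singular_model begin

text \<open>Degree 0 is free apart from \<open>aug = 1\<close>, so it is a single vertex. The
  augmentation is prescribed because it later makes both composites agree with the identity as far
  as degree 0 acyclicity can see.\<close>

lemma ex_cube_to_simplex:
  "\<exists>\<Phi>. (\<forall>n. \<Phi> n \<in> Chom (sq n) (\<Delta> n)) \<and> aug (\<Phi> 0) = 1 \<and>
    (\<forall>n. ccomp (sq n) (\<Phi> (Suc n)) (dQ n) - ccomp (sq n) (dD n) (\<Phi> n) \<in> degen n (\<Delta> (Suc n)))"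
proof -
  obtain v where v: "v \<in> pts (\<Delta> 0)"
    using cube_simp[of 0] unfolding cube_contractible_def by auto
  define \<Phi>0 where "\<Phi>0 = frag_of (\<lambda>_\<in>pts (sq 0). v)"
  have \<Phi>0: "\<Phi>0 \<in> Chom (sq 0) (\<Delta> 0)" "aug \<Phi>0 = 1"
    unfolding \<Phi>0_def chains_of restrict_cmaps[OF closure_sq]
    by (rule ccontinuous_const[OF closure_sq closure_\<Delta> v]) simp
  \<comment> \<open>\<open>X n\<close> will be \<open>\<Phi> (Suc n)\<close>, so index 0 already
    carries the first boundary equation: \<open>W\<close> feeds in \<open>\<Phi>0\<close> there and
    is zero afterwards. As \<open>lifting_sequence\<close> solves for \<open>W\<close> minus
    \<open>\<gamma>\<close>, a chain map equation needs \<open>\<gamma>\<close> and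
    \<open>\<delta>\<close> with a minus sign.\<close>
  define W where "W n = (if n = 0 then ccomp (sq 0) (dD 0) \<Phi>0 else 0)" for n :: nat
  obtain X where X: "\<And>n. X n \<in> Chom (sq (Suc n)) (\<Delta> (Suc n))"
    and X0: "ccomp (sq 0) (X 0) (dQ 0) - W 0 \<in> degen 0 (\<Delta> (Suc 0))"
    and XS: "\<And>n. ccomp (sq (Suc n)) (X (Suc n)) (dQ (Suc n)) - (W (Suc n) - - ccomp (sq (Suc n)) (dD (Suc n)) (X n))
        \<in> degen (Suc n) (\<Delta> (Suc (Suc n)))"
  proof (rule lifting_sequence[where B = "\<lambda>n. Chom (sq (Suc n)) (\<Delta> (Suc n))" and W = W
        and b = "\<lambda>n x. ccomp (sq n) x (dQ n)" and A = "\<lambda>n. Chom (sq n) (\<Delta> (Suc n))"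
        and N = "\<lambda>n. degen n (\<Delta> (Suc n))" and N' = "\<lambda>n. degen n (\<Delta> (Suc (Suc n)))"
        and \<gamma> = "\<lambda>n x. - ccomp (sq (Suc n)) (dD (Suc n)) x" and \<delta> = "\<lambda>n x. - ccomp (sq n) (dD (Suc n)) x"])
    show "\<exists>x\<in>Chom (sq (Suc 0)) (\<Delta> (Suc 0)). ccomp (sq 0) x (dQ 0) - W 0 \<in> degen 0 (\<Delta> (Suc 0))"
      by (rule cube_acyclic[OF cube_simp closure_\<Delta>]) (use ccomp_Chom[OF closure_sq dD_Chom \<Phi>0(1)] aug_dD_0 in \<open>auto simp: W_def\<close>)
    show "\<exists>x\<in>Chom (sq (Suc (Suc n))) (\<Delta> (Suc (Suc n))). ccomp (sq (Suc n)) x (dQ (Suc n)) - z \<in> degen (Suc n) (\<Delta> (Suc (Suc n)))"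
      if "z \<in> Chom (sq (Suc n)) (\<Delta> (Suc (Suc n)))" "ccomp (sq n) z (dQ n) \<in> degen n (\<Delta> (Suc (Suc n)))" for n z
      by (rule cube_acyclic[OF cube_simp closure_\<Delta>]) (use that in auto)
    show "W (Suc n) - - ccomp (sq (Suc n)) (dD (Suc n)) x \<in> Chom (sq (Suc n)) (\<Delta> (Suc (Suc n)))"
      if "x \<in> Chom (sq (Suc n)) (\<Delta> (Suc n))" for n x
      using ccomp_Chom[OF closure_sq dD_Chom that] by (simp add: W_def)
    show "ccomp (sq n) (W (Suc n)) (dQ n) - - ccomp (sq n) (dD (Suc n)) (W n) \<in> degen n (\<Delta> (Suc (Suc n)))" for n
      using \<Phi>0 by (auto simp: W_def ccomp_left ccomp_right dD_dD simp flip: Chom_assoc[where X = "\<Delta> 0"])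
    show "ccomp (sq n) (- ccomp (sq (Suc n)) (dD (Suc n)) x) (dQ n) = - ccomp (sq n) (dD (Suc n)) (ccomp (sq n) x (dQ n))" for n x
      by (simp add: ccomp_left Chom_assoc[OF dQ_Chom])
    show "- ccomp (sq (Suc n)) (dD (Suc (Suc n))) (- ccomp (sq (Suc n)) (dD (Suc n)) x) = 0"
      if "x \<in> Chom (sq (Suc n)) (\<Delta> (Suc n))" for n x
      by (simp add: ccomp_right ccomp_left dD_dD flip: Chom_assoc[OF that])
    show "- ccomp (sq n) (dD (Suc n)) y \<in> degen n (\<Delta> (Suc (Suc n)))" if "y \<in> degen n (\<Delta> (Suc n))" for n y
      by (intro deg_simps deg_left[OF dD_Chom that])
  qed (auto simp: ccomp_left ccomp_right)
  define \<Phi> where "\<Phi> = case_nat \<Phi>0 X"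
  have "ccomp (sq n) (\<Phi> (Suc n)) (dQ n) - ccomp (sq n) (dD n) (\<Phi> n) \<in> degen n (\<Delta> (Suc n))" for n
    using X0 XS by (cases n) (simp_all add: \<Phi>_def W_def)
  moreover have "\<Phi> n \<in> Chom (sq n) (\<Delta> n)" for n
    using X \<Phi>0 by (cases n) (simp_all add: \<Phi>_def)
  moreover have "aug (\<Phi> 0) = 1" by (simp add: \<Phi>_def \<Phi>0)
  ultimately show ?thesis by blast
qed

text \<open>An arbitrary filling is repaired by multiplying with \<open>nrm\<close> on the left.
  This does not interfere with the boundary, which acts on the right, and it fixes
  \<open>z\<close>.\<close>

lemma simp_acyclic_killed:
  assumes "z \<in> killed m (\<Delta> n)" "n = 0 \<Longrightarrow> aug z = 0" "\<And>k. n = Suc k \<Longrightarrow> ccomp (\<Delta> k) z (dD k) = 0"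
  shows "\<exists>w\<in>killed m (\<Delta> (Suc n)). ccomp (\<Delta> n) w (dD n) = z"
proof -
  have "z \<in> Chom (\<Delta> n) (sq m)" using assms by (simp add: killed_def)
  then obtain w where w: "w \<in> Chom (\<Delta> (Suc n)) (sq m)" "ccomp (\<Delta> n) w (dD n) = z"
    using simp_acyclic[OF simp_cube _ assms(2,3)] by blast
  show ?thesis
  proof
    show "ccomp (\<Delta> (Suc n)) (nrm m m) w \<in> killed m (\<Delta> (Suc n))"
      by (rule killed_right[OF closure_\<Delta> nrm_killed w(1)])
    show "ccomp (\<Delta> n) (ccomp (\<Delta> (Suc n)) (nrm m m) w) (dD n) = z"
      using assms(1) by (simp add: Chom_assoc[OF dD_Chom] w nrm_fixes)
  qed
qed

text \<open>The same repair; the degenerate error of the filling stays degenerate under left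
  multiplication.\<close>

lemma cube_acyclic_killed:
  assumes "z \<in> killed m (sq n)" "n = 0 \<Longrightarrow> aug z = 0"
    "\<And>k. n = Suc k \<Longrightarrow> ccomp (sq k) z (dQ k) \<in> degen k (sq m)"
  shows "\<exists>w\<in>killed m (sq (Suc n)). ccomp (sq n) w (dQ n) - z \<in> degen n (sq m)"
proof -
  have "z \<in> Chom (sq n) (sq m)" using assms by (simp add: killed_def)
  then obtain w where w: "w \<in> Chom (sq (Suc n)) (sq m)" "ccomp (sq n) w (dQ n) - z \<in> degen n (sq m)"
    using cube_acyclic[OF cube_cube closure_sq _ assms(2,3)] by blast
  show ?thesis
  proof
    show "ccomp (sq (Suc n)) (nrm m m) w \<in> killed m (sq (Suc n))"
      by (rule killed_right[OF closure_sq nrm_killed w(1)])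
    have "ccomp (sq n) (nrm m m) (ccomp (sq n) w (dQ n) - z) \<in> degen n (sq m)"
      by (rule deg_left[OF nrm_Chom w(2)])
    then show "ccomp (sq n) (ccomp (sq (Suc n)) (nrm m m) w) (dQ n) - z \<in> degen n (sq m)"
      using assms(1) by (simp add: Chom_assoc[OF dQ_Chom] ccomp_right nrm_fixes)
  qed
qed

text \<open>Fillings over simplices are exact, so here \<open>N\<close> and \<open>N'\<close> are
  zero and \<open>\<Psi>\<close> commutes strictly with the boundaries.\<close>

lemma ex_simplex_to_cube:
  "\<exists>\<Psi>. (\<forall>n. \<Psi> n \<in> killed n (\<Delta> n)) \<and> aug (\<Psi> 0) = 1 \<and>
    (\<forall>n. ccomp (\<Delta> n) (\<Psi> (Suc n)) (dD n) = ccomp (\<Delta> n) (dQ n) (\<Psi> n))"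
proof -
  \<comment> \<open>The constant map to the only point of the cube of dimension 0, the function
    \<open>undefined\<close> everywhere. There are no coordinates, so being killed is
    vacuous.\<close>
  define \<Psi>0 where "\<Psi>0 = frag_of (\<lambda>_\<in>pts (\<Delta> 0). \<lambda>_::nat. undefined::'j)"
  have "(\<lambda>_. undefined) \<in> pts (sq 0)" by (simp add: pts_cpower)
  then have \<Psi>0: "\<Psi>0 \<in> killed 0 (\<Delta> 0)" "aug \<Psi>0 = 1"
    unfolding \<Psi>0_def killed_def using ccontinuous_const[OF closure_\<Delta> closure_sq, of _ 0 0]
    by (auto simp: restrict_cmaps)
  define W where "W n = (if n = 0 then ccomp (\<Delta> 0) (dQ 0) \<Psi>0 else 0)" for n :: nat
  obtain X where X: "\<And>n. X n \<in> killed (Suc n) (\<Delta> (Suc n))"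
    and X0: "ccomp (\<Delta> 0) (X 0) (dD 0) - W 0 \<in> {0}"
    and XS: "\<And>n. ccomp (\<Delta> (Suc n)) (X (Suc n)) (dD (Suc n)) - (W (Suc n) - - ccomp (\<Delta> (Suc n)) (dQ (Suc n)) (X n)) \<in> {0}"
  proof (rule lifting_sequence[where B = "\<lambda>n. killed (Suc n) (\<Delta> (Suc n))" and W = W
        and b = "\<lambda>n x. ccomp (\<Delta> n) x (dD n)" and A = "\<lambda>n. killed (Suc n) (\<Delta> n)"
        and N = "\<lambda>n. {0}" and N' = "\<lambda>n. {0}"
        and \<gamma> = "\<lambda>n x. - ccomp (\<Delta> (Suc n)) (dQ (Suc n)) x" and \<delta> = "\<lambda>n x. - ccomp (\<Delta> n) (dQ (Suc n)) x"])
    have Ck: "x \<in> Chom Y (sq n)" if "x \<in> killed n Y" for x n and Y :: "'s cspace"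
      using that by (simp add: killed_def)
    show "\<exists>x\<in>killed (Suc 0) (\<Delta> (Suc 0)). ccomp (\<Delta> 0) x (dD 0) - W 0 \<in> {0}"
      using simp_acyclic_killed[of "W 0" "Suc 0" 0] killed_dQ[OF closure_\<Delta> \<Psi>0(1)] aug_dQ by (auto simp: W_def)
    show "\<exists>x\<in>killed (Suc (Suc n)) (\<Delta> (Suc (Suc n))). ccomp (\<Delta> (Suc n)) x (dD (Suc n)) - z \<in> {0}"
      if "z \<in> killed (Suc (Suc n)) (\<Delta> (Suc n))" "ccomp (\<Delta> n) z (dD n) \<in> {0}" for n z
      using simp_acyclic_killed[OF that(1)] that(2) by auto
    show "W (Suc n) - - ccomp (\<Delta> (Suc n)) (dQ (Suc n)) x \<in> killed (Suc (Suc n)) (\<Delta> (Suc n))"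
      if "x \<in> killed (Suc n) (\<Delta> (Suc n))" for n x
      using killed_dQ[OF closure_\<Delta> that] by (simp add: W_def)
    show "ccomp (\<Delta> n) (W (Suc n)) (dD n) - - ccomp (\<Delta> n) (dQ (Suc n)) (W n) \<in> {0}" for n
      using Ck[OF \<Psi>0(1)] by (simp add: W_def ccomp_left ccomp_right dQ_dQ flip: Chom_assoc[where X = "sq 0"])
    show "ccomp (\<Delta> n) (- ccomp (\<Delta> (Suc n)) (dQ (Suc n)) x) (dD n) = - ccomp (\<Delta> n) (dQ (Suc n)) (ccomp (\<Delta> n) x (dD n))" for n x
      by (simp add: ccomp_left Chom_assoc[OF dD_Chom])
    show "- ccomp (\<Delta> (Suc n)) (dQ (Suc (Suc n))) (- ccomp (\<Delta> (Suc n)) (dQ (Suc n)) x) = 0"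
      if "x \<in> killed (Suc n) (\<Delta> (Suc n))" for n x
      by (simp add: ccomp_right ccomp_left dQ_dQ flip: Chom_assoc[OF Ck[OF that]])
  qed (auto simp: ccomp_left ccomp_right)
  define \<Psi> where "\<Psi> = case_nat \<Psi>0 X"
  have "ccomp (\<Delta> n) (\<Psi> (Suc n)) (dD n) = ccomp (\<Delta> n) (dQ n) (\<Psi> n)" for n
    using X0 XS by (cases n) (simp_all add: \<Psi>_def W_def)
  moreover have "\<Psi> n \<in> killed n (\<Delta> n)" for n
    using X \<Psi>0 by (cases n) (simp_all add: \<Psi>_def)
  moreover have "aug (\<Psi> 0) = 1" by (simp add: \<Psi>_def \<Psi>0)
  ultimately show ?thesis by blast
qed

section \<open>Identification with the defined complexes and the equivalence\<close>

lemma simplicial_chains_sel: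
  "ch (simplicial_chains \<Delta> d X) n = free_Abelian_group (cmaps (\<Delta> n) X)"
  "bd (simplicial_chains \<Delta> d X) n z = ccomp (\<Delta> n) z (dD n)"
proof -
  have "restrict (\<sigma> \<circ> d i) (pts (\<Delta> n)) = compose (pts (\<Delta> n)) \<sigma> (face n i)" for \<sigma> :: "'s \<Rightarrow> 'a" and i
    unfolding compose_face by (simp add: compose_def comp_def)
  then show "bd (simplicial_chains \<Delta> d X) n z = ccomp (\<Delta> n) z (dD n)"
    by (simp add: simplicial_chains_def ccomp_def dD_def frag_extend_sum frag_extend_cmul comp_def
        del: sum.atMost_Suc)
qed (simp add: simplicial_chains_def)

lemma cube_chains_sel:
  "ch (cube_chains J X) n = free_Abelian_group (cmaps (sq n) X)"
  "bd (cube_chains J X) n z = ccomp (sq n) z (dQ n)"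
proof -
  have "cube_face J n i a \<sigma> = compose (pts (sq n)) \<sigma> (A n i a)" for \<sigma> :: "(nat \<Rightarrow> 'j) \<Rightarrow> 'a" and i a
    unfolding A_def compose_restrict_right by (simp add: cube_face_def compose_def comp_def)
  then show "bd (cube_chains J X) n z = ccomp (sq n) z (dQ n)"
    by (simp add: cube_chains_def ccomp_def dQ_def frag_extend_sum frag_extend_cmul frag_extend_diff comp_def
        del: sum.cl_ivl_Suc)
qed (simp add: cube_chains_def)

lemma degenerate_chains_eq: "degenerate_chains J X n = degen n X"
  unfolding degenerate_chains_def cube_chains_sel degen_def by (rule generate_free_Abelian_group) auto

lemma degen_coset_eqI:
  assumes "x - y \<in> degen n X"
  shows "degen n X #>\<^bsub>free_Abelian_group S\<^esub> x = degen n X #>\<^bsub>free_Abelian_group S\<^esub> y"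
proof -
  have "\<exists>h'\<in>degen n X. h + x' = h' + y'" if "h \<in> degen n X" "x' - y' \<in> degen n X" for h x' y'
    using that by (intro bexI[of _ "h + (x' - y')"]) auto
  from this[OF _ assms] this[of _ y x] show ?thesis
    using deg_simps(4)[OF assms] by (fastforce simp: r_coset_def)
qed

theorem Hom_simplicial_cubical_equivalent:
  fixes X :: "'a cspace" and G :: "('g, 'm) monoid_scheme"
  assumes "comm_group G"
  shows "cochain_homotopy_equivalent (Hom_complex (simplicial_chains \<Delta> d X) G) (Hom_complex (cubical_chains J X) G)"
proof -
  obtain \<Phi> where \<Phi>: "\<And>n. \<Phi> n \<in> Chom (sq n) (\<Delta> n)" "aug (\<Phi> 0) = 1"
    and \<Phi>d: "\<And>n. ccomp (sq n) (\<Phi> (Suc n)) (dQ n) - ccomp (sq n) (dD n) (\<Phi> n) \<in> degen n (\<Delta> (Suc n))"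
    using ex_cube_to_simplex by blast
  obtain \<Psi> where \<Psi>k: "\<And>n. \<Psi> n \<in> killed n (\<Delta> n)" "aug (\<Psi> 0) = 1"
    and \<Psi>d: "\<And>n. ccomp (\<Delta> n) (\<Psi> (Suc n)) (dD n) = ccomp (\<Delta> n) (dQ n) (\<Psi> n)"
    using ex_simplex_to_cube by blast
  have \<Psi>: "\<Psi> n \<in> Chom (\<Delta> n) (sq n)" for n using \<Psi>k(1)[of n] by (simp add: killed_def)

  define W where "W n = ccomp (\<Delta> n) (\<Phi> n) (\<Psi> n) - cid (\<Delta> n)" for n
  obtain S where S: "\<And>n. S n \<in> Chom (\<Delta> (Suc n)) (\<Delta> n)"
    and S0: "ccomp (\<Delta> 0) (S 0) (dD 0) - W 0 \<in> {0}"
    and SS: "\<And>n. ccomp (\<Delta> (Suc n)) (S (Suc n)) (dD (Suc n)) - (W (Suc n) - ccomp (\<Delta> (Suc n)) (dD n) (S n)) \<in> {0}"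
  proof (rule lifting_sequence[where B = "\<lambda>n. Chom (\<Delta> (Suc n)) (\<Delta> n)" and W = W
        and b = "\<lambda>n x. ccomp (\<Delta> n) x (dD n)" and A = "\<lambda>n. Chom (\<Delta> n) (\<Delta> n)"
        and N = "\<lambda>n. {0}" and N' = "\<lambda>n. {0}"
        and \<gamma> = "\<lambda>n x. ccomp (\<Delta> (Suc n)) (dD n) x" and \<delta> = "\<lambda>n x. ccomp (\<Delta> n) (dD n) x"])
    have W: "W n \<in> Chom (\<Delta> n) (\<Delta> n)" for n
      unfolding W_def by (intro chains_diff ccomp_Chom[OF _ \<Phi>(1) \<Psi>]) simp_all
    show "\<exists>x\<in>Chom (\<Delta> (Suc 0)) (\<Delta> 0). ccomp (\<Delta> 0) x (dD 0) - W 0 \<in> {0}"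
      using simp_acyclic[OF simp_simp W[of 0]] by (simp add: W_def \<Phi>(2) \<Psi>k(2) cid_def)
    show "\<exists>x\<in>Chom (\<Delta> (Suc (Suc n))) (\<Delta> (Suc n)). ccomp (\<Delta> (Suc n)) x (dD (Suc n)) - z \<in> {0}"
      if "z \<in> Chom (\<Delta> (Suc n)) (\<Delta> (Suc n))" "ccomp (\<Delta> n) z (dD n) \<in> {0}" for n z
      using simp_acyclic[OF simp_simp that(1)] that(2) by simp
    show "W (Suc n) - ccomp (\<Delta> (Suc n)) (dD n) x \<in> Chom (\<Delta> (Suc n)) (\<Delta> (Suc n))"
      if "x \<in> Chom (\<Delta> (Suc n)) (\<Delta> n)" for n x
      by (intro chains_diff W ccomp_Chom[OF closure_\<Delta> dD_Chom that])
    have "ccomp (\<Delta> n) (ccomp (\<Delta> (Suc n)) (\<Phi> (Suc n)) (\<Psi> (Suc n))) (dD n) =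
      ccomp (\<Delta> n) (dD n) (ccomp (\<Delta> n) (\<Phi> n) (\<Psi> n))" for n
    proof -
      \<comment> \<open>\<open>\<Phi>\<close> commutes with the boundaries only up to degenerate
        chains, but \<open>\<Psi>\<close> kills these; hence the composite commutes exactly.\<close>
      have "ccomp (\<Delta> n) (ccomp (sq n) (\<Phi> (Suc n)) (dQ n) - ccomp (sq n) (dD n) (\<Phi> n)) (\<Psi> n) = 0"
        by (rule deg_kill[OF \<Phi>d \<Psi>k(1)])
      then show ?thesis
        by (simp add: Chom_assoc[OF dD_Chom] \<Psi>d Chom_assoc[OF \<Psi>] ccomp_left)
    qed
    then show "ccomp (\<Delta> n) (W (Suc n)) (dD n) - ccomp (\<Delta> n) (dD n) (W n) \<in> {0}" for n
      by (simp add: W_def ccomp_left ccomp_right ccomp_cid_left[OF dD_Chom] ccomp_cid_right[OF dD_Chom])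
    show "ccomp (\<Delta> n) (ccomp (\<Delta> (Suc n)) (dD n) x) (dD n) = ccomp (\<Delta> n) (dD n) (ccomp (\<Delta> n) x (dD n))" for n x
      by (rule Chom_assoc[OF dD_Chom])
    show "ccomp (\<Delta> (Suc n)) (dD (Suc n)) (ccomp (\<Delta> (Suc n)) (dD n) x) = 0"
      if "x \<in> Chom (\<Delta> (Suc n)) (\<Delta> n)" for n x
      by (simp add: ccomp_left dD_dD flip: Chom_assoc[OF that])
  qed (auto simp: ccomp_left ccomp_right)

  \<comment> \<open>Comparison with \<open>nrm\<close> instead of \<open>cid\<close>: the homotopy
    \<open>T\<close> must consist of killed chains to descend to the quotient, so the chain to be
    filled must be killed as well.\<close>
  define V where "V n = ccomp (sq n) (\<Psi> n) (\<Phi> n) - nrm n n" for n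
  obtain T where T: "\<And>n. T n \<in> killed n (sq (Suc n))"
    and T0: "ccomp (sq 0) (T 0) (dQ 0) - V 0 \<in> degen 0 (sq 0)"
    and TS: "\<And>n. ccomp (sq (Suc n)) (T (Suc n)) (dQ (Suc n)) - (V (Suc n) - ccomp (sq (Suc n)) (dQ n) (T n))
      \<in> degen (Suc n) (sq (Suc n))"
  proof (rule lifting_sequence[where B = "\<lambda>n. killed n (sq (Suc n))" and W = V
        and b = "\<lambda>n x. ccomp (sq n) x (dQ n)" and A = "\<lambda>n. killed n (sq n)"
        and N = "\<lambda>n. degen n (sq n)" and N' = "\<lambda>n. degen n (sq (Suc n))"
        and \<gamma> = "\<lambda>n x. ccomp (sq (Suc n)) (dQ n) x" and \<delta> = "\<lambda>n x. ccomp (sq n) (dQ n) x"])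
    have Ck: "x \<in> Chom Y (sq n)" if "x \<in> killed n Y" for x n and Y :: "(nat \<Rightarrow> 'j) cspace"
      using that by (simp add: killed_def)
    have V: "V n \<in> killed n (sq n)" for n
      unfolding V_def by (intro killed_simps(2) killed_right[OF _ \<Psi>k(1) \<Phi>(1)]) simp_all
    show "\<exists>x\<in>killed 0 (sq (Suc 0)). ccomp (sq 0) x (dQ 0) - V 0 \<in> degen 0 (sq 0)"
      by (rule cube_acyclic_killed[OF V]) (simp_all add: V_def \<Phi>(2) \<Psi>k(2) cid_def)
    show "\<exists>x\<in>killed (Suc n) (sq (Suc (Suc n))). ccomp (sq (Suc n)) x (dQ (Suc n)) - z \<in> degen (Suc n) (sq (Suc n))"
      if "z \<in> killed (Suc n) (sq (Suc n))" "ccomp (sq n) z (dQ n) \<in> degen n (sq (Suc n))" for n z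
      by (rule cube_acyclic_killed[OF that(1)]) (use that(2) in simp_all)
    show "V (Suc n) - ccomp (sq (Suc n)) (dQ n) x \<in> killed (Suc n) (sq (Suc n))"
      if "x \<in> killed n (sq (Suc n))" for n x
      by (intro killed_simps(2) V killed_dQ[OF closure_sq that])
    show "ccomp (sq n) (V (Suc n)) (dQ n) - ccomp (sq n) (dQ n) (V n) \<in> degen n (sq (Suc n))" for n
    proof -
      have 1: "ccomp (sq n) (\<Psi> (Suc n)) (ccomp (sq n) (\<Phi> (Suc n)) (dQ n) - ccomp (sq n) (dD n) (\<Phi> n)) \<in> degen n (sq (Suc n))"
        by (rule deg_left[OF \<Psi> \<Phi>d])
      \<comment> \<open>\<open>nrm\<close> commutes with \<open>dQ\<close> only up to degenerate
        chains. As \<open>dQ\<close> times \<open>nrm\<close> is killed, it is fixed by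
        \<open>nrm\<close> on the left, so the commutator equals \<open>nrm\<close> times
        \<open>dQ\<close> times \<open>nrm - cid\<close>, whose last factor is degenerate.\<close>
      have 2: "ccomp (sq n) (nrm (Suc n) (Suc n)) (ccomp (sq n) (dQ n) (nrm n n - cid (sq n))) \<in> degen n (sq (Suc n))"
        by (intro deg_left[OF nrm_Chom] deg_left[OF dQ_Chom] nrm_cid)
      have 3: "ccomp (sq n) (nrm (Suc n) (Suc n)) (ccomp (sq n) (dQ n) (nrm n n)) = ccomp (sq n) (dQ n) (nrm n n)"
        by (intro nrm_fixes killed_dQ) simp_all
      have "ccomp (sq n) (\<Psi> (Suc n)) (ccomp (sq n) (dD n) (\<Phi> n)) = ccomp (sq n) (dQ n) (ccomp (sq n) (\<Psi> n) (\<Phi> n))"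
        by (simp add: \<Psi>d flip: Chom_assoc[OF \<Phi>(1)])
      then have "ccomp (sq n) (V (Suc n)) (dQ n) - ccomp (sq n) (dQ n) (V n) =
          ccomp (sq n) (\<Psi> (Suc n)) (ccomp (sq n) (\<Phi> (Suc n)) (dQ n) - ccomp (sq n) (dD n) (\<Phi> n)) +
          ccomp (sq n) (nrm (Suc n) (Suc n)) (ccomp (sq n) (dQ n) (nrm n n - cid (sq n)))"
        by (simp add: V_def ccomp_left ccomp_right Chom_assoc[OF dQ_Chom] ccomp_cid_right[OF dQ_Chom] 3 del: nrm.simps)
      then show ?thesis using 1 2 by (simp only:) (rule deg_simps)
    qed
    show "ccomp (sq n) (ccomp (sq (Suc n)) (dQ n) x) (dQ n) = ccomp (sq n) (dQ n) (ccomp (sq n) x (dQ n))" for n x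
      by (rule Chom_assoc[OF dQ_Chom])
    show "ccomp (sq (Suc n)) (dQ (Suc n)) (ccomp (sq (Suc n)) (dQ n) x) = 0"
      if "x \<in> killed n (sq (Suc n))" for n x
      by (simp add: ccomp_left dQ_dQ flip: Chom_assoc[OF Ck[OF that]])
    show "ccomp (sq n) (dQ n) y \<in> degen n (sq (Suc n))" if "y \<in> degen n (sq n)" for n y
      by (rule deg_left[OF dQ_Chom that])
  qed (auto simp: ccomp_left ccomp_right)
  have TC: "T n \<in> Chom (sq (Suc n)) (sq n)" for n using T[of n] by (simp add: killed_def)

  note sel = simplicial_chains_sel cube_chains_sel degenerate_chains_eq
  show ?thesis
    unfolding cubical_chains_def
  proof (rule cochain_homotopy_equivalent_Hom_quotient[where \<phi> = "\<lambda>n z. ccomp (sq n) z (\<Phi> n)"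
        and \<psi> = "\<lambda>n z. ccomp (\<Delta> n) z (\<Psi> n)" and t = "\<lambda>n z. ccomp (sq (Suc n)) z (T n)"],
      unfold sel mult_free_Abelian_group one_free_Abelian_group, unfold chains_def[symmetric])
    show "comm_group G" by fact
    show "chain_complex (simplicial_chains \<Delta> d X)"
      unfolding chain_complex_def sel one_free_Abelian_group
      by (auto simp: abelian_free_Abelian_group ccomp_hom Chom_assoc[OF dD_Chom] dD_dD ccomp_right)
    show "comm_group (free_Abelian_group (cmaps (sq n) X))" for n
      by (rule abelian_free_Abelian_group)
    show "(\<lambda>z. ccomp (sq n) z (dQ n)) \<in> hom (free_Abelian_group (cmaps (sq (Suc n)) X)) (free_Abelian_group (cmaps (sq n) X))" for n
      by (rule ccomp_hom[OF closure_sq dQ_Chom])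
    show "ccomp (sq n) (ccomp (sq (Suc n)) x (dQ (Suc n))) (dQ n) \<in> degen n X" for n x
      by (auto simp: Chom_assoc[OF dQ_Chom] dQ_dQ ccomp_right)
    show "subgroup (degen n X) (free_Abelian_group (cmaps (sq n) X))" for n
      using deg_Chom[of _ n X] by unfold_locales (auto simp: chains_iff)
    show "d \<in> degen (Suc n) X \<Longrightarrow> ccomp (sq n) d (dQ n) \<in> degen n X" for n d
      by (rule deg_bd)
    show "(\<lambda>z. ccomp (sq n) z (\<Phi> n)) \<in> hom (free_Abelian_group (cmaps (\<Delta> n) X)) (free_Abelian_group (cmaps (sq n) X))" for n
      by (rule ccomp_hom[OF closure_sq \<Phi>(1)])
    show "degen n X #>\<^bsub>free_Abelian_group (cmaps (sq n) X)\<^esub> ccomp (sq n) (ccomp (sq (Suc n)) x (\<Phi> (Suc n))) (dQ n) =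
        degen n X #>\<^bsub>free_Abelian_group (cmaps (sq n) X)\<^esub> ccomp (sq n) (ccomp (\<Delta> n) x (dD n)) (\<Phi> n)"
      if "x \<in> Chom (\<Delta> (Suc n)) X" for n x
    proof (rule degen_coset_eqI)
      show "ccomp (sq n) (ccomp (sq (Suc n)) x (\<Phi> (Suc n))) (dQ n) - ccomp (sq n) (ccomp (\<Delta> n) x (dD n)) (\<Phi> n) \<in> degen n X"
        using deg_left[OF that \<Phi>d] by (simp add: Chom_assoc[OF dQ_Chom] Chom_assoc[OF \<Phi>(1)] ccomp_right)
    qed
    show "(\<lambda>z. ccomp (\<Delta> n) z (\<Psi> n)) \<in> hom (free_Abelian_group (cmaps (sq n) X)) (free_Abelian_group (cmaps (\<Delta> n) X))" for n
      by (rule ccomp_hom[OF closure_\<Delta> \<Psi>])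
    show "d \<in> degen n X \<Longrightarrow> ccomp (\<Delta> n) d (\<Psi> n) = 0" for n d
      by (rule deg_kill[OF _ \<Psi>k(1)])
    show "ccomp (\<Delta> n) (ccomp (\<Delta> (Suc n)) x (\<Psi> (Suc n))) (dD n) = ccomp (\<Delta> n) (ccomp (sq n) x (dQ n)) (\<Psi> n)" for n x
      by (simp add: Chom_assoc[OF dD_Chom] Chom_assoc[OF \<Psi>] \<Psi>d)
    show "(\<lambda>z. ccomp (sq (Suc n)) z (T n)) \<in> hom (free_Abelian_group (cmaps (sq n) X)) (free_Abelian_group (cmaps (sq (Suc n)) X))" for n
      by (rule ccomp_hom[OF closure_sq TC])
    show "ccomp (sq (Suc n)) d (T n) \<in> degen (Suc n) X" if "d \<in> degen n X" for n d
      using deg_kill[OF that T] by auto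
    show "degen n X #>\<^bsub>free_Abelian_group (cmaps (sq n) X)\<^esub> ccomp (sq n) (ccomp (\<Delta> n) x (\<Psi> n)) (\<Phi> n) =
         degen n X #>\<^bsub>free_Abelian_group (cmaps (sq n) X)\<^esub>
         ((case n of 0 \<Rightarrow> 0 | Suc m \<Rightarrow> ccomp (sq (Suc m)) (ccomp (sq m) x (dQ m)) (T m)) +
           ccomp (sq n) (ccomp (sq (Suc n)) x (T n)) (dQ n) + x)"
      if x: "x \<in> Chom (sq n) X" for n x
    proof (rule degen_coset_eqI)
      \<comment> \<open>Replaces the endpoint \<open>nrm\<close> of the homotopy by the identity, at
        the cost of a degenerate term.\<close>
      have 1: "ccomp (sq n) x (nrm n n - cid (sq n)) \<in> degen n X"
        by (rule deg_left[OF x nrm_cid])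
      show "ccomp (sq n) (ccomp (\<Delta> n) x (\<Psi> n)) (\<Phi> n) - ((case n of 0 \<Rightarrow> 0 | Suc m \<Rightarrow> ccomp (sq (Suc m)) (ccomp (sq m) x (dQ m)) (T m)) +
           ccomp (sq n) (ccomp (sq (Suc n)) x (T n)) (dQ n) + x) \<in> degen n X" (is "?e \<in> _")
      proof (cases n)
        case 0
        have 2: "ccomp (sq n) x (ccomp (sq 0) (T 0) (dQ 0) - V 0) \<in> degen n X"
          using deg_left[OF x[unfolded 0] T0] 0 by simp
        have "?e = ccomp (sq n) x (nrm n n - cid (sq n)) - ccomp (sq n) x (ccomp (sq 0) (T 0) (dQ 0) - V 0)"
          using x 0 by (simp add: Chom_assoc[OF dQ_Chom] Chom_assoc[OF \<Phi>(1)] ccomp_right ccomp_cid_right V_def)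
        then show ?thesis using 1 2 by (simp only:) (rule deg_simps)
      next
        case (Suc m)
        let ?E = "ccomp (sq (Suc m)) (T (Suc m)) (dQ (Suc m)) - (V (Suc m) - ccomp (sq (Suc m)) (dQ m) (T m))"
        have 2: "ccomp (sq n) x ?E \<in> degen n X"
          using deg_left[OF x[unfolded Suc] TS] Suc by simp
        have "?e = ccomp (sq n) x (nrm n n - cid (sq n)) - ccomp (sq n) x ?E"
          using x Suc by (simp add: Chom_assoc[OF dQ_Chom] Chom_assoc[OF TC] Chom_assoc[OF \<Phi>(1)] ccomp_right ccomp_cid_right V_def
              del: nrm.simps)
        then show ?thesis using 1 2 by (simp only:) (rule deg_simps)
      qed
    qed
    show "chain_homotopic_id (simplicial_chains \<Delta> d X) (\<lambda>n x. ccomp (\<Delta> n) (ccomp (sq n) x (\<Phi> n)) (\<Psi> n))"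
      unfolding chain_homotopic_id_def sel mult_free_Abelian_group one_free_Abelian_group chains_def[symmetric]
    proof (intro exI[of _ "\<lambda>n z. ccomp (\<Delta> (Suc n)) z (S n)"] conjI allI ballI)
      show "(\<lambda>z. ccomp (\<Delta> (Suc n)) z (S n)) \<in> hom (free_Abelian_group (cmaps (\<Delta> n) X)) (free_Abelian_group (cmaps (\<Delta> (Suc n)) X))" for n
        by (rule ccomp_hom[OF closure_\<Delta> S])
      fix n x assume x: "x \<in> Chom (\<Delta> n) X"
      show "ccomp (\<Delta> n) (ccomp (sq n) x (\<Phi> n)) (\<Psi> n) =
        (case n of 0 \<Rightarrow> 0 | Suc m \<Rightarrow> ccomp (\<Delta> (Suc m)) (ccomp (\<Delta> m) x (dD m)) (S m)) +
          ccomp (\<Delta> n) (ccomp (\<Delta> (Suc n)) x (S n)) (dD n) + x"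
      proof (cases n)
        case 0
        then show ?thesis
          using S0 x by (simp add: Chom_assoc[OF dD_Chom] Chom_assoc[OF \<Psi>] ccomp_right ccomp_cid_right W_def)
      next
        case (Suc m)
        then show ?thesis
          using SS[of m] x by (simp add: Chom_assoc[OF dD_Chom] Chom_assoc[OF S] Chom_assoc[OF \<Psi>] ccomp_right ccomp_cid_right W_def)
      qed
    qed
  qed
qed

end

section \<open>The discrete intervals\<close>

text \<open>Closures generated by a reflexive relation, total for \<open>interval_J1\<close> and
  \<open>(\<le>)\<close> for \<open>interval_Jplus\<close>. Continuity becomes preservation of the
  relation, so both discrete intervals are treated together.\<close>

definition relational :: "('a \<Rightarrow> 'a \<Rightarrow> bool) \<Rightarrow> 'a cspace \<Rightarrow> bool" where
  "relational R K \<longleftrightarrow> (\<forall>x\<in>pts K. R x x) \<and> (\<forall>A. A \<subseteq> pts K \<longrightarrow> clo K A = {y \<in> pts K. \<exists>x\<in>A. R x y})"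

lemma closure_space_relational: "relational R K \<Longrightarrow> closure_space K"
  unfolding closure_space_def relational_def by (elim conjE) (simp add: subset_iff, blast)

lemma relational_clo: "relational R K \<Longrightarrow> A \<subseteq> pts K \<Longrightarrow> y \<in> clo K A \<longleftrightarrow> y \<in> pts K \<and> (\<exists>x\<in>A. R x y)"
  by (simp add: relational_def)

lemma ccontinuous_relational:
  assumes "relational R K" "relational R' L"
  shows "ccontinuous K L f \<longleftrightarrow> f ` pts K \<subseteq> pts L \<and> (\<forall>x\<in>pts K. \<forall>y\<in>pts K. R x y \<longrightarrow> R' (f x) (f y))"
proof
  assume c: "ccontinuous K L f"
  then have f: "f ` pts K \<subseteq> pts L" by (simp add: ccontinuous_def)
  have "R' (f x) (f y)" if "x \<in> pts K" "y \<in> pts K" "R x y" for x y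
  proof -
    have "y \<in> clo K {x}" using that by (simp add: relational_clo[OF assms(1)])
    moreover have "f ` clo K {x} \<subseteq> clo L (f ` {x})"
      using c that(1) unfolding ccontinuous_def by blast
    ultimately have "f y \<in> clo L {f x}" by auto
    moreover have "f x \<in> pts L" using f that(1) by auto
    ultimately show ?thesis by (simp add: relational_clo[OF assms(2)])
  qed
  then show "f ` pts K \<subseteq> pts L \<and> (\<forall>x\<in>pts K. \<forall>y\<in>pts K. R x y \<longrightarrow> R' (f x) (f y))"
    using f by blast
next
  assume f: "f ` pts K \<subseteq> pts L \<and> (\<forall>x\<in>pts K. \<forall>y\<in>pts K. R x y \<longrightarrow> R' (f x) (f y))"
  have "f ` clo K A \<subseteq> clo L (f ` A)" if A: "A \<subseteq> pts K" for A
  proof -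
    have "clo K A = {y \<in> pts K. \<exists>x\<in>A. R x y}"
      using assms(1) A by (simp add: relational_def)
    moreover have "clo L (f ` A) = {y \<in> pts L. \<exists>x\<in>f ` A. R' x y}"
    proof -
      have "f ` A \<subseteq> pts L" using A f by blast
      then show ?thesis using assms(2) unfolding relational_def by blast
    qed
    moreover have "f y \<in> {y \<in> pts L. \<exists>x\<in>f ` A. R' x y}" if "y \<in> pts K" "x \<in> A" "R x y" for x y
    proof -
      have "x \<in> pts K" using A that by auto
      then show ?thesis using f that by auto
    qed
    ultimately show ?thesis
      by (simp only: image_subset_iff) blast
  qed
  then show "ccontinuous K L f" using f by (simp add: ccontinuous_def)
qed

lemma relational_cpower:
  assumes "relational R J"
  shows "relational (\<lambda>x y. \<forall>k\<in>{1..n}. R (x k) (y k)) (cpower J n)"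
proof -
  \<comment> \<open>Each point has a smallest neighbourhood, the points related to it; the box of
    these smallest neighbourhoods decides membership in the closure.\<close>
  have nb: "cnbhd J x U \<longleftrightarrow> U \<subseteq> pts J \<and> x \<in> pts J \<and> (\<forall>z\<in>pts J. R z x \<longrightarrow> z \<in> U)" for x U
    using assms unfolding cnbhd_def cinterior_def relational_def by auto
  have "clo (cpower J n) A = {y \<in> pts (cpower J n). \<exists>x\<in>A. \<forall>k\<in>{1..n}. R (x k) (y k)}"
    if A: "A \<subseteq> pts (cpower J n)" for A
  proof (intro equalityI subsetI)
    fix y assume y: "y \<in> clo (cpower J n) A"
    then have yp: "y \<in> pts (cpower J n)" unfolding cpower_def clo_cprod by blast
    have "(\<Pi>\<^sub>E k\<in>{1..n}. {z \<in> pts J. R z (y k)}) \<inter> A \<noteq> {}"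
      using y unfolding cpower_def by (rule clo_cprodD) (use yp nb in \<open>auto simp: pts_cpower\<close>)
    then show "y \<in> {y \<in> pts (cpower J n). \<exists>x\<in>A. \<forall>k\<in>{1..n}. R (x k) (y k)}"
      using yp by (fastforce simp: PiE_iff)
  next
    fix y assume "y \<in> {y \<in> pts (cpower J n). \<exists>x\<in>A. \<forall>k\<in>{1..n}. R (x k) (y k)}"
    then obtain x where y: "y \<in> pts (cpower J n)" and x: "x \<in> A" "\<And>k. k \<in> {1..n} \<Longrightarrow> R (x k) (y k)"
      by auto
    have xp: "x \<in> (\<Pi>\<^sub>E k\<in>{1..n}. pts J)" using A x(1) by (auto simp: pts_cpower)
    have "x \<in> (\<Pi>\<^sub>E k\<in>{1..n}. U k) \<inter> A" if "\<forall>k\<in>{1..n}. cnbhd J (y k) (U k)" for U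
      using that xp x nb by (auto simp: PiE_iff)
    then show "y \<in> clo (cpower J n) A"
      using y unfolding cpower_def clo_cprod by blast
  qed
  then show ?thesis
    using assms unfolding relational_def pts_cpower by (intro conjI ballI allI impI) (simp_all add: PiE_iff)
qed

text \<open>Everything contracts to an apex related to all points: vertex 0 of a simplex, the zero
  corner of a cube. Under \<open>(\<le>)\<close> the contraction can only run away from the
  apex.\<close>

lemma singular_model_nat:
  fixes J :: "nat cspace" and R :: "nat \<Rightarrow> nat \<Rightarrow> bool"
  assumes R: "R = (\<lambda>_ _. True) \<or> R = (\<le>)"
    and J: "relational R J" "pts J = {0, 1}"
    and \<Delta>: "\<And>n. relational R (\<Delta> n)" "\<And>n. pts (\<Delta> n) = {0..n}"
  shows "singular_model J \<Delta> vertex_face"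
proof -
  have R_simps: "R 0 x" "R (Suc x) (Suc y) \<longleftrightarrow> R x y" for x y using R by auto
  have simp_contr: "simp_contractible \<Delta> vertex_face K"
    if K: "relational R' K" "v \<in> pts K" "\<And>y. y \<in> pts K \<Longrightarrow> R' v y"
      and RK: "R = (\<le>) \<or> (\<forall>x\<in>pts K. \<forall>y\<in>pts K. R' x y)"
    for R' v and K :: "'k cspace"
  proof -
    \<comment> \<open>Vertex 0 goes to the apex. A relation from an old vertex back to vertex 0
      arises only for the total \<open>R\<close>; the second alternative of \<open>RK\<close>
      handles it.\<close>
    define c where "c n \<sigma> = (\<lambda>x\<in>{0..Suc n}. case x of 0 \<Rightarrow> v | Suc y \<Rightarrow> \<sigma> y)" for n and \<sigma> :: "nat \<Rightarrow> 'k"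
    have "c n \<sigma> \<in> cmaps (\<Delta> (Suc n)) K" if \<sigma>: "\<sigma> \<in> cmaps (\<Delta> n) K" for n \<sigma>
    proof -
      have s: "\<And>x. x \<le> n \<Longrightarrow> \<sigma> x \<in> pts K" "\<And>x y. x \<le> n \<Longrightarrow> y \<le> n \<Longrightarrow> R x y \<Longrightarrow> R' (\<sigma> x) (\<sigma> y)"
        using \<sigma> ccontinuous_relational[OF \<Delta>(1) K(1)] by (auto simp: cmaps_def \<Delta>(2))
      have "R' (c n \<sigma> x) (c n \<sigma> y)" if "x \<le> Suc n" "y \<le> Suc n" "R x y" for x y
        using that s K R_simps RK by (auto simp: c_def split: nat.split)
      moreover have "c n \<sigma> x \<in> pts K" if "x \<le> Suc n" for x
        using that s K by (auto simp: c_def split: nat.split)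
      moreover have "c n \<sigma> \<in> extensional {0..Suc n}" by (simp add: c_def)
      ultimately show ?thesis
        using ccontinuous_relational[OF \<Delta>(1) K(1)] by (auto simp: cmaps_def \<Delta>(2))
    qed
    moreover have "compose (pts (\<Delta> n)) (c n \<sigma>) (vertex_face 0) = \<sigma>" if "\<sigma> \<in> cmaps (\<Delta> n) K" for n \<sigma>
      using that by (auto simp: compose_def c_def vertex_face_def \<Delta>(2) cmaps_def extensional_def fun_eq_iff)
    moreover have "compose (pts (\<Delta> n)) (c n \<sigma>) (vertex_face (Suc i)) =
       (case n of 0 \<Rightarrow> (\<lambda>_\<in>pts (\<Delta> 0). v) | Suc m \<Rightarrow> c m (compose (pts (\<Delta> m)) \<sigma> (vertex_face i)))"
      if "i \<le> n" for n i \<sigma>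
      using that by (auto simp: compose_def c_def vertex_face_def \<Delta>(2) fun_eq_iff split: nat.split)
    ultimately show ?thesis
      unfolding simp_contractible_def using K(2) by (intro bexI[of _ v] exI[of _ c]) auto
  qed
  have cube_contr: "cube_contractible J K"
    if K: "relational R' K" "v \<in> pts K" "\<And>y. y \<in> pts K \<Longrightarrow> R' v y"
      and RK: "R = (\<le>) \<or> (\<forall>x\<in>pts K. \<forall>y\<in>pts K. R' x y)"
    for R' v and K :: "'k cspace"
  proof -
    define H where "H t y = (if t = 0 then v else y)" for t :: nat and y
    have "cube_cone H J n \<sigma> \<in> cmaps (cpower J (Suc n)) K" if \<sigma>: "\<sigma> \<in> cmaps (cpower J n) K" for n \<sigma>
    proof -
      note rJ = relational_cpower[OF J(1)]
      have s: "\<And>x. x \<in> pts (cpower J n) \<Longrightarrow> \<sigma> x \<in> pts K"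
        "\<And>x y. x \<in> pts (cpower J n) \<Longrightarrow> y \<in> pts (cpower J n) \<Longrightarrow> (\<forall>k\<in>{1..n}. R (x k) (y k)) \<Longrightarrow> R' (\<sigma> x) (\<sigma> y)"
        using \<sigma> ccontinuous_relational[OF rJ K(1)] by (auto simp: cmaps_def)
      let ?t = "\<lambda>x. \<lambda>k\<in>{1..n}. x (Suc k)"
      have t: "?t x \<in> pts (cpower J n)" if "x \<in> pts (cpower J (Suc n))" for x
        using that by (auto simp: pts_cpower)
      have "R' (H (x 1) (\<sigma> (?t x))) (H (y 1) (\<sigma> (?t y)))"
        if xy: "x \<in> pts (cpower J (Suc n))" "y \<in> pts (cpower J (Suc n))" "\<forall>k\<in>{1..Suc n}. R (x k) (y k)" for x y
      proof -
        have "R (x 1) (y 1)" using xy by auto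
        moreover have "R' (\<sigma> (?t x)) (\<sigma> (?t y))" using xy by (intro s(2) t) auto
        \<comment> \<open>The parameter can fall back to 0 along \<open>R\<close> only if
          \<open>R\<close> is total, and then \<open>RK\<close> relates any two points of
          \<open>K\<close>.\<close>
        moreover have "x 1 \<noteq> 0 \<Longrightarrow> y 1 = 0 \<Longrightarrow> R (x 1) (y 1) \<Longrightarrow> \<forall>x\<in>pts K. \<forall>y\<in>pts K. R' x y"
          using RK by auto
        moreover have "\<sigma> (?t x) \<in> pts K" "\<sigma> (?t y) \<in> pts K" using xy by (blast intro: s(1) t)+
        ultimately show ?thesis using K(2,3) by (auto simp: H_def)
      qed
      moreover have "H (x 1) (\<sigma> (?t x)) \<in> pts K" if "x \<in> pts (cpower J (Suc n))" for x
        using K(2) s(1) t that by (simp add: H_def)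
      ultimately show ?thesis
        unfolding cube_cone_def
        by (subst restrict_cmaps) (auto simp: ccontinuous_relational[OF rJ K(1)] intro: closure_space_relational[OF rJ])
    qed
    then show ?thesis
      unfolding cube_contractible_def using K(2) by (intro bexI[of _ v] exI[of _ H]) (auto simp: H_def)
  qed
  have RR: "R = (\<le>) \<or> (\<forall>x\<in>S. \<forall>y\<in>S. R x y)" for S using R by auto
  have RJ: "R = (\<le>) \<or> (\<forall>x\<in>S. \<forall>y\<in>S. \<forall>k\<in>{1..m}. R (x k) (y k))" for S :: "(nat \<Rightarrow> nat) set" and m using R by auto
  have 0: "0 \<in> pts (\<Delta> m)" "(\<lambda>k\<in>{1..m}. 0) \<in> pts (cpower J m)" for m
    by (simp_all add: \<Delta>(2) pts_cpower J(2))
  show ?thesis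
  proof
    show "ccontinuous (\<Delta> n) (\<Delta> (Suc n)) (vertex_face i)" if "i \<le> Suc n" for i n
      using R that by (auto simp: ccontinuous_relational[OF \<Delta>(1) \<Delta>(1)] \<Delta>(2) vertex_face_def)
    show "simp_contractible \<Delta> vertex_face (\<Delta> m)" "cube_contractible J (\<Delta> m)" for m
      using R_simps(1) by (auto intro: simp_contr[OF \<Delta>(1) 0(1) _ RR] cube_contr[OF \<Delta>(1) 0(1) _ RR])
    show "simp_contractible \<Delta> vertex_face (cpower J m)" "cube_contractible J (cpower J m)" for m
      using R_simps(1)
      by (auto intro!: simp_contr[OF relational_cpower[OF J(1)] 0(2) _ RJ] cube_contr[OF relational_cpower[OF J(1)] 0(2) _ RJ])
  qed (auto simp: J(2) vertex_face_def intro: closure_space_relational J \<Delta>)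
qed

lemma singular_model_J1: "singular_model interval_J1 simplex_J1 vertex_face"
  by (rule singular_model_nat[where R = "\<lambda>_ _. True"])
    (auto simp: relational_def interval_J1_def simplex_J1_def indiscrete_cspace_def)

lemma singular_model_Jplus: "singular_model interval_Jplus simplex_Jplus vertex_face"
  by (rule singular_model_nat[where R = "(\<le>)"])
    (auto simp: relational_def interval_Jplus_def simplex_Jplus_def le_Suc_eq)

section \<open>The unit interval\<close>

lemma cspace_of_sel [simp]:
  "pts (cspace_of T) = topspace T" "clo (cspace_of T) A = T closure_of A"
  by (simp_all add: cspace_of_def)

lemma closure_space_cspace_of: "closure_space (cspace_of T)"
  by (auto simp: closure_space_def closure_of_subset closure_of_subset_topspace closure_of_Un)

lemma ccontinuous_cspace_of: "ccontinuous (cspace_of S) (cspace_of T) f \<longleftrightarrow> continuous_map S T f"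
proof
  assume "continuous_map S T f"
  then show "ccontinuous (cspace_of S) (cspace_of T) f"
    unfolding ccontinuous_def cspace_of_sel
    by (auto simp: continuous_map_image_subset_topspace continuous_map_image_closure_subset)
next
  assume "ccontinuous (cspace_of S) (cspace_of T) f"
  then show "continuous_map S T f"
    unfolding ccontinuous_def cspace_of_sel continuous_map_eq_image_closure_subset_alt
    by (simp add: image_subset_iff_funcset)
qed

lemma cnbhd_cspace_of: "cnbhd (cspace_of T) x U \<longleftrightarrow> U \<subseteq> topspace T \<and> x \<in> T interior_of U"
  by (simp add: cnbhd_def cinterior_def interior_of_closure_of)

text \<open>A box of neighbourhoods contains the box of interiors, which is open because
  \<open>K\<close> is finite; conversely, open boxes form a base of the product topology.\<close>

lemma cprod_cspace_of:
  assumes "finite K"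
  shows "cprod K (\<lambda>k. cspace_of (T k)) = cspace_of (product_topology T K)"
proof -
  let ?P = "product_topology T K"
  have "x \<in> clo (cprod K (\<lambda>k. cspace_of (T k))) A \<longleftrightarrow> x \<in> ?P closure_of A" for x A
  proof
    assume x: "x \<in> clo (cprod K (\<lambda>k. cspace_of (T k))) A"
    then have xp: "x \<in> topspace ?P"
      unfolding clo_cprod by simp
    have "\<exists>y. y \<in> A \<and> y \<in> W" if W: "x \<in> W" "openin ?P W" for W
    proof -
      obtain U where U: "\<forall>k\<in>K. openin (T k) (U k)" "x \<in> Pi\<^sub>E K U" "Pi\<^sub>E K U \<subseteq> W"
        using W unfolding openin_product_topology_alt by meson
      have "Pi\<^sub>E K U \<inter> A \<noteq> {}"
      proof (rule clo_cprodD[OF x])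
        fix k assume k: "k \<in> K"
        then have "x k \<in> U k" using U(2) by auto
        then show "cnbhd (cspace_of (T k)) (x k) (U k)"
          using U(1) k by (simp add: cnbhd_cspace_of openin_subset interior_of_openin)
      qed
      then show ?thesis using U(3) by blast
    qed
    then show "x \<in> ?P closure_of A"
      using xp by (simp add: in_closure_of)
  next
    assume x: "x \<in> ?P closure_of A"
    then have xp: "x \<in> topspace ?P" by (simp add: in_closure_of)
    have "Pi\<^sub>E K U \<inter> A \<noteq> {}" if U: "\<forall>k\<in>K. cnbhd (cspace_of (T k)) (x k) (U k)" for U
    proof -
      let ?V = "\<lambda>k. T k interior_of U k"
      have "openin ?P (Pi\<^sub>E K ?V)" using assms by (simp add: openin_PiE_gen)
      moreover have "x \<in> Pi\<^sub>E K ?V"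
        using xp U by (auto simp: cnbhd_cspace_of PiE_iff)
      ultimately obtain y where "y \<in> A" "y \<in> Pi\<^sub>E K ?V"
        using x by (auto simp: in_closure_of)
      moreover have "Pi\<^sub>E K ?V \<subseteq> Pi\<^sub>E K U"
        by (intro PiE_mono interior_of_subset)
      ultimately show ?thesis by blast
    qed
    then show "x \<in> clo (cprod K (\<lambda>k. cspace_of (T k))) A"
      using xp unfolding clo_cprod by simp
  qed
  then have "clo (cprod K (\<lambda>k. cspace_of (T k))) = clo (cspace_of ?P)"
    by (intro ext) auto
  moreover have "pts (cprod K (\<lambda>k. cspace_of (T k))) = pts (cspace_of ?P)" by simp
  ultimately show ?thesis
    by (metis (full_types) cspace.equality old.unit.exhaust)
qed

section \<open>Straight-line contractions of cubes and topological simplices\<close>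

abbreviation "cube_top n \<equiv> product_topology (\<lambda>_. top_of_set {0..1::real}) {1..n::nat}"
abbreviation "simplex_top n \<equiv> subtopology (powertop_real UNIV) (standard_simplex n)"

lemma cpower_I: "cpower interval_I n = cspace_of (cube_top n)"
  unfolding cpower_def interval_I_def by (rule cprod_cspace_of) simp

lemma cmaps_cspace_of: "restrict f (topspace S) \<in> cmaps (cspace_of S) (cspace_of T) \<longleftrightarrow> continuous_map S T f"
  using restrict_cmaps[OF closure_space_cspace_of[of S], of f "cspace_of T"] by (simp add: ccontinuous_cspace_of)

lemma cmaps_cspace_of_iff:
  "f \<in> cmaps (cspace_of S) (cspace_of T) \<longleftrightarrow> f \<in> extensional (topspace S) \<and> continuous_map S T f"
  by (simp add: cmaps_def ccontinuous_cspace_of)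

text \<open>Projection from vertex 0 onto the opposite face, in the coordinates of that face; it is
  undefined at the vertex itself.\<close>

lemma standard_simplex_rescaled_tail:
  assumes "x \<in> standard_simplex (Suc n)" "x 0 \<noteq> 1"
  shows "(\<lambda>i. x (Suc i) / (1 - x 0)) \<in> standard_simplex n"
proof -
  have x: "\<And>i. 0 \<le> x i" "\<And>i. x i \<le> 1" "\<And>i. i > Suc n \<Longrightarrow> x i = 0" "(\<Sum>i\<le>Suc n. x i) = 1"
    using assms by (auto simp: standard_simplex_def)
  have pos: "1 - x 0 > 0" using x(2)[of 0] assms(2) by simp
  have sum: "(\<Sum>i\<le>n. x (Suc i)) = 1 - x 0"
    using x(4) by (subst (asm) sum.atMost_Suc_shift) simp
  have "x (Suc i) \<le> 1 - x 0" for i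
  proof (cases "i \<le> n")
    case True
    then have "x (Suc i) \<le> (\<Sum>i\<le>n. x (Suc i))"
      using x(1) by (intro member_le_sum) auto
    then show ?thesis using sum by simp
  qed (use x(3) pos in auto)
  moreover have "(\<Sum>i\<le>n. x (Suc i) / (1 - x 0)) = 1"
    using sum pos by (simp flip: sum_divide_distrib)
  ultimately show ?thesis
    using x pos by (auto simp: standard_simplex_def)
qed

text \<open>Covers the topological simplices (\<open>L = UNIV\<close>) and the cubes (\<open>L = {1..m}\<close>, where points are
  \<open>undefined\<close> off \<open>L\<close>).\<close>

locale convex_space =
  fixes T :: "(nat \<Rightarrow> real) topology" and L :: "nat set" and v :: "nat \<Rightarrow> real"
  assumes continuous_map_into: "\<And>(S :: (nat \<Rightarrow> real) topology) f. continuous_map S T f \<longleftrightarrow>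
      f \<in> topspace S \<rightarrow> topspace T \<and> (\<forall>k\<in>L. continuous_map S euclideanreal (\<lambda>x. f x k))"
    and v: "v \<in> topspace T"
    and bounds: "y \<in> topspace T \<Longrightarrow> k \<in> L \<Longrightarrow> 0 \<le> y k \<and> y k \<le> 1"
    and off: "y \<in> topspace T \<Longrightarrow> k \<notin> L \<Longrightarrow> y k = undefined"
    and convex: "y \<in> topspace T \<Longrightarrow> 0 \<le> t \<Longrightarrow> t \<le> 1 \<Longrightarrow>
      (\<lambda>k. if k \<in> L then (1 - t) * v k + t * y k else undefined) \<in> topspace T"
begin

definition "comb t y = (\<lambda>k. if k \<in> L then (1 - t) * v k + t * y k else undefined)"

lemma comb_in: "y \<in> topspace T \<Longrightarrow> 0 \<le> t \<Longrightarrow> t \<le> 1 \<Longrightarrow> comb t y \<in> topspace T"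
  unfolding comb_def by (rule convex)

lemma comb_0: "comb 0 y = v"
  using off[OF v] by (auto simp: comb_def fun_eq_iff)

lemma comb_1: "y \<in> topspace T \<Longrightarrow> comb 1 y = y"
  by (rule ext) (simp add: comb_def off)

lemma cube_contractible_I: "cube_contractible interval_I (cspace_of T)"
proof -
  have "cube_cone comb interval_I n \<sigma> \<in> cmaps (cpower interval_I (Suc n)) (cspace_of T)"
    if \<sigma>: "\<sigma> \<in> cmaps (cpower interval_I n) (cspace_of T)" for n \<sigma>
  proof -
    let ?C = "cube_top (Suc n)" and ?t = "\<lambda>x::nat \<Rightarrow> real. \<lambda>k\<in>{1..n}. x (Suc k)"
    have \<sigma>: "continuous_map (cube_top n) T \<sigma>"
      using \<sigma> by (simp add: cpower_I cmaps_cspace_of_iff)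
    have t: "continuous_map ?C (cube_top n) ?t"
      unfolding continuous_map_componentwise
    proof (intro conjI ballI)
      fix k assume k: "k \<in> {1..n}"
      then have "continuous_map ?C (top_of_set {0..1}) (\<lambda>x. x (Suc k))"
        by (intro continuous_map_product_projection) simp
      then show "continuous_map ?C (top_of_set {0..1}) (\<lambda>x. ?t x k)" using k by simp
    qed auto
    have 1: "continuous_map ?C euclideanreal (\<lambda>x. x 1)"
    proof (rule continuous_map_into_fulltopology)
      show "continuous_map ?C (top_of_set {0..1}) (\<lambda>x. x 1)"
        by (intro continuous_map_product_projection) simp
    qed
    have st: "continuous_map ?C T (\<lambda>x. \<sigma> (?t x))"
      using continuous_map_compose[OF t \<sigma>] by (simp add: comp_def)
    have "continuous_map ?C T (\<lambda>x. comb (x 1) (\<sigma> (?t x)))"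
      unfolding continuous_map_into
    proof (intro conjI ballI funcsetI)
      fix x assume x: "x \<in> topspace ?C"
      then have "0 \<le> x 1" "x 1 \<le> 1" by (auto simp: PiE_iff)
      moreover have "\<sigma> (?t x) \<in> topspace T" using continuous_map_funspace[OF st] x by blast
      ultimately show "comb (x 1) (\<sigma> (?t x)) \<in> topspace T" by (intro comb_in)
    next
      fix k assume k: "k \<in> L"
      then have "continuous_map ?C euclideanreal (\<lambda>x. \<sigma> (?t x) k)"
        using st unfolding continuous_map_into by blast
      then show "continuous_map ?C euclideanreal (\<lambda>x. comb (x 1) (\<sigma> (?t x)) k)"
        unfolding comb_def if_P[OF k]
        by (intro continuous_map_add continuous_map_diff continuous_map_real_mult continuous_map_canonical_const 1)
    qed
    then show ?thesis
      unfolding cube_cone_def cpower_I cspace_of_sel cmaps_cspace_of by simp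
  qed
  then show ?thesis
    unfolding cube_contractible_def using v comb_0 comb_1
    by (intro bexI[of _ v] exI[of _ comb]) auto
qed

text \<open>Away from vertex 0 the formula is built from continuous maps. The projection has no
  limit at the vertex, but coordinates of points of \<open>T\<close> lie in the unit interval, so
  each coordinate of the cone is within \<open>1 - x 0\<close> of the apex.\<close>

lemma simplex_cone_continuous:
  assumes \<sigma>: "continuous_map (simplex_top n) T \<sigma>"
  shows "continuous_map (simplex_top (Suc n)) T (\<lambda>x. comb (1 - x 0) (\<sigma> (\<lambda>i. x (Suc i) / (1 - x 0))))"
  unfolding continuous_map_into
proof (intro conjI ballI funcsetI)
  let ?\<tau> = "\<lambda>x i. x (Suc i) / (1 - x 0 :: real)"
  have \<sigma>T: "\<sigma> (?\<tau> x) \<in> topspace T" if "x \<in> standard_simplex (Suc n)" "x 0 \<noteq> 1" for x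
    using continuous_map_funspace[OF \<sigma>] standard_simplex_rescaled_tail[OF that] by auto
  show "comb (1 - x 0) (\<sigma> (?\<tau> x)) \<in> topspace T" if "x \<in> topspace (simplex_top (Suc n))" for x
  proof (cases "x 0 = 1")
    \<comment> \<open>Here the projection divides by zero and \<open>\<sigma>\<close> may be
      evaluated outside the simplex; \<open>comb 0\<close> ignores its second argument.\<close>
    case True
    then show ?thesis using v by (simp add: comb_0)
  next
    case False
    then show ?thesis using that by (intro comb_in \<sigma>T) (auto simp: standard_simplex_def)
  qed
  fix k assume k: "k \<in> L"
  let ?S = "standard_simplex (Suc n)" and ?U = "{x :: nat \<Rightarrow> real. x 0 < 1}"
  let ?f = "\<lambda>x. \<sigma> (?\<tau> x) k"
  let ?g = "\<lambda>x. comb (1 - x 0) (\<sigma> (?\<tau> x)) k"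
  have g: "?g x = x 0 * v k + (1 - x 0) * ?f x" for x
    using k by (simp add: comb_def)
  have coord: "continuous_on A (\<lambda>x. x i)" for i and A :: "(nat \<Rightarrow> real) set"
    by (rule continuous_on_subset[OF continuous_on_product_coordinates subset_UNIV])
  have U: "open ?U"
    by (intro open_Collect_less coord continuous_on_const)
  have "continuous_map (top_of_set (?S \<inter> ?U)) (simplex_top n) ?\<tau>"
    unfolding continuous_map_in_subtopology continuous_map_componentwise_UNIV
  proof (intro conjI allI)
    show "continuous_map (top_of_set (?S \<inter> ?U)) euclideanreal (\<lambda>x. ?\<tau> x i)" for i
      by (simp, intro continuous_on_divide continuous_on_diff continuous_on_const coord) auto
  qed (auto intro: standard_simplex_rescaled_tail)
  then have "continuous_map (top_of_set (?S \<inter> ?U)) T (\<sigma> \<circ> ?\<tau>)"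
    using \<sigma> by (rule continuous_map_compose)
  then have "continuous_on (?S \<inter> ?U) ?f"
    using k unfolding continuous_map_into by (simp add: comp_def)
  then have gU: "continuous_on (?S \<inter> ?U) ?g"
    unfolding g by (intro continuous_intros coord)
  have "continuous_on ?S ?g"
    unfolding continuous_on_eq_continuous_within
  proof
    fix x assume x: "x \<in> ?S"
    show "continuous (at x within ?S) ?g"
    proof (cases "x 0 < 1")
      case True
      then have "continuous (at x within ?S \<inter> ?U) ?g"
        using gU x unfolding continuous_on_eq_continuous_within by blast
      moreover have "at x within ?S \<inter> ?U = at x within ?S"
        using True by (intro at_within_nhd[of _ ?U] U) auto
      ultimately show ?thesis by simp
    next
      case False
      then have x0: "x 0 = 1" using x by (auto simp: standard_simplex_def intro: antisym)
      have "((\<lambda>y. ?g y - v k) \<longlongrightarrow> 0) (at x within ?S)"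
      proof (rule Lim_null_comparison)
        show "\<forall>\<^sub>F y in at x within ?S. norm (?g y - v k) \<le> 1 - y 0"
          unfolding eventually_at_filter
        proof (intro always_eventually allI impI)
          fix y assume y: "y \<in> ?S"
          have y0: "0 \<le> 1 - y 0" using y by (auto simp: standard_simplex_def)
          have "\<bar>1 - y 0\<bar> * \<bar>?f y - v k\<bar> \<le> (1 - y 0) * 1"
          \<comment> \<open>For \<open>y 0 = 1\<close> nothing is known about \<open>?f y\<close>,
            but the factor in front of it is zero.\<close>
          proof (cases "y 0 = 1")
            case False
            then have "\<bar>?f y - v k\<bar> \<le> 1"
              using bounds[OF \<sigma>T[OF y] k] bounds[OF v k] by (auto simp: abs_le_iff)
            then show ?thesis using y0 by (intro mult_mono) auto
          qed simp
          moreover have "?g y - v k = (1 - y 0) * (?f y - v k)"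
            unfolding g by (simp add: algebra_simps)
          ultimately show "norm (?g y - v k) \<le> 1 - y 0"
            by (simp add: abs_mult)
        qed
        have "((\<lambda>y. y 0) \<longlongrightarrow> x 0) (at x within ?S)"
          using coord[of ?S 0] x unfolding continuous_on_def by blast
        then show "((\<lambda>y. 1 - y 0) \<longlongrightarrow> 0) (at x within ?S)"
          using tendsto_diff[OF tendsto_const[of 1]] x0 by fastforce
      qed
      then have "(?g \<longlongrightarrow> v k) (at x within ?S)"
        by (simp add: LIM_zero_iff)
      then show ?thesis
        using x0 unfolding continuous_within by (simp add: comb_0)
    qed
  qed
  then show "continuous_map (simplex_top (Suc n)) euclideanreal ?g"
    by (simp add: euclidean_product_topology)
qed

lemma simp_contractible_I: "simp_contractible simplex_I simplical_face (cspace_of T)"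
proof -
  define c where "c n \<sigma> = (\<lambda>x\<in>standard_simplex (Suc n). comb (1 - x 0) (\<sigma> (\<lambda>i. x (Suc i) / (1 - x 0))))"
    for n :: nat and \<sigma> :: "(nat \<Rightarrow> real) \<Rightarrow> nat \<Rightarrow> real"
  have pts: "pts (simplex_I n) = standard_simplex n" for n
    by (simp add: simplex_I_def)
  have face: "simplical_face i y \<in> standard_simplex (Suc n)" if "i \<le> Suc n" "y \<in> standard_simplex n" for i y n
    using simplical_face_in_standard_simplex[of "Suc n" i y] that by simp
  have "c n \<sigma> \<in> cmaps (simplex_I (Suc n)) (cspace_of T)" if "\<sigma> \<in> cmaps (simplex_I n) (cspace_of T)" for n \<sigma>
    using simplex_cone_continuous[of n \<sigma>] that cmaps_cspace_of[of _ "simplex_top (Suc n)" T]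
    unfolding simplex_I_def c_def by (simp add: cmaps_cspace_of_iff)
  moreover have "compose (pts (simplex_I n)) (c n \<sigma>) (simplical_face 0) = \<sigma>"
    if \<sigma>: "\<sigma> \<in> cmaps (simplex_I n) (cspace_of T)" for n \<sigma>
  proof
    fix y
    have "\<sigma> y \<in> topspace T" if "y \<in> standard_simplex n"
      using \<sigma> that continuous_map_funspace[of "simplex_top n" T \<sigma>]
      by (auto simp: simplex_I_def cmaps_cspace_of_iff)
    then show "compose (pts (simplex_I n)) (c n \<sigma>) (simplical_face 0) y = \<sigma> y"
      using \<sigma> face[of 0 n y]
      by (auto simp: pts compose_def c_def simplical_face_def comb_1 cmaps_def extensional_def)
  qed
  moreover have "compose (pts (simplex_I n)) (c n \<sigma>) (simplical_face (Suc i)) =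
       (case n of 0 \<Rightarrow> (\<lambda>_\<in>pts (simplex_I 0). v) | Suc m \<Rightarrow> c m (compose (pts (simplex_I m)) \<sigma> (simplical_face i)))"
    if i: "i \<le> n" for n i \<sigma>
  proof (cases n)
    case 0
    then show ?thesis
      using i face[of "Suc 0" 0] by (auto simp: pts compose_def c_def standard_simplex_0 simplical_face_def comb_0 fun_eq_iff)
  next
    case (Suc m)
    have "c n \<sigma> (simplical_face (Suc i) y) = c m (compose (pts (simplex_I m)) \<sigma> (simplical_face i)) y"
      if y: "y \<in> standard_simplex n" for y
    proof -
      let ?z = "\<lambda>j. y (Suc j) / (1 - y 0)"
      \<comment> \<open>The zero is inserted behind coordinate 0, so dropping that coordinate shifts
        its place by one, and rescaling leaves it zero.\<close>
      have "(\<lambda>j. simplical_face (Suc i) y (Suc j) / (1 - simplical_face (Suc i) y 0)) = simplical_face i ?z"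
        by (auto simp: simplical_face_def fun_eq_iff)
      then have "c n \<sigma> (simplical_face (Suc i) y) = comb (1 - y 0) (\<sigma> (simplical_face i ?z))"
        using face[of "Suc i" n y] i y by (simp add: c_def) (simp add: simplical_face_def)
      also have "\<dots> = c m (compose (pts (simplex_I m)) \<sigma> (simplical_face i)) y"
        \<comment> \<open>At \<open>y 0 = 1\<close> the point \<open>?z\<close> is not in the
          simplex and the restricted composite is \<open>undefined\<close> there; both sides are the
          apex by \<open>comb_0\<close>.\<close>
        using y standard_simplex_rescaled_tail[of y m] Suc
        by (cases "y 0 = 1") (simp_all add: c_def compose_def pts comb_0)
      finally show ?thesis .
    qed
    then show ?thesis
      using Suc by (auto simp: compose_def pts fun_eq_iff) (simp add: c_def)
  qed
  ultimately show ?thesis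
    unfolding simp_contractible_def using v by (intro bexI[of _ v] exI[of _ c]) auto
qed

end

lemma convex_space_cube: "convex_space (cube_top m) {1..m} (\<lambda>k\<in>{1..m}. 0)"
proof
  show "continuous_map S (cube_top m) f \<longleftrightarrow> f \<in> topspace S \<rightarrow> topspace (cube_top m) \<and>
      (\<forall>k\<in>{1..m}. continuous_map S euclideanreal (\<lambda>x. f x k))" for S :: "(nat \<Rightarrow> real) topology" and f
    unfolding continuous_map_componentwise continuous_map_in_subtopology
    by (auto simp: Pi_iff PiE_iff)
qed (auto simp: PiE_iff extensional_def mult_le_one)

lemma convex_space_simplex: "convex_space (simplex_top m) UNIV (\<lambda>k. if k = 0 then 1 else 0)"
proof
  show "continuous_map S (simplex_top m) f \<longleftrightarrow> f \<in> topspace S \<rightarrow> topspace (simplex_top m) \<and>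
      (\<forall>k\<in>UNIV. continuous_map S euclideanreal (\<lambda>x. f x k))" for S :: "(nat \<Rightarrow> real) topology" and f
    unfolding continuous_map_componentwise_UNIV continuous_map_in_subtopology by auto
  have v: "(\<lambda>k. if k = 0 then 1 else 0) \<in> standard_simplex m" by simp
  show "(\<lambda>k. if k \<in> UNIV then (1 - t) * (if k = 0 then 1 else 0) + t * y k else undefined) \<in> topspace (simplex_top m)"
    if "y \<in> topspace (simplex_top m)" "0 \<le> t" "t \<le> 1" for y t
    using convex_standard_simplex[OF v, of y t] that by simp
qed (auto simp: standard_simplex_def)

lemma continuous_map_simplical_face:
  assumes "i \<le> Suc n"
  shows "continuous_map (simplex_top n) (simplex_top (Suc n)) (simplical_face i)"
  unfolding continuous_map_in_subtopology continuous_map_componentwise_UNIV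
proof (intro conjI allI)
  have "continuous_map (simplex_top n) euclideanreal (\<lambda>x. x k)" for k
    by (intro continuous_map_from_subtopology continuous_map_product_projection) simp
  then show "continuous_map (simplex_top n) euclideanreal (\<lambda>x. simplical_face i x k)" for k
    by (simp add: simplical_face_def)
qed (use assms simplical_face_in_standard_simplex[of "Suc n" i] in auto)

lemma singular_model_I: "singular_model interval_I simplex_I simplical_face"
proof
  \<comment> \<open>Reduces the simplicial face identity to that for inserted coordinates, with both
    inserted values zero.\<close>
  have face_eq: "simplical_face i x = insert_coord i 0 x" for i and x :: "nat \<Rightarrow> real"
    by (simp add: simplical_face_def insert_coord_def)
  show "closure_space interval_I" "closure_space (simplex_I n)" for n
    by (simp_all add: interval_I_def simplex_I_def closure_space_cspace_of)
  show "0 \<in> pts interval_I" "1 \<in> pts interval_I" by (simp_all add: interval_I_def)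
  show "i \<le> Suc n \<Longrightarrow> ccontinuous (simplex_I n) (simplex_I (Suc n)) (simplical_face i)" for i n
    by (simp add: simplex_I_def ccontinuous_cspace_of continuous_map_simplical_face)
  show "simplical_face j (simplical_face i x) = simplical_face i (simplical_face (j - 1) x)"
    if "i < j" for i j and x :: "nat \<Rightarrow> real"
    using insert_coord_insert_coord[OF that, of 0 0 x] unfolding face_eq by simp
  show "simp_contractible simplex_I simplical_face (simplex_I m)" "cube_contractible interval_I (simplex_I m)" for m
    using convex_space.simp_contractible_I[OF convex_space_simplex] convex_space.cube_contractible_I[OF convex_space_simplex]
    by (simp_all add: simplex_I_def)
  show "simp_contractible simplex_I simplical_face (cpower interval_I m)" "cube_contractible interval_I (cpower interval_I m)" for m
    using convex_space.simp_contractible_I[OF convex_space_cube] convex_space.cube_contractible_I[OF convex_space_cube]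
    by (simp_all add: cpower_I)
qed

theorem theorem6p2:
  fixes X :: "'a cspace" and G :: "('g, 'm) monoid_scheme"
  assumes "closure_space X" and "comm_group G"
  shows
    "cochain_homotopy_equivalent
       (Hom_complex (simplicial_chains simplex_I simplical_face X) G)
       (Hom_complex (cubical_chains interval_I X) G) \<and>
     cochain_homotopy_equivalent
       (Hom_complex (simplicial_chains simplex_J1 vertex_face X) G)
       (Hom_complex (cubical_chains interval_J1 X) G) \<and>
     cochain_homotopy_equivalent
       (Hom_complex (simplicial_chains simplex_Jplus vertex_face X) G)
       (Hom_complex (cubical_chains interval_Jplus X) G)"
  using singular_model.Hom_simplicial_cubical_equivalent[OF singular_model_I assms(2)]
    singular_model.Hom_simplicial_cubical_equivalent[OF singular_model_J1 assms(2)]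
    singular_model.Hom_simplicial_cubical_equivalent[OF singular_model_Jplus assms(2)]
  by blast

end
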